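(* Let $g\ge 1$ and let $\Gamma\subset \mathrm{Sp}(2g,\mathbb{Z})$ be a neat subgroup of finite index. Let $k,m$ be positive integers. Then the graded $\mathbb{C}$-algebra $\bigoplus_{\ell\ge 0} J_{\ell k,\ell m}(\Gamma)$ (with multiplication given by the product of functions) is not finitely generated.
   Context: $\mathcal{H}_g$ denotes the Siegel upper half space of complex symmetric $g\times g$ matrices $Z$ with positive definite imaginary part; $\mathbb{C}^{(1,g)}$ denotes row vectors of length $g$. A subgroup $\Gamma\subset \mathrm{Sp}(2g,\mathbb{Z})$ is neat if for every $M\in\Gamma$ the subgroup of $\mathbb{C}^\times$ generated by the eigenvalues of $M$ is torsion free. For integers $k$, $m\ge 0$, a holomorphic $\phi\colon\mathcal{H}_g\times\mathbb{C}^{(1,g)}\to\mathbb{C}$ and $M=\begin{pmatrix}A&B\\C&D\end{pmatrix}\in\mathrm{Sp}(2g,\mathbb{R})$, put $(\phi|_{k,m}M)(Z,W)=\det(CZ+D)^{-k}e^{-2\pi i m W(CZ+D)^{-1}CW^t}\phi((AZ+B)(CZ+D)^{-1},W(CZ+D)^{-1})$, and for $\lambda,\mu\in\mathbb{Z}^{(1,g)}$, $x\in\mathbb{Z}$, put $(\phi|_{k,m}[(\lambda,\mu),x])(Z,W)=e^{2\pi i m(\lambda Z\lambda^t+2\lambda W^t+x+\mu\lambda^t)}\phi(Z,W+\lambda Z+\mu)$. A Siegel--Jacobi form of weight $k$ and index $m$ for $\Gamma$ is a holomorphic $\phi$ such that (1) $\phi|_{k,m}M=\phi$ for all $M\in\Gamma$;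 (2) $\phi|_{k,m}[(\lambda,\mu),x]=\phi$ for all $\lambda,\mu\in\mathbb{Z}^{(1,g)}$, $x\in\mathbb{Z}$; (3) for every $M\in\mathrm{Sp}(2g,\mathbb{Z})$, $\phi|_{k,m}M$ has a Fourier expansion $\sum_{T}\sum_{R\in\mathbb{Z}^{(g,1)}}c(T,R)e^{2\pi i\,\mathrm{tr}(TZ)/\lambda_\Gamma}e^{2\pi i WR}$, the sum over symmetric positive semidefinite half-integral $T$ (i.e. $2T$ integral with integral diagonal), for some integer $\lambda_\Gamma>0$, such that $c(T,R)\neq 0$ implies $\begin{pmatrix}T/\lambda_\Gamma & R/2\\ R^t/2 & m\end{pmatrix}\ge 0$. $J_{k,m}(\Gamma)$ denotes the complex vector space of such forms. *)

theory Defs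
  imports "HOL-Analysis.Analysis"
begin

text \<open>A 2g x 2g matrix is indexed by the finite type 'g + 'g; Inl indices form the
first block of g coordinates, Inr the second.\<close>

definition Jmat :: "int ^ ('g::finite + 'g) ^ ('g + 'g)" where
  "Jmat = (\<chi> i j. (case (i, j) of
      (Inl a, Inr b) \<Rightarrow> (if a = b then 1 else 0)
    | (Inr a, Inl b) \<Rightarrow> (if a = b then -1 else 0)
    | _ \<Rightarrow> 0))"

definition Sp_Z :: "(int ^ ('g::finite + 'g) ^ ('g + 'g)) set" where
  "Sp_Z = {M. transpose M ** Jmat ** M = Jmat}"

definition blkA :: "int ^ ('g::finite + 'g) ^ ('g + 'g) \<Rightarrow> complex ^ 'g ^ 'g" where
  "blkA M = (\<chi> i j. of_int (M $ Inl i $ Inl j))"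
definition blkB :: "int ^ ('g::finite + 'g) ^ ('g + 'g) \<Rightarrow> complex ^ 'g ^ 'g" where
  "blkB M = (\<chi> i j. of_int (M $ Inl i $ Inr j))"
definition blkC :: "int ^ ('g::finite + 'g) ^ ('g + 'g) \<Rightarrow> complex ^ 'g ^ 'g" where
  "blkC M = (\<chi> i j. of_int (M $ Inr i $ Inl j))"
definition blkD :: "int ^ ('g::finite + 'g) ^ ('g + 'g) \<Rightarrow> complex ^ 'g ^ 'g" where
  "blkD M = (\<chi> i j. of_int (M $ Inr i $ Inr j))"

definition is_subgroup_Sp :: "(int ^ ('g::finite + 'g) ^ ('g + 'g)) set \<Rightarrow> bool" where
  "is_subgroup_Sp \<Gamma> \<longleftrightarrow> \<Gamma> \<subseteq> Sp_Z \<and> mat 1 \<in> \<Gamma>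
     \<and> (\<forall>A\<in>\<Gamma>. \<forall>B\<in>\<Gamma>. A ** B \<in> \<Gamma>)
     \<and> (\<forall>A\<in>\<Gamma>. \<exists>B\<in>\<Gamma>. A ** B = mat 1)"

definition finite_index_Sp :: "(int ^ ('g::finite + 'g) ^ ('g + 'g)) set \<Rightarrow> bool" where
  "finite_index_Sp \<Gamma> \<longleftrightarrow> (\<exists>F. finite F \<and> F \<subseteq> Sp_Z \<and>
      (\<forall>M\<in>Sp_Z. \<exists>f\<in>F. \<exists>\<gamma>\<in>\<Gamma>. M = f ** \<gamma>))"

definition eigenvalues_Z :: "int ^ ('n::finite) ^ 'n \<Rightarrow> complex set" where
  "eigenvalues_Z M = {z. det (mat z - ((\<chi> i j. of_int (M $ i $ j)) :: complex ^ 'n ^ 'n)) = 0}"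

inductive_set mult_group_gen :: "complex set \<Rightarrow> complex set" for E where
  one: "1 \<in> mult_group_gen E"
| mul: "x \<in> mult_group_gen E \<Longrightarrow> e \<in> E \<Longrightarrow> x * e \<in> mult_group_gen E"
| div: "x \<in> mult_group_gen E \<Longrightarrow> e \<in> E \<Longrightarrow> x / e \<in> mult_group_gen E"

definition torsion_free :: "complex set \<Rightarrow> bool" where
  "torsion_free G \<longleftrightarrow> (\<forall>z\<in>G. \<forall>n::nat. n > 0 \<and> z ^ n = 1 \<longrightarrow> z = 1)"

definition neat :: "(int ^ ('g::finite + 'g) ^ ('g + 'g)) set \<Rightarrow> bool" where
  "neat \<Gamma> \<longleftrightarrow> (\<forall>M\<in>\<Gamma>. torsion_free (mult_group_gen (eigenvalues_Z M)))"

definition siegel_H :: "(complex ^ ('g::finite) ^ 'g) set" where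
  "siegel_H = {Z. transpose Z = Z \<and>
     (\<forall>x::real ^ 'g. x \<noteq> 0 \<longrightarrow> (\<Sum>i\<in>UNIV. \<Sum>j\<in>UNIV. x $ i * Im (Z $ i $ j) * x $ j) > 0)}"

definition cmul_pair :: "complex \<Rightarrow> (complex ^ 'g ^ 'g) \<times> (complex ^ 'g) \<Rightarrow> (complex ^ 'g ^ 'g) \<times> (complex ^ 'g)" where
  "cmul_pair c p = ((\<chi> i j. c * fst p $ i $ j), (\<chi> i. c * snd p $ i))"

text \<open>Holomorphy on H_g x C^g: at every point a complex-linear (Frechet) derivative relative
to the domain, which is an open subset of the complex vector space Sym_g(C) x C^g.\<close>
definition holo_HC :: "(complex ^ 'g ^ 'g \<Rightarrow> complex ^ 'g \<Rightarrow> complex) \<Rightarrow> bool" where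
  "holo_HC \<phi> \<longleftrightarrow> (\<forall>p \<in> siegel_H \<times> UNIV. \<exists>L.
      ((\<lambda>q. \<phi> (fst q) (snd q)) has_derivative L) (at p within (siegel_H \<times> UNIV)) \<and>
      (\<forall>v. L (cmul_pair \<i> v) = \<i> * L v))"

definition rowdot :: "complex ^ 'g \<Rightarrow> complex ^ 'g \<Rightarrow> complex" where
  "rowdot a b = (\<Sum>i\<in>UNIV. a $ i * b $ i)"

definition e2pi :: "complex \<Rightarrow> complex" where
  "e2pi z = exp (2 * of_real pi * \<i> * z)"

definition slash :: "int \<Rightarrow> nat \<Rightarrow> int ^ ('g::finite + 'g) ^ ('g + 'g)
     \<Rightarrow> (complex ^ 'g ^ 'g \<Rightarrow> complex ^ 'g \<Rightarrow> complex)
     \<Rightarrow> (complex ^ 'g ^ 'g \<Rightarrow> complex ^ 'g \<Rightarrow> complex)" where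
  "slash k m M \<phi> = (\<lambda>Z W.
     let A = blkA M; B = blkB M; C = blkC M; D = blkD M;
         N = matrix_inv (C ** Z + D)
     in det (C ** Z + D) powi (- k)
        * exp (- 2 * of_real pi * \<i> * of_nat m * rowdot (W v* N) (C *v W))
        * \<phi> ((A ** Z + B) ** N) (W v* N))"

definition heis_slash :: "nat \<Rightarrow> int ^ 'g \<Rightarrow> int ^ 'g \<Rightarrow> int
     \<Rightarrow> (complex ^ 'g ^ 'g \<Rightarrow> complex ^ 'g \<Rightarrow> complex)
     \<Rightarrow> (complex ^ 'g ^ 'g \<Rightarrow> complex ^ 'g \<Rightarrow> complex)" where
  "heis_slash m lam mu x \<phi> = (\<lambda>Z W.
     let l = ((\<chi> i. of_int (lam $ i)) :: complex ^ 'g); u = ((\<chi> i. of_int (mu $ i)) :: complex ^ 'g)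
     in e2pi (of_nat m * (rowdot (l v* Z) l + 2 * rowdot l W + of_int x + rowdot u l))
        * \<phi> Z (W + l v* Z + u))"

definition half_integral_psd :: "real ^ 'g ^ 'g \<Rightarrow> bool" where
  "half_integral_psd T \<longleftrightarrow> transpose T = T \<and>
     (\<forall>i j. 2 * T $ i $ j \<in> \<int>) \<and> (\<forall>i. T $ i $ i \<in> \<int>) \<and>
     (\<forall>x::real ^ 'g. (\<Sum>i\<in>UNIV. \<Sum>j\<in>UNIV. x $ i * T $ i $ j * x $ j) \<ge> 0)"

definition fourier_index :: "((real ^ ('g::finite) ^ 'g) \<times> (real ^ 'g)) set" where
  "fourier_index = {(T, R). half_integral_psd T \<and> (\<forall>i. R $ i \<in> \<int>)}"

text \<open>The block matrix ((T/lam, R/2), (R^t/2, m)) is positive semidefinite.\<close>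
definition block_psd :: "nat \<Rightarrow> nat \<Rightarrow> real ^ 'g ^ 'g \<Rightarrow> real ^ 'g \<Rightarrow> bool" where
  "block_psd lam m T R \<longleftrightarrow> (\<forall>(x::real ^ 'g) (y::real).
     (\<Sum>i\<in>UNIV. \<Sum>j\<in>UNIV. x $ i * (T $ i $ j / real lam) * x $ j)
     + 2 * (\<Sum>i\<in>UNIV. x $ i * (R $ i / 2) * y) + real m * y * y \<ge> 0)"

definition has_fourier_exp :: "nat \<Rightarrow> (complex ^ 'g ^ 'g \<Rightarrow> complex ^ 'g \<Rightarrow> complex) \<Rightarrow> bool" where
  "has_fourier_exp m \<psi> \<longleftrightarrow> (\<exists>(lam::nat) c. lam > 0 \<and>
     (\<forall>Z\<in>siegel_H. \<forall>W.
        ((\<lambda>(T, R). c T R * e2pi ((\<Sum>i\<in>UNIV. \<Sum>j\<in>UNIV. of_real (T $ i $ j) * Z $ j $ i) / of_nat lam)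
                      * e2pi (\<Sum>i\<in>UNIV. W $ i * of_real (R $ i)))
          has_sum \<psi> Z W) fourier_index) \<and>
     (\<forall>(T, R) \<in> fourier_index. c T R \<noteq> 0 \<longrightarrow> block_psd lam m T R))"

text \<open>Forms are functions on H_g x C^g; as a normalization (so that equality of forms is
equality of functions) they are required to vanish for Z outside H_g.\<close>
definition jacobi_forms :: "int \<Rightarrow> nat \<Rightarrow> (int ^ ('g::finite + 'g) ^ ('g + 'g)) set
     \<Rightarrow> (complex ^ 'g ^ 'g \<Rightarrow> complex ^ 'g \<Rightarrow> complex) set" where
  "jacobi_forms k m \<Gamma> = {\<phi>.
     (\<forall>Z W. Z \<notin> siegel_H \<longrightarrow> \<phi> Z W = 0) \<and>
     holo_HC \<phi> \<and>
     (\<forall>M\<in>\<Gamma>. \<forall>Z\<in>siegel_H. \<forall>W. slash k m M \<phi> Z W = \<phi> Z W) \<and>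
     (\<forall>lam mu x. \<forall>Z\<in>siegel_H. \<forall>W. heis_slash m lam mu x \<phi> Z W = \<phi> Z W) \<and>
     (\<forall>M\<in>Sp_Z. has_fourier_exp m (slash k m M \<phi>))}"

type_synonym 'g graded_elt = "nat \<Rightarrow> complex ^ 'g ^ 'g \<Rightarrow> complex ^ 'g \<Rightarrow> complex"

definition jacobi_algebra :: "nat \<Rightarrow> nat \<Rightarrow> (int ^ ('g::finite + 'g) ^ ('g + 'g)) set
     \<Rightarrow> 'g graded_elt set" where
  "jacobi_algebra k m \<Gamma> = {F.
     (\<forall>l. F l \<in> jacobi_forms (int (l * k)) (l * m) \<Gamma>) \<and>
     finite {l. F l \<noteq> (\<lambda>_ _. 0)}}"

definition gadd :: "'g graded_elt \<Rightarrow> 'g graded_elt \<Rightarrow> 'g graded_elt" where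
  "gadd F G = (\<lambda>l Z W. F l Z W + G l Z W)"
definition gscale :: "complex \<Rightarrow> 'g graded_elt \<Rightarrow> 'g graded_elt" where
  "gscale c F = (\<lambda>l Z W. c * F l Z W)"
definition gmult :: "'g graded_elt \<Rightarrow> 'g graded_elt \<Rightarrow> 'g graded_elt" where
  "gmult F G = (\<lambda>l Z W. \<Sum>i\<le>l. F i Z W * G (l - i) Z W)"
definition gone :: "('g::finite) graded_elt" where
  "gone = (\<lambda>l Z W. if l = 0 \<and> Z \<in> siegel_H then 1 else 0)"

inductive_set subalg_gen :: "('g::finite) graded_elt set \<Rightarrow> 'g graded_elt set" for S where
  gen: "F \<in> S \<Longrightarrow> F \<in> subalg_gen S"
| one: "gone \<in> subalg_gen S"
| add: "F \<in> subalg_gen S \<Longrightarrow> G \<in> subalg_gen S \<Longrightarrow> gadd F G \<in> subalg_gen S"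
| scale: "F \<in> subalg_gen S \<Longrightarrow> gscale c F \<in> subalg_gen S"
| mult: "F \<in> subalg_gen S \<Longrightarrow> G \<in> subalg_gen S \<Longrightarrow> gmult F G \<in> subalg_gen S"

definition finitely_generated_alg :: "('g::finite) graded_elt set \<Rightarrow> bool" where
  "finitely_generated_alg A \<longleftrightarrow> (\<exists>S. finite S \<and> S \<subseteq> A \<and> A \<subseteq> subalg_gen S)"

end

theory Submission
  imports Defs "HOL-Probability.Characteristic_Functions" "HOL-Complex_Analysis.Conformal_Mappings"
begin

text \<open>
  A form of index \<open>l m\<close> has Fourier support on pairs with
  \<open>T\<^sub>p\<^sub>p / \<lambda> + R\<^sub>p y + l m y\<^sup>2 \<ge> 0\<close> for all real \<open>y\<close>. Since \<open>R\<^sub>p\<close> is an integer, at \<open>y = 1 / n\<close>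
  with \<open>n > 2 l m\<close> this quantity is bounded below by a positive constant. Hence along
  \<open>Z = \<i> (1 + t E\<^sub>p\<^sub>p)\<close>, \<open>W = y Z e\<^sub>p\<close> the elements of degree \<open>l\<close> of an algebra generated by
  finitely many forms grow exponentially slower than \<open>exp (2 \<pi> t l m y\<^sup>2)\<close>. That rate is
  attained by \<open>\<Theta>(Z, 0)\<^sup>b \<Theta>(Z, n W)\<^sup>c\<close> for suitable \<open>b\<close>, \<open>c\<close>, where \<open>\<Theta>\<close> is the theta series of the
  lattice \<open>E\<^sub>8\<^sup>g\<close>, a form of weight 4 and index 1 for the full group \<open>Sp(2g, \<int>)\<close>.
  Its modularity is checked on the generators \<open>Z \<mapsto> Z + S\<close> and the partial inversions, the latter
  by the one-dimensional Jacobi transformation.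
\<close>

text \<open>The rate l m y^2 can be attained in degree l only where the quadratic polynomial has a
  real zero at y, that is y = -R_p / (2 l m) with R_p an integer. Finitely many generators leave
  only finitely many denominators, so y = 1/n escapes all of them once n is large, while the algebra
  as a whole attains the rate at every 1/n. Upper bounds pass from generators to all elements: rate
  and degree are both additive under products, and cancellation in sums does no harm. Only for the
  witness is a lower bound needed, and there all terms of the theta series at W = 0 are positive.
  \<open>E8\<close> is chosen because it is even and unimodular: its theta series has no level and
  no character, so it lies over every subgroup. The vector (1/2, ..., 1/2) is a root, and half its
  norm is the index 1. Replacing W by n W multiplies the index by n^2 and keeps the weight, and n =
  0 gives index 0; products of such forms therefore reach any ratio k : m. Splitting
  \<open>E8\<close> by parity and a character modulo 4 keeps all Poisson summation
  one-dimensional.\<close>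

section \<open>Series of exponentials\<close>

text \<open>The termwise Taylor remainder exp z - 1 - z is at most exp |Re z| |z|^2. The weight exp
  (\<delta> K) in the summability hypothesis pays both for the factor K^2 and for the growth of the
  terms near \<open>x\<close>, so convergence has to be known at the single point \<open>x\<close>
  only. The index family is arbitrary and the space real, so the lemma serves one complex variable
  and the pair (Z, W) alike.\<close>

lemma exp_series_has_derivative:
  fixes a :: "'i \<Rightarrow> 'a::real_normed_vector \<Rightarrow> complex"
  assumes lin: "\<And>i. i \<in> I \<Longrightarrow> linear (a i)"
    and bound: "\<And>i v. i \<in> I \<Longrightarrow> norm (a i v) \<le> K i * norm v"
    and K: "\<And>i. i \<in> I \<Longrightarrow> K i \<ge> 0" and \<delta>: "0 < \<delta>"
    and sm: "(\<lambda>i. norm (c i * exp (a i x)) * exp (\<delta> * K i)) summable_on I"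
  shows "((\<lambda>y. \<Sum>\<^sub>\<infinity>i\<in>I. c i * exp (a i y)) has_derivative
          (\<lambda>v. \<Sum>\<^sub>\<infinity>i\<in>I. c i * exp (a i x) * a i v)) (at x)"
proof -
  define T where "T i = norm (c i * exp (a i x))" for i
  define D where "D v = (\<Sum>\<^sub>\<infinity>i\<in>I. c i * exp (a i x) * a i v)" for v
  define M where "M = (\<Sum>\<^sub>\<infinity>i\<in>I. T i * exp (\<delta> * K i))"
  have T0: "T i \<ge> 0" for i by (simp add: T_def)
  have smT: "(\<lambda>i. T i * exp (\<delta> * K i)) summable_on I" using sm by (simp add: T_def)
  have K1: "K i \<le> (1/\<delta>) * exp (\<delta> * K i)" for i
  proof -
    have "\<delta> * K i \<le> exp (\<delta> * K i)" using exp_ge_add_one_self[of "\<delta> * K i"] by linarith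
    then show ?thesis using \<delta> by (simp add: field_simps)
  qed
  \<comment> \<open>One half of the exponent absorbs the square, the other half is reserved for
    displacements of norm at most \<open>\<delta>/2\<close>. The constant 8 comes from s^2 / 2 \<le>
    exp s at s = \<delta> K / 2.\<close>
  have K2: "(K i)^2 * exp (\<delta>/2 * K i) \<le> (8/\<delta>^2) * exp (\<delta> * K i)" if "i \<in> I" for i
  proof -
    have "(\<delta> * K i / 2)^2 / 2 \<le> exp (\<delta> * K i / 2)"
      using exp_lower_Taylor_quadratic[of "\<delta> * K i / 2"] K[OF that] \<delta>
      by (smt (verit, best) mult_nonneg_nonneg divide_nonneg_nonneg)
    then have "(K i)^2 \<le> (8/\<delta>^2) * exp (\<delta>/2 * K i)"
      using \<delta> by (simp add: field_simps power2_eq_square)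
    then have "(K i)^2 * exp (\<delta>/2 * K i) \<le> (8/\<delta>^2) * exp (\<delta>/2 * K i) * exp (\<delta>/2 * K i)"
      by (intro mult_right_mono) auto
    also have "\<dots> = (8/\<delta>^2) * exp (\<delta> * K i)"
      by (simp add: mult.assoc flip: exp_add)
    finally show ?thesis .
  qed
  have smD: "(\<lambda>i. norm (c i * exp (a i x) * a i v)) summable_on I" for v
  proof (rule Infinite_Sum.abs_summable_on_comparison_test'[OF summable_on_cmult_right[OF smT, of "norm v / \<delta>"]])
    fix i assume i: "i \<in> I"
    have "norm (c i * exp (a i x) * a i v) \<le> T i * (K i * norm v)"
      unfolding norm_mult[of _ "a i v"] T_def[symmetric] using bound[OF i] T0 by (intro mult_left_mono) auto
    also have "\<dots> \<le> T i * ((1/\<delta>) * exp (\<delta> * K i) * norm v)"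
      using K1 T0 by (intro mult_left_mono mult_right_mono) auto
    finally show "norm (c i * exp (a i x) * a i v) \<le> norm v / \<delta> * (T i * exp (\<delta> * K i))"
      by (simp add: field_simps)
  qed
  have smexp: "(\<lambda>i. norm (c i * exp (a i (x + h)))) summable_on I" if h: "norm h \<le> \<delta>" for h
  proof (rule Infinite_Sum.abs_summable_on_comparison_test'[OF smT])
    fix i assume i: "i \<in> I"
    have "norm (c i * exp (a i (x + h))) = T i * exp (Re (a i h))"
      using lin[OF i] by (simp add: linear_add exp_add norm_mult T_def)
    also have "\<dots> \<le> T i * exp (\<delta> * K i)"
    proof -
      have "Re (a i h) \<le> K i * norm h" using bound[OF i, of h] complex_Re_le_cmod order_trans by blast
      also have "\<dots> \<le> \<delta> * K i" using mult_right_mono[OF h K[OF i]] by (simp add: mult.commute)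
      finally show ?thesis using T0 by (intro mult_left_mono) auto
    qed
    finally show "norm (c i * exp (a i (x + h))) \<le> T i * exp (\<delta> * K i)" .
  qed
  have linD: "linear D"
  proof
    fix u v
    have "((\<lambda>i. c i * exp (a i x) * a i u + c i * exp (a i x) * a i v) has_sum (D u + D v)) I"
      unfolding D_def by (intro has_sum_add has_sum_infsum abs_summable_summable[OF smD])
    then have "D u + D v = (\<Sum>\<^sub>\<infinity>i\<in>I. c i * exp (a i x) * a i u + c i * exp (a i x) * a i v)"
      by (simp add: infsumI)
    also have "\<dots> = D (u + v)"
      unfolding D_def by (intro infsum_cong) (simp add: lin linear_add ring_distribs)
    finally show "D (u + v) = D u + D v" by simp
  next
    fix r v
    have "D (r *\<^sub>R v) = (\<Sum>\<^sub>\<infinity>i\<in>I. r *\<^sub>R (c i * exp (a i x) * a i v))"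
      unfolding D_def by (intro infsum_cong) (simp add: lin linear_scale)
    then show "D (r *\<^sub>R v) = r *\<^sub>R D v" by (simp add: D_def infsum_scaleR_right)
  qed
  have bndD: "norm (D v) \<le> norm v * (M / \<delta>)" for v
  proof -
    have "norm (D v) \<le> (\<Sum>\<^sub>\<infinity>i\<in>I. norm (c i * exp (a i x) * a i v))"
      unfolding D_def by (rule norm_infsum_bound) (rule smD)
    also have "\<dots> \<le> (\<Sum>\<^sub>\<infinity>i\<in>I. norm v / \<delta> * (T i * exp (\<delta> * K i)))"
    proof (rule infsum_mono[OF smD summable_on_cmult_right[OF smT]])
      fix i assume i: "i \<in> I"
      have "norm (c i * exp (a i x) * a i v) \<le> T i * (K i * norm v)"
        unfolding norm_mult[of _ "a i v"] T_def[symmetric] using bound[OF i] T0 by (intro mult_left_mono) auto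
      also have "\<dots> \<le> T i * ((1/\<delta>) * exp (\<delta> * K i) * norm v)"
        using K1 T0 by (intro mult_left_mono mult_right_mono) auto
      finally show "norm (c i * exp (a i x) * a i v) \<le> norm v / \<delta> * (T i * exp (\<delta> * K i))"
        by (simp add: field_simps)
    qed
    also have "\<dots> = norm v / \<delta> * M" unfolding M_def by (rule infsum_cmult_right')
    also have "\<dots> = norm v * (M / \<delta>)" by simp
    finally show ?thesis .
  qed
  have blD: "bounded_linear D"
    by (rule bounded_linear_intro[of _ "M/\<delta>"]) (use linD bndD in \<open>auto simp: linear_add linear_scale\<close>)
  define f where "f y = (\<Sum>\<^sub>\<infinity>i\<in>I. c i * exp (a i y))" for y
  have main: "norm (f (x + h) - f x - D h) \<le> (8/\<delta>^2 * M) * (norm h)^2" if h: "norm h \<le> \<delta>/2" for h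
  proof -
    have h': "norm h \<le> \<delta>" using h \<delta> by simp
    let ?g = "\<lambda>i. c i * exp (a i x) * (exp (a i h) - 1 - a i h)"
    have "f (x + h) - f x - D h = infsum ?g I"
    proof -
      have s1: "(\<lambda>i. c i * exp (a i (x+h))) summable_on I" "(\<lambda>i. c i * exp (a i x)) summable_on I"
        using smexp[OF h'] smexp[of 0] \<delta> by (auto intro: abs_summable_summable)
      have s2: "(\<lambda>i. c i * exp (a i x) * a i h) summable_on I"
        by (rule abs_summable_summable[OF smD])
      have "((\<lambda>i. c i * exp (a i (x+h)) + (- (c i * exp (a i x))) + (- (c i * exp (a i x) * a i h))) has_sum (f (x+h) + (- f x) + (- D h))) I"
        unfolding f_def D_def by (intro has_sum_add has_sum_uminusI has_sum_infsum s1 s2)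
      moreover have "((\<lambda>i. c i * exp (a i (x+h)) + (- (c i * exp (a i x))) + (- (c i * exp (a i x) * a i h))) has_sum (f (x+h) + (- f x) + (- D h))) I \<longleftrightarrow> (?g has_sum (f (x+h) + (- f x) + (- D h))) I"
        by (rule has_sum_cong) (simp add: lin linear_add exp_add algebra_simps)
      ultimately show ?thesis by (simp add: infsumI)
    qed
    moreover have *: "norm (?g i) \<le> (norm h)^2 * (8/\<delta>^2) * (T i * exp (\<delta> * K i))" if i: "i \<in> I" for i
    proof -
      have "norm (exp (a i h) - (\<Sum>j\<le>1. (a i h)^j / fact j)) \<le> exp \<bar>Re (a i h)\<bar> * (norm (a i h))^Suc 1 / fact 1"
        by (rule Taylor_exp)
      then have "norm (exp (a i h) - 1 - a i h) \<le> exp \<bar>Re (a i h)\<bar> * (norm (a i h))^2"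
        by (simp add: algebra_simps numeral_2_eq_2)
      also have "\<dots> \<le> exp (\<delta>/2 * K i) * (K i * norm h)^2"
      proof (intro mult_mono power_mono)
        have "\<bar>Re (a i h)\<bar> \<le> K i * norm h" using bound[OF i, of h] abs_Re_le_cmod order_trans by blast
        also have "\<dots> \<le> \<delta>/2 * K i" using mult_right_mono[OF h K[OF i]] by (simp add: mult.commute)
        finally show "exp \<bar>Re (a i h)\<bar> \<le> exp (\<delta>/2 * K i)" by simp
      qed (use bound[OF i] in auto)
      also have "\<dots> = (norm h)^2 * ((K i)^2 * exp (\<delta>/2 * K i))" by (simp add: power_mult_distrib)
      also have "\<dots> \<le> (norm h)^2 * ((8/\<delta>^2) * exp (\<delta> * K i))"
        using K2[OF i] by (intro mult_left_mono) auto
      finally have "T i * norm (exp (a i h) - 1 - a i h) \<le> T i * ((norm h)^2 * ((8/\<delta>^2) * exp (\<delta> * K i)))"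
        using T0 by (intro mult_left_mono)
      then show ?thesis by (simp add: norm_mult T_def mult_ac)
    qed
    have sg: "(\<lambda>i. norm (?g i)) summable_on I"
      by (rule Infinite_Sum.abs_summable_on_comparison_test'[OF summable_on_cmult_right[OF smT, of "(norm h)^2 * (8/\<delta>^2)"]]) (rule *)
    ultimately have "norm (f (x + h) - f x - D h) \<le> (\<Sum>\<^sub>\<infinity>i\<in>I. norm (?g i))"
      using norm_infsum_bound[of ?g I] by simp
    also have "\<dots> \<le> (\<Sum>\<^sub>\<infinity>i\<in>I. (norm h)^2 * (8/\<delta>^2) * (T i * exp (\<delta> * K i)))"
      by (rule infsum_mono[OF sg summable_on_cmult_right[OF smT]]) (rule *)
    also have "\<dots> = (norm h)^2 * (8/\<delta>^2) * M" unfolding M_def by (rule infsum_cmult_right')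
    also have "\<dots> = (8/\<delta>^2 * M) * (norm h)^2" by simp
    finally show ?thesis .
  qed
  have "((\<lambda>h. norm (f (x + h) - f x - D h) / norm h) \<longlongrightarrow> 0) (at 0)"
  proof (rule tendsto_sandwich)
    show "\<forall>\<^sub>F h in at 0. 0 \<le> norm (f (x + h) - f x - D h) / norm h" by simp
    show "\<forall>\<^sub>F h in at 0. norm (f (x + h) - f x - D h) / norm h \<le> (8/\<delta>^2 * M) * norm h"
      unfolding eventually_at
    proof (intro exI[of _ "\<delta>/2"] conjI ballI impI)
      fix h :: 'a assume "h \<noteq> 0 \<and> dist h 0 < \<delta>/2"
      then show "norm (f (x + h) - f x - D h) / norm h \<le> (8/\<delta>^2 * M) * norm h"
        using main[of h] by (subst pos_divide_le_eq) (auto simp: power2_eq_square mult.assoc)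
    qed (use \<delta> in auto)
    show "((\<lambda>h. 0) \<longlongrightarrow> 0) (at 0)" by simp
    show "((\<lambda>h. (8/\<delta>^2 * M) * norm h) \<longlongrightarrow> 0) (at (0::'a))"
      by (rule tendsto_eq_intros | simp)+
  qed
  then have "(f has_derivative D) (at x)"
    by (simp add: has_derivative_at blD)
  then show ?thesis unfolding f_def D_def .
qed

section \<open>Summability of Gaussian families\<close>

text \<open>Completing the square bounds the linear term plus one further |n| by the quadratic term
  and a constant, which leaves the geometric majorant exp (- |n|).\<close>

lemma summable_on_int_gaussian:
  fixes \<epsilon> C :: real
  assumes "\<epsilon> > 0"
  shows "(\<lambda>n::int. exp (- \<epsilon> * (of_int n)^2 + C * \<bar>of_int n\<bar>)) summable_on UNIV"
proof -
  have s: "(\<lambda>n::nat. exp (- real n)) summable_on UNIV"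
  proof (rule norm_summable_imp_summable_on)
    have "summable (\<lambda>n. (exp (-1::real))^n)" by (rule summable_geometric) simp
    then show "summable (\<lambda>n. norm (exp (- real n)))" by (simp flip: exp_of_nat_mult)
  qed
  have r1: "(\<lambda>n::int. exp (- \<bar>of_int n\<bar>) :: real) summable_on range int"
    by (subst summable_on_reindex) (use s in \<open>auto simp: o_def\<close>)
  have r2: "(\<lambda>n::int. exp (- \<bar>of_int n\<bar>) :: real) summable_on range (\<lambda>n. - int n)"
    by (subst summable_on_reindex) (use s in \<open>auto simp: o_def inj_on_def\<close>)
  have "range int \<union> range (\<lambda>n. - int n) = UNIV"
    by (auto simp: image_iff) (metis int_cases2)
  then have s': "(\<lambda>n::int. exp (- \<bar>of_int n\<bar>) :: real) summable_on UNIV"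
    using summable_on_union[OF r1 r2] by simp
  \<comment> \<open>The maximum over real s of (C + 1) s - \<epsilon> s^2.\<close>
  define D where "D = (C+1)^2 / (4*\<epsilon>)"
  show ?thesis
  proof (rule summable_on_comparison_test[OF summable_on_cmult_right[OF s', of "exp D"]])
    fix n :: int
    have "(C+1) * \<bar>of_int n\<bar> \<le> \<epsilon> * (of_int n)^2 + D"
    proof -
      have "0 \<le> (2*\<epsilon>*\<bar>of_int n\<bar> - (C+1))^2 / (4*\<epsilon>)" using assms by simp
      also have "\<dots> = \<epsilon> * (of_int n)^2 + D - (C+1) * \<bar>of_int n\<bar>"
        using assms by (simp add: D_def power2_eq_square field_simps)
      finally show ?thesis by simp
    qed
    then show "exp (- \<epsilon> * (of_int n)^2 + C * \<bar>of_int n\<bar>) \<le> exp D * exp (- \<bar>of_int n\<bar>)"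
      by (simp add: algebra_simps flip: exp_add)
  qed auto
qed

text \<open>The product formula for infinite sums yields summability because \<open>infsum\<close>
  is 0 on a family that is not summable: a nonzero product of sums excludes that case. If some
  factor has sum 0, nonnegativity forces all its terms, and hence all products, to vanish.\<close>

lemma summable_on_prod_PiE:
  fixes f :: "'a \<Rightarrow> 'b \<Rightarrow> real"
  assumes fin: "finite A" and sm: "\<And>x. x \<in> A \<Longrightarrow> f x summable_on B x"
    and nn: "\<And>x y. x \<in> A \<Longrightarrow> y \<in> B x \<Longrightarrow> f x y \<ge> 0"
  shows "(\<lambda>g. \<Prod>x\<in>A. f x (g x)) summable_on (PiE A B)"
proof (cases "\<exists>x\<in>A. infsum (f x) (B x) = 0")
  case True
  then obtain x where x: "x \<in> A" "infsum (f x) (B x) = 0" by blast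
  have "f x y = 0" if "y \<in> B x" for y
    by (rule nonneg_infsum_le_0D[of "f x" "B x"]) (use x sm nn that in auto)
  then have "(\<Prod>x\<in>A. f x (g x)) = 0" if "g \<in> PiE A B" for g
    using that fin x(1) by (auto simp: PiE_mem intro!: bexI[of _ x])
  then show ?thesis
    by (subst summable_on_cong[where g = "\<lambda>_. 0"]) auto
next
  case False
  have "infsum (\<lambda>g. \<Prod>x\<in>A. f x (g x)) (PiE A B) = (\<Prod>x\<in>A. infsum (f x) (B x))"
  proof (rule infsum_prod_PiE_abs[OF fin])
    show "(\<lambda>y. norm (f x y)) summable_on B x" if "x \<in> A" for x
      using sm[OF that] by (rule summable_on_cong[THEN iffD1, rotated]) (use nn[OF that] in auto)
  qed
  then have "infsum (\<lambda>g. \<Prod>x\<in>A. f x (g x)) (PiE A B) \<noteq> 0"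
    using False fin by simp
  then show ?thesis using infsum_not_exists by blast
qed

section \<open>The Jacobi transformation of the one-dimensional theta series\<close>

text \<open>An even 1-periodic continuous function is a continuous function of u = (1 + cos 2 pi x)
  / 2 on [0, 1], hence uniformly close to a Bernstein polynomial P in u. Orthogonality to cosines
  extends to P, so the integral of d^2 equals that of d (d - P) and is arbitrarily small.\<close>

lemma even_periodic_fourier_unique_real:
  fixes d :: "real \<Rightarrow> real"
  assumes cont: "continuous_on UNIV d"
    and even: "\<And>x. d (- x) = d x" and per: "\<And>x. d (x + 1) = d x"
    and orth: "\<And>k::nat. integral {0..1} (\<lambda>x. d x * cos (2 * pi * real k * x)) = 0"
  shows "d x = 0"
proof -
  define u where "u x = (1 + cos (2 * pi * x)) / 2" for x :: real
  \<comment> \<open>Orthogonality against every cosine, and not only against the constant, makes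
    \<open>S\<close> closed under multiplication by cos (2 pi x), because cos a cos b is the mean of
    cos (a + b) and cos (a - b).\<close>
  define S where "S = {g :: real \<Rightarrow> real. continuous_on UNIV g \<and>
      (\<forall>j::nat. ((\<lambda>x. d x * g x * cos (2 * pi * real j * x)) has_integral 0) {0..1})}"
  have intg: "(\<lambda>x. d x * g x * cos (2 * pi * real j * x)) integrable_on {0..1}"
    if "continuous_on UNIV g" for g :: "real \<Rightarrow> real" and j :: nat
    by (rule integrable_continuous_real)
       (intro continuous_intros continuous_on_subset[OF that] continuous_on_subset[OF cont]; simp)
  have S1: "(\<lambda>_. 1) \<in> S"
    using orth intg[of "\<lambda>_. 1"] by (simp add: S_def has_integral_iff)
  have Scos: "(\<lambda>x. cos (2 * pi * x) * g x) \<in> S" if g: "g \<in> S" for g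
  proof -
    have cg: "continuous_on UNIV g" and og: "\<And>j::nat. ((\<lambda>x. d x * g x * cos (2 * pi * real j * x)) has_integral 0) {0..1}"
      using g by (auto simp: S_def)
    have "((\<lambda>x. d x * (cos (2 * pi * x) * g x) * cos (2 * pi * real j * x)) has_integral 0) {0..1}" for j :: nat
    proof (cases j)
      case 0
      then show ?thesis using og[of 1] by (simp add: mult_ac)
    next
      case (Suc i)
      have "d x * (cos (2 * pi * x) * g x) * cos (2 * pi * real j * x) =
         1/2 * (d x * g x * cos (2 * pi * real (Suc (Suc i)) * x)) + 1/2 * (d x * g x * cos (2 * pi * real i * x))" for x
      proof -
        have "2 * pi * real (Suc (Suc i)) * x = 2 * pi * real j * x + 2 * pi * x"
             "2 * pi * real i * x = 2 * pi * real j * x - 2 * pi * x"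
          using Suc by (auto simp: algebra_simps)
        then show ?thesis by (simp only: cos_add cos_diff) (simp add: field_simps)
      qed
      moreover have "((\<lambda>x. 1/2 * (d x * g x * cos (2 * pi * real (Suc (Suc i)) * x)) + 1/2 * (d x * g x * cos (2 * pi * real i * x))) has_integral (1/2 * 0 + 1/2 * 0)) {0..1}"
        by (intro has_integral_add has_integral_mult_right og)
      ultimately show ?thesis by simp
    qed
    moreover have "continuous_on UNIV (\<lambda>x. cos (2 * pi * x) * g x)"
      by (intro continuous_intros cg)
    ultimately show ?thesis by (simp add: S_def)
  qed
  have Slin: "(\<lambda>x. a * g x + b * h x) \<in> S" if g: "g \<in> S" "h \<in> S" for a b g h
  proof -
    have cg: "continuous_on UNIV g" "continuous_on UNIV h"
      and og: "\<And>j::nat. ((\<lambda>x. d x * g x * cos (2 * pi * real j * x)) has_integral 0) {0..1}"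
       "\<And>j::nat. ((\<lambda>x. d x * h x * cos (2 * pi * real j * x)) has_integral 0) {0..1}"
      using g by (auto simp: S_def)
    have e: "(\<lambda>x. d x * (a * g x + b * h x) * cos (2 * pi * real j * x)) =
        (\<lambda>x. a * (d x * g x * cos (2 * pi * real j * x)) + b * (d x * h x * cos (2 * pi * real j * x)))" for j
      by (rule ext, simp add: algebra_simps)
    have "((\<lambda>x. a * (d x * g x * cos (2 * pi * real j * x)) + b * (d x * h x * cos (2 * pi * real j * x))) has_integral (a * 0 + b * 0)) {0..1}" for j :: nat
      by (intro has_integral_add has_integral_mult_right og)
    then have "((\<lambda>x. d x * (a * g x + b * h x) * cos (2 * pi * real j * x)) has_integral 0) {0..1}" for j :: nat
      unfolding e by simp
    moreover have "continuous_on UNIV (\<lambda>x. a * g x + b * h x)"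
      by (intro continuous_intros cg)
    ultimately show ?thesis by (simp add: S_def)
  qed
  have S0: "(\<lambda>_. 0) \<in> S" using Slin[OF S1 S1, of 0 0] by simp
  have Su: "(\<lambda>x. u x * g x) \<in> S" if g: "g \<in> S" for g
    using Slin[OF g Scos[OF g], of "1/2" "1/2"] by (simp add: u_def algebra_simps add_divide_distrib)
  have Su': "(\<lambda>x. (1 - u x) * g x) \<in> S" if g: "g \<in> S" for g
    using Slin[OF g Su[OF g], of 1 "-1"] by (simp add: algebra_simps)
  have Suk': "(\<lambda>x. (1 - u x)^k) \<in> S" for k
    by (induction k) (use S1 Su' in auto)
  have Suk: "(\<lambda>x. u x ^ l * (1 - u x)^k) \<in> S" for k l
    by (induction l) (use Suk' Su[of "\<lambda>x. u x ^ _ * (1 - u x)^k"] in \<open>auto simp: mult_ac\<close>)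
  have Sum: "(\<lambda>x. \<Sum>k\<in>K. c k * g k x) \<in> S" if "finite K" "\<And>k. g k \<in> S" for K c g
    using that by (induction K rule: finite_induct) (use S0 Slin[where b=1] in auto)
  \<comment> \<open>The argument of \<open>d\<close> inverts \<open>u\<close> on [0, 1/2]; evenness
    and periodicity extend the relation \<open>D (u x) = d x\<close> to [0, 1].\<close>
  define D where "D v = d (arccos (2 * v - 1) / (2 * pi))" for v
  have contD: "continuous_on {0..1} D"
  proof -
    have "continuous_on {0..1} (\<lambda>v::real. arccos (2 * v - 1) / (2 * pi))"
      by (intro continuous_intros) auto
    from continuous_on_compose2[OF cont this] show ?thesis by (simp add: D_def)
  qed
  have u01: "u x \<in> {0..1}" for x by (simp add: u_def) (smt (verit) cos_ge_minus_one cos_le_one)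
  have u2: "2 * u x - 1 = cos (2 * pi * x)" for x by (simp add: u_def field_simps)
  have Du: "D (u x) = d x" if x: "x \<in> {0..1}" for x
  proof (cases "x \<le> 1/2")
    case True
    have "arccos (cos (2 * pi * x)) = 2 * pi * x" using x True by (intro arccos_cos) auto
    then show ?thesis by (simp add: D_def u2)
  next
    case False
    have "cos (2 * pi * x) = cos (2 * pi * (1 - x))" by (simp add: algebra_simps cos_diff)
    moreover have "arccos (cos (2 * pi * (1 - x))) = 2 * pi * (1 - x)" using x False by (intro arccos_cos) (auto simp: mult_left_le)
    ultimately have "D (u x) = d (1 - x)" by (simp add: D_def u2)
    also have "\<dots> = d (-x + 1)" by (simp add: algebra_simps)
    also have "\<dots> = d x" by (simp only: per even)
    finally show ?thesis .
  qed
  have intd: "(\<lambda>x. d x * g x) integrable_on {0..1}" if "continuous_on UNIV g" for g :: "real \<Rightarrow> real"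
    using intg[OF that, of 0] by simp
  obtain B where B: "\<And>x. x \<in> {0..1} \<Longrightarrow> \<bar>d x\<bar> \<le> B"
  proof -
    have "bounded (d ` {0..1})"
      using compact_continuous_image[OF continuous_on_subset[OF cont] compact_Icc] compact_imp_bounded by blast
    then show ?thesis using that by (force simp add: bounded_iff)
  qed
  have B0: "B \<ge> 0" using B[of 0] by simp
  have small: "integral {0..1} (\<lambda>x. d x * d x) \<le> e * B" if e: "e > 0" for e
  proof -
    obtain N where N: "\<And>n v. N \<le> n \<Longrightarrow> v \<in> {0..1} \<Longrightarrow> \<bar>D v - (\<Sum>k\<le>n. D (k/n) * Bernstein n k v)\<bar> < e"
      using Bernstein_Weierstrass[OF contD e] by blast
    define P where "P x = (\<Sum>k\<le>N. D (k/N) * Bernstein N k (u x))" for x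
    have PS: "P \<in> S"
      unfolding P_def Bernstein_def by (rule Sum) (use Slin[OF Suk S0, where b=0] in \<open>simp_all add: mult.assoc\<close>)
    then have cP: "continuous_on UNIV P" and oP: "integral {0..1} (\<lambda>x. d x * P x) = 0"
      by (auto simp: S_def has_integral_iff dest!: spec[of _ 0])
    have "integral {0..1} (\<lambda>x. d x * d x) = integral {0..1} (\<lambda>x. d x * d x) - integral {0..1} (\<lambda>x. d x * P x)"
      using oP by simp
    also have "\<dots> = integral {0..1} (\<lambda>x. d x * d x - d x * P x)"
      by (rule integral_diff[symmetric]) (rule intd[OF cont], rule intd[OF cP])
    also have "\<dots> \<le> integral {0..1} (\<lambda>x::real. e * B)"
    proof (rule integral_le)
      show "(\<lambda>x. d x * d x - d x * P x) integrable_on {0..1}"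
        by (intro integrable_diff intd cont cP)
      fix x :: real assume x: "x \<in> {0..1}"
      have "\<bar>d x - P x\<bar> < e" using N[OF order_refl u01[of x]] Du[OF x] by (simp add: P_def)
      then have "\<bar>d x\<bar> * \<bar>d x - P x\<bar> \<le> B * e" using B[OF x] by (intro mult_mono) auto
      then have "d x * (d x - P x) \<le> B * e" using abs_ge_self[of "d x * (d x - P x)"] by (simp add: abs_mult)
      then show "d x * d x - d x * P x \<le> e * B" by (simp add: algebra_simps)
    qed auto
    finally show ?thesis by simp
  qed
  have "integral {0..1} (\<lambda>x. d x * d x) \<le> 0"
  proof (rule field_le_epsilon)
    fix e :: real assume e: "e > 0"
    have "integral {0..1} (\<lambda>x. d x * d x) \<le> e / (B + 1) * B" using small[of "e/(B+1)"] e B0 by simp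
    also have "\<dots> \<le> e" using B0 e by (simp add: field_simps)
    finally show "integral {0..1} (\<lambda>x. d x * d x) \<le> 0 + e" by simp
  qed
  moreover have "integral {0..1} (\<lambda>x. d x * d x) \<ge> 0" 
    by (rule integral_nonneg[OF intd[OF cont]]) simp
  ultimately have "integral {0..1} (\<lambda>x. d x * d x) = 0" by simp
  then have z: "d x = 0" if "x \<in> {0..1}" for x
  proof -
    have "continuous_on {0..1} (\<lambda>x. d x * d x)"
      by (intro continuous_intros continuous_on_subset[OF cont]) auto
    with \<open>integral {0..1} (\<lambda>x. d x * d x) = 0\<close> show ?thesis
      using that integral_eq_0_iff[of 0 1 "\<lambda>x. d x * d x"] by simp
  qed
  have pern: "d (x + real n) = d x" for x n
  proof (induction n)
    case (Suc n)
    have "d (x + real (Suc n)) = d ((x + real n) + 1)" by (rule arg_cong[where f = d]) simp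
    also have "\<dots> = d (x + real n)" by (rule per)
    also have "\<dots> = d x" by (rule Suc.IH)
    finally show ?case .
  qed simp
  have "d (x + of_int n) = d x" for n x
  proof (cases "n \<ge> 0")
    case True then show ?thesis using pern[of x "nat n"] by simp
  next
    case False then show ?thesis using pern[of "x + of_int n" "nat (-n)"] by simp
  qed
  from this[of "frac x" "\<lfloor>x\<rfloor>"] have "d x = d (frac x)" by (simp add: frac_def)
  also have "\<dots> = 0" using z[of "frac x"] frac_lt_1[of x] by simp
  finally show ?thesis .
qed

lemma even_periodic_fourier_unique:
  fixes d :: "real \<Rightarrow> complex"
  assumes cont: "continuous_on UNIV d"
    and even: "\<And>x. d (- x) = d x" and per: "\<And>x. d (x + 1) = d x"
    and orth: "\<And>k::int. integral {0..1} (\<lambda>x. d x * cis (2 * pi * of_int k * x)) = 0"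
  shows "d x = 0"
proof -
  have intd: "(\<lambda>x. d x * cis (2 * pi * of_int k * x)) integrable_on {0..1}" for k
    by (rule integrable_continuous_real)
       (intro continuous_intros continuous_on_subset[OF cont]; simp)
  have *: "integral {0..1} (\<lambda>x. d x * of_real (cos (2 * pi * real k * x))) = 0"
          "(\<lambda>x. d x * of_real (cos (2 * pi * real k * x))) integrable_on {0..1}" for k
  proof -
    have c: "of_real (cos a) = (cis a + cis (- a)) / 2" for a
      by (simp add: complex_eq_iff)
    have c': "2 * pi * of_int (- int k) * x = - (2 * pi * real k * x)" "2 * pi * of_int (int k) * x = 2 * pi * real k * x" for x
      by simp_all
    have e: "(\<lambda>x. d x * of_real (cos (2 * pi * real k * x))) = (\<lambda>x.
        1/2 * (d x * cis (2 * pi * of_int (int k) * x)) + 1/2 * (d x * cis (2 * pi * of_int (- int k) * x)))"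
    proof
      fix x
      have "y * ((A + B) / 2) = 1/2 * (y * A) + 1/2 * (y * B)" for A B y :: complex
        by (simp add: field_simps)
      then show "d x * of_real (cos (2 * pi * real k * x)) =
        1/2 * (d x * cis (2 * pi * of_int (int k) * x)) + 1/2 * (d x * cis (2 * pi * of_int (- int k) * x))"
        unfolding c c' by this
    qed
    have "((\<lambda>x. d x * cis (2 * pi * of_int k * x)) has_integral 0) {0..1}" for k
      using intd[of k] orth[of k] by (simp add: has_integral_iff)
    then have "((\<lambda>x. d x * of_real (cos (2 * pi * real k * x))) has_integral (1/2 * 0 + 1/2 * 0)) {0..1}"
      unfolding e by (intro has_integral_add has_integral_mult_right)
    then show "integral {0..1} (\<lambda>x. d x * of_real (cos (2 * pi * real k * x))) = 0"
       "(\<lambda>x. d x * of_real (cos (2 * pi * real k * x))) integrable_on {0..1}"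
      by (auto simp: has_integral_iff)
  qed
  have "integral {0..1} (\<lambda>x. Re (d x) * cos (2 * pi * real k * x)) = 0"
       "integral {0..1} (\<lambda>x. Im (d x) * cos (2 * pi * real k * x)) = 0" for k
    using integral_linear[OF *(2)[of k] bounded_linear_Re] integral_linear[OF *(2)[of k] bounded_linear_Im] *(1)[of k]
    by (simp_all add: o_def)
  then have "Re (d x) = 0" "Im (d x) = 0"
    using even_periodic_fourier_unique_real[of "\<lambda>x. Re (d x)" x] even_periodic_fourier_unique_real[of "\<lambda>x. Im (d x)" x]
      cont even per by (auto intro!: continuous_intros)
  then show ?thesis by (simp add: complex_eq_iff)
qed

section \<open>Poisson summation for real Gaussians\<close>

text \<open>This is the characteristic function of the standard normal distribution after a linear
  change of variable.\<close>

lemma gaussian_fourier_transform: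
  fixes t :: real and j :: real
  assumes t: "t > 0"
  shows "has_bochner_integral lborel (\<lambda>x. of_real (exp (- pi * x^2 / t)) * cis (2 * pi * j * x))
           (of_real (sqrt t * exp (- pi * t * j^2)))"
proof -
  \<comment> \<open>Chosen so that (\<alpha> x)^2 / 2 = pi x^2 / t; the frequency \<open>s\<close>
    below then satisfies s \<alpha> x = 2 pi j x.\<close>
  define \<alpha> where "\<alpha> = sqrt (2 * pi / t)"
  have \<alpha>: "\<alpha> > 0" "\<alpha>^2 = 2 * pi / t" using t by (auto simp: \<alpha>_def)
  define s where "s = 2 * pi * j / \<alpha>"
  let ?f = "\<lambda>x. std_normal_density x *\<^sub>R iexp (s * x)"
  have int: "integrable lborel ?f"
  proof (rule Bochner_Integration.integrable_bound[of _ std_normal_density])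
    show "integrable lborel std_normal_density" by simp
    show "?f \<in> borel_measurable lborel" by measurable
  qed auto
  have val: "integral\<^sup>L lborel ?f = of_real (exp (- (s^2) / 2))"
    using fun_cong[OF char_std_normal_distribution, of s] unfolding char_def
    by (subst (asm) integral_density) (auto simp: normal_density_nonneg)
  have "has_bochner_integral lborel ?f (of_real (exp (- (s^2) / 2)))"
    using int val by (simp add: has_bochner_integral_iff)
  then have h: "has_bochner_integral lborel (\<lambda>x. ?f (0 + \<alpha> * x)) (of_real (exp (- (s^2) / 2)) /\<^sub>R \<bar>\<alpha>\<bar>)"
    using \<alpha> by (subst (asm) lborel_has_bochner_integral_real_affine_iff[of \<alpha> _ _ 0]) auto
  have "has_bochner_integral lborel (\<lambda>x. of_real (sqrt (2*pi)) * ?f (0 + \<alpha> * x)) (of_real (sqrt (2*pi)) * (of_real (exp (- (s^2) / 2)) /\<^sub>R \<bar>\<alpha>\<bar>))"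
    by (rule has_bochner_integral_mult_right) (use h in auto)
  moreover have "of_real (sqrt (2*pi)) * ?f (0 + \<alpha> * x) = of_real (exp (- pi * x^2 / t)) * cis (2 * pi * j * x)" for x
  proof -
    have "(\<alpha> * x)^2 / 2 = pi * x^2 / t" using \<alpha> by (simp add: power_mult_distrib)
    then have "std_normal_density (0 + \<alpha> * x) = (1 / sqrt (2 * pi)) * exp (- pi * x^2 / t)"
      by (simp add: std_normal_density_def)
    moreover have "s * (0 + \<alpha> * x) = 2 * pi * j * x" using \<alpha> by (simp add: s_def)
    ultimately have "?f (0 + \<alpha> * x) = ((1 / sqrt (2 * pi)) * exp (- pi * x^2 / t)) *\<^sub>R iexp (2 * pi * j * x)"
      by (simp only:)
    then show ?thesis
      by (simp add: std_normal_density_def scaleR_conv_of_real cis_conv_exp flip: of_real_mult)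
  qed
  moreover have "of_real (sqrt (2*pi)) * (of_real (exp (- (s^2) / 2)) /\<^sub>R \<bar>\<alpha>\<bar>) = (of_real (sqrt t * exp (- pi * t * j^2)) :: complex)"
  proof -
    have "s^2 / 2 = pi * t * j^2" using \<alpha> t by (simp add: s_def power_divide power_mult_distrib power2_eq_square[of pi] power2_eq_square[of 2])
    moreover have "sqrt (2*pi) / \<alpha> = sqrt t" using t by (simp add: \<alpha>_def real_sqrt_divide)
    ultimately show ?thesis using \<alpha>
      by (simp add: scaleR_conv_of_real field_simps flip: of_real_mult of_real_divide of_real_inverse)
  qed
  ultimately show ?thesis by simp
qed

text \<open>The majorant may depend on the radius \<open>R\<close>: the translates exp (- pi (x +
  n)^2 / t) have no summable bound valid for all real x.\<close>

lemma infsum_continuous_on_UNIV: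
  fixes f :: "'i \<Rightarrow> real \<Rightarrow> complex" and M :: "real \<Rightarrow> 'i \<Rightarrow> real"
  assumes c: "\<And>i. i \<in> I \<Longrightarrow> continuous_on UNIV (f i)"
    and b: "\<And>R i x. i \<in> I \<Longrightarrow> \<bar>x\<bar> \<le> R \<Longrightarrow> norm (f i x) \<le> M R i"
    and s: "\<And>R. M R summable_on I"
  shows "continuous_on UNIV (\<lambda>x. \<Sum>\<^sub>\<infinity>i\<in>I. f i x)"
proof -
  have "continuous_on {-R..R} (\<lambda>x. \<Sum>\<^sub>\<infinity>i\<in>I. f i x)" for R
  proof (rule uniform_limit_theorem)
    show "uniform_limit {-R..R} (\<lambda>X y. \<Sum>i\<in>X. f i y) (\<lambda>y. \<Sum>\<^sub>\<infinity>i\<in>I. f i y) (finite_subsets_at_top I)"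
      by (rule Weierstrass_m_test_general[OF _ s[of R]]) (auto intro!: b)
    show "\<forall>\<^sub>F X in finite_subsets_at_top I. continuous_on {-R..R} (\<lambda>y. \<Sum>i\<in>X. f i y)"
      by (rule eventually_finite_subsets_at_top_weakI)
         (auto intro!: continuous_on_sum continuous_on_subset[OF c])
  qed simp
  then have "isCont (\<lambda>x. \<Sum>\<^sub>\<infinity>i\<in>I. f i x) x" for x
    by (rule continuous_on_interior[of "{-(\<bar>x\<bar>+1)..\<bar>x\<bar>+1}"]) (auto simp: interior_atLeastAtMost_real)
  then show ?thesis by (simp add: continuous_at_imp_continuous_on)
qed

lemma has_sum_integral:
  fixes f :: "'i \<Rightarrow> real \<Rightarrow> complex"
  assumes c: "\<And>i. i \<in> I \<Longrightarrow> continuous_on {a..b} (f i)"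
    and bd: "\<And>i x. i \<in> I \<Longrightarrow> x \<in> {a..b} \<Longrightarrow> norm (f i x) \<le> M i"
    and s: "M summable_on I"
  shows "((\<lambda>i. integral {a..b} (f i)) has_sum (integral {a..b} (\<lambda>x. \<Sum>\<^sub>\<infinity>i\<in>I. f i x))) I"
proof -
  \<comment> \<open>The theorem on integrals of uniform limits asks for continuity for every
    \<open>X\<close>, while \<open>f i\<close> is continuous for \<open>i\<close> in
    \<open>I\<close> only; the value 0 covers the other sets, which the filter does not see.\<close>
  let ?f = "\<lambda>X y. if X \<subseteq> I then \<Sum>i\<in>X. f i y else 0"
  have ev: "\<forall>\<^sub>F X in finite_subsets_at_top I. finite X \<and> X \<subseteq> I"
    by (rule eventually_finite_subsets_at_top_weakI) auto
  have "uniform_limit {a..b} (\<lambda>X y. \<Sum>i\<in>X. f i y) (\<lambda>y. \<Sum>\<^sub>\<infinity>i\<in>I. f i y) (finite_subsets_at_top I)"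
    by (rule Weierstrass_m_test_general[OF _ s]) (auto intro!: bd)
  then have u: "uniform_limit {a..b} ?f (\<lambda>y. \<Sum>\<^sub>\<infinity>i\<in>I. f i y) (finite_subsets_at_top I)"
    by (rule uniform_limit_cong[THEN iffD1, rotated 2])
       (use ev in \<open>auto elim!: eventually_mono\<close>)
  have cf: "continuous_on {a..b} (?f X)" for X
    by (cases "X \<subseteq> I") (auto intro!: continuous_on_sum c)
  obtain J' J where J: "\<And>X. (?f X has_integral J' X) {a..b}"
      "((\<lambda>y. \<Sum>\<^sub>\<infinity>i\<in>I. f i y) has_integral J) {a..b}" "(J' \<longlongrightarrow> J) (finite_subsets_at_top I)"
    by (rule uniform_limit_integral[OF u cf]) auto
  have "J' X = (\<Sum>i\<in>X. integral {a..b} (f i))" if "finite X \<and> X \<subseteq> I" for X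
  proof -
    have "J' X = integral {a..b} (?f X)" by (rule integral_unique[OF J(1), symmetric])
    also have "\<dots> = (\<Sum>i\<in>X. integral {a..b} (f i))"
      using that by (auto intro!: integral_sum integrable_continuous_real c)
    finally show ?thesis .
  qed
  then have "((\<lambda>X. \<Sum>i\<in>X. integral {a..b} (f i)) \<longlongrightarrow> J) (finite_subsets_at_top I)"
    using ev by (intro Lim_transform_eventually[OF J(3)]) (auto elim!: eventually_mono)
  then show ?thesis using J(2) by (simp add: has_sum_def integral_unique)
qed

lemma integral_cis_period:
  "integral {0..1} (\<lambda>x. cis (2 * pi * of_int l * x)) = (if l = 0 then 1 else 0)"
proof (cases "l = 0")
  case False
  define w where "w = 2 * pi * \<i> * of_int l"
  have w: "w \<noteq> 0" using False by (simp add: w_def)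
  have "((\<lambda>x. exp (w * of_real x)) has_integral exp (w * of_real 1) / w - exp (w * of_real 0) / w) {0..1}"
  proof (rule fundamental_theorem_of_calculus)
    fix x :: real
    have "((\<lambda>z. exp (w * z) / w) has_field_derivative exp (w * of_real x)) (at (of_real x))"
      using w by (auto intro!: derivative_eq_intros)
    then have "((\<lambda>x. exp (w * of_real x) / w) has_vector_derivative exp (w * of_real x)) (at x)"
      by (rule has_vector_derivative_real_field)
    then show "((\<lambda>x. exp (w * of_real x) / w) has_vector_derivative exp (w * of_real x)) (at x within {0..1})"
      by (rule has_vector_derivative_at_within)
  qed simp
  moreover have "exp (w * of_real 1) = 1" unfolding w_def exp_eq_1 by simp
  moreover have "cis (2 * pi * of_int l * x) = exp (w * of_real x)" for x
    by (simp add: cis_conv_exp w_def mult_ac)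
  ultimately show ?thesis using False by (simp add: integral_unique)
qed simp

lemma gaussian_shift_bound:
  fixes t R x :: real
  assumes "t > 0" "\<bar>x\<bar> \<le> R"
  shows "exp (- pi * (x + of_int n)^2 / t) \<le> exp (- (pi / t) * (of_int n)^2 + (2 * pi * R / t) * \<bar>of_int n\<bar>)"
proof -
  have "- (2 * x * of_int n) \<le> 2 * R * \<bar>of_int n\<bar>"
    using mult_right_mono[OF assms(2), of "\<bar>of_int n\<bar>"] abs_ge_minus_self[of "x * of_int n"] by (simp add: abs_mult)
  then have "- ((x + of_int n)^2) \<le> - ((of_int n)^2) + 2 * R * \<bar>of_int n\<bar>"
    using zero_le_power2[of x] unfolding power2_sum by linarith
  then have "(pi / t) * (- ((x + of_int n)^2)) \<le> (pi / t) * (- ((of_int n)^2) + 2 * R * \<bar>of_int n\<bar>)"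
    using assms by (intro mult_left_mono) auto
  then show ?thesis by (simp add: algebra_simps)
qed

text \<open>Passage from the Lebesgue integral over the line to gauge integrals over intervals, by
  dominated convergence with majorant \<open>norm (H x)\<close>.\<close>

lemma integral_symmetric_limit:
  fixes H :: "real \<Rightarrow> complex"
  assumes H: "has_bochner_integral lborel H v"
  shows "(\<lambda>N::nat. integral {- real N..real N} H) \<longlonglongrightarrow> v"
proof -
  have int: "integrable lborel H" and v: "integral\<^sup>L lborel H = v"
    using H by (auto simp: has_bochner_integral_iff)
  have "(\<lambda>N::nat. LINT x|lborel. indicator {- real N..real N} x *\<^sub>R H x) \<longlonglongrightarrow> integral\<^sup>L lborel H"
  proof (rule integral_dominated_convergence[where w = "\<lambda>x. norm (H x)"])
    show "AE x in lborel. (\<lambda>N. indicator {- real N..real N} x *\<^sub>R H x) \<longlonglongrightarrow> H x"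
    proof (rule AE_I2)
      fix x :: real
      obtain N0 :: nat where N0: "\<bar>x\<bar> \<le> real N0" using real_arch_simple by blast
      have "\<forall>\<^sub>F N in sequentially. indicator {- real N..real N} x *\<^sub>R H x = H x"
        using eventually_ge_at_top[of N0] by eventually_elim (use N0 in \<open>auto simp: indicator_def\<close>)
      then show "(\<lambda>N. indicator {- real N..real N} x *\<^sub>R H x) \<longlonglongrightarrow> H x"
        by (rule tendsto_eventually)
    qed
  qed (use int in \<open>auto simp: indicator_def\<close>)
  moreover have "(LINT x|lborel. indicator {- real N..real N} x *\<^sub>R H x) = integral {- real N..real N} H" for N :: nat
  proof -
    have "set_integrable lborel {- real N..real N} H"
      unfolding set_integrable_def by (intro integrable_mult_indicator int) auto
    from set_borel_integral_eq_integral(2)[OF this] show ?thesis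
      by (simp add: set_lebesgue_integral_def)
  qed
  ultimately show ?thesis using v by simp
qed

text \<open>The finite form of unfolding a periodised integral. The translate by n covers
  [n, n + 1], so the half-open range from -N to N - 1 fills exactly [-N, N].\<close>

lemma integral_unit_translates:
  fixes H :: "real \<Rightarrow> complex"
  assumes c: "continuous_on UNIV H"
  shows "(\<Sum>n\<in>{- int N..<int N}. integral {0..1} (\<lambda>x. H (x + of_int n))) = integral {- real N..real N} H"
proof (induction N)
  case (Suc N)
  have tr: "integral {0..1} (\<lambda>x. H (x + of_int n)) = integral {of_int n..of_int n + 1} H" for n :: int
  proof -
    have "(H has_integral integral {of_int n..of_int n + 1} H) (cbox (0 + of_int n) (1 + of_int n))"
      by (simp add: add.commute integrable_integral integrable_continuous_real continuous_on_subset[OF c])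
    then have "(H \<circ> (+) (of_int n) has_integral integral {of_int n..of_int n + 1} H) (cbox 0 1)"
      by (subst has_integral_shift_cbox_iff)
    then show ?thesis by (simp add: o_def add.commute integral_unique)
  qed
  have io: "H integrable_on {a..b}" for a b
    by (intro integrable_continuous_real continuous_on_subset[OF c]) auto
  have "{- int (Suc N)..<int (Suc N)} = insert (- int (Suc N)) (insert (int N) {- int N..<int N})" by auto
  then have "(\<Sum>n\<in>{- int (Suc N)..<int (Suc N)}. integral {0..1} (\<lambda>x. H (x + of_int n))) =
     integral {- real (Suc N)..- real N} H + integral {real N..real (Suc N)} H + integral {- real N..real N} H"
    by (simp add: tr Suc.IH[symmetric] add.commute)
  also have "\<dots> = integral {- real (Suc N)..real (Suc N)} H"
    using Henstock_Kurzweil_Integration.integral_combine[OF _ _ io, of "- real (Suc N)" "- real N" "real N", symmetric]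
      Henstock_Kurzweil_Integration.integral_combine[OF _ _ io, of "- real (Suc N)" "real N" "real (Suc N)", symmetric] by (simp add: ac_simps)
  finally show ?case .
qed simp

text \<open>Unordered sums are limits along finite subsets; this allows them to be evaluated along
  symmetric intervals.\<close>

lemma filterlim_symmetric_int_intervals:
  "filterlim (\<lambda>N::nat. {- int N..<int N}) (finite_subsets_at_top UNIV) sequentially"
  unfolding filterlim_finite_subsets_at_top
proof safe
  fix X :: "int set" assume X: "finite X"
  obtain B where B: "\<And>x. x \<in> X \<Longrightarrow> \<bar>x\<bar> \<le> B"
    using X by (metis abs_le_iff bdd_above_def bdd_above.unfold finite_imageI bdd_above_finite imageI)
  show "\<forall>\<^sub>F N in sequentially. finite {- int N..<int N} \<and> X \<subseteq> {- int N..<int N} \<and> {- int N..<int N} \<subseteq> UNIV"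
    using eventually_gt_at_top[of "nat (\<bar>B\<bar>)"] by eventually_elim (use B in force)
qed

text \<open>Both sides are continuous, even and 1-periodic in x and have the same Fourier
  coefficients, so their difference vanishes by uniqueness.\<close>

theorem poisson_gaussian_real:
  fixes t x :: real
  assumes t: "t > 0"
  shows "(\<Sum>\<^sub>\<infinity>n::int. complex_of_real (exp (- pi * (x + of_int n)^2 / t))) =
         of_real (sqrt t) * (\<Sum>\<^sub>\<infinity>k::int. of_real (exp (- pi * t * (of_int k)^2)) * cis (2 * pi * of_int k * x))"
proof -
  define F where "F x = (\<Sum>\<^sub>\<infinity>n::int. complex_of_real (exp (- pi * (x + of_int n)^2 / t)))" for x
  define G where "G x = (\<Sum>\<^sub>\<infinity>k::int. complex_of_real (exp (- pi * t * (of_int k)^2)) * cis (2 * pi * of_int k * x))" for x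
  have smF: "(\<lambda>n::int. exp (- (pi / t) * (of_int n)^2 + (2 * pi * R / t) * \<bar>of_int n\<bar>)) summable_on UNIV" for R :: real
    using t by (intro summable_on_int_gaussian) auto
  have smG: "(\<lambda>n::int. exp (- pi * t * (of_int n)^2)) summable_on UNIV"
    using summable_on_int_gaussian[of "pi * t" 0] t by simp
  have cF: "continuous_on UNIV F"
    unfolding F_def
  proof (rule infsum_continuous_on_UNIV[OF _ _ smF])
    show "norm (complex_of_real (exp (- pi * (x + of_int n)^2 / t))) \<le> exp (- (pi / t) * (of_int n)^2 + (2 * pi * R / t) * \<bar>of_int n\<bar>)" if "\<bar>x\<bar> \<le> R" for x R :: real and n
      using gaussian_shift_bound[OF t that, of n] by simp
  qed (use t in \<open>auto intro!: continuous_intros\<close>)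
  have cG: "continuous_on UNIV G"
    unfolding G_def
    by (rule infsum_continuous_on_UNIV[OF _ _ smG]) (auto intro!: continuous_intros simp: norm_mult)
  have evF: "F (- x) = F x" for x
  proof -
    have "(- x + of_int n)^2 = (x + of_int (- n))^2" for n :: int by (simp add: power2_eq_square algebra_simps)
    then show ?thesis
      unfolding F_def by (intro infsum_reindex_bij_witness[of _ uminus uminus]) auto
  qed
  have perF: "F (x + 1) = F x" for x
    unfolding F_def
    by (intro infsum_reindex_bij_witness[of _ "\<lambda>n. n - 1" "\<lambda>n. n + 1"]) (auto simp: algebra_simps)
  have evG: "G (- x) = G x" for x
    unfolding G_def
    by (intro infsum_reindex_bij_witness[of _ uminus uminus]) auto
  have cis1: "cis (2 * pi * of_int k * (x + of_int n)) = cis (2 * pi * of_int k * x)" for k n :: int and x :: real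
  proof -
    have "cis (2 * pi * of_int k * (x + of_int n)) = cis (2 * pi * of_int k * x) * cis (2 * pi * of_int (k * n))"
      unfolding cis_mult by (simp add: algebra_simps)
    also have "cis (2 * pi * of_int (k * n)) = 1" by (rule cis_multiple_2pi) simp
    finally show ?thesis by simp
  qed
  have perG: "G (x + 1) = G x" for x
    unfolding G_def using cis1[of _ x 1] by simp
  define d where "d x = F x - of_real (sqrt t) * G x" for x
  \<comment> \<open>The character is invariant under integral shifts, so the sum over translates
    unfolds to the Fourier transform of one Gaussian over the whole line.\<close>
  have coefF: "integral {0..1} (\<lambda>x. F x * cis (2 * pi * of_int k * x)) = of_real (sqrt t * exp (- pi * t * (of_int k)^2))" for k
  proof -
    define H where "H y = of_real (exp (- pi * y^2 / t)) * cis (2 * pi * of_int k * y)" for y :: real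
    have cH: "continuous_on UNIV H" unfolding H_def using t by (auto intro!: continuous_intros)
    have FH: "F x * cis (2 * pi * of_int k * x) = (\<Sum>\<^sub>\<infinity>n::int. H (x + of_int n))" for x
      unfolding F_def H_def cis1 by (rule infsum_cmult_left'[symmetric])
    have "((\<lambda>n. integral {0..1} (\<lambda>x. H (x + of_int n))) has_sum integral {0..1} (\<lambda>x. \<Sum>\<^sub>\<infinity>n::int. H (x + of_int n))) UNIV"
    proof (rule has_sum_integral[OF _ _ smF[of 1]])
      show "continuous_on {0..1} (\<lambda>x. H (x + of_int n))" for n :: int
        by (rule continuous_on_compose2[OF cH]) (auto intro!: continuous_intros)
      show "norm (H (x + of_int n)) \<le> exp (- (pi / t) * (of_int n)^2 + (2 * pi * 1 / t) * \<bar>of_int n\<bar>)" if "x \<in> {0..1}" for n :: int and x :: real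
        using gaussian_shift_bound[OF t, of x 1 n] that by (simp add: H_def norm_mult)
    qed
    then have "((\<lambda>X. \<Sum>n\<in>X. integral {0..1} (\<lambda>x. H (x + of_int n))) \<longlongrightarrow> integral {0..1} (\<lambda>x. \<Sum>\<^sub>\<infinity>n::int. H (x + of_int n))) (finite_subsets_at_top UNIV)"
      by (simp add: has_sum_def)
    from filterlim_compose[OF this filterlim_symmetric_int_intervals]
    have "(\<lambda>N. integral {- real N..real N} H) \<longlonglongrightarrow> integral {0..1} (\<lambda>x. \<Sum>\<^sub>\<infinity>n::int. H (x + of_int n))"
      by (simp add: integral_unit_translates[OF cH])
    moreover have "(\<lambda>N. integral {- real N..real N} H) \<longlonglongrightarrow> of_real (sqrt t * exp (- pi * t * (of_int k)^2))"
      using gaussian_fourier_transform[OF t, of "of_int k"] unfolding H_def by (rule integral_symmetric_limit)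
    ultimately show ?thesis unfolding FH using LIMSEQ_unique by blast
  qed
  \<comment> \<open>The pairing is with the character itself and not with its conjugate, so
    orthogonality selects the term j = -k; the Gaussian coefficient is even in j.\<close>
  have coefG: "integral {0..1} (\<lambda>x. G x * cis (2 * pi * of_int k * x)) = of_real (exp (- pi * t * (of_int k)^2))" for k
  proof -
    define h where "h j x = complex_of_real (exp (- pi * t * (of_int j)^2)) * cis (2 * pi * of_int j * x) * cis (2 * pi * of_int k * x)" for j :: int and x :: real
    have GH: "G x * cis (2 * pi * of_int k * x) = (\<Sum>\<^sub>\<infinity>j::int. h j x)" for x
      unfolding G_def h_def by (rule infsum_cmult_left'[symmetric])
    have "((\<lambda>j. integral {0..1} (h j)) has_sum integral {0..1} (\<lambda>x. \<Sum>\<^sub>\<infinity>j::int. h j x)) UNIV"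
    proof (rule has_sum_integral[OF _ _ smG])
      show "continuous_on {0..1} (h j)" for j
        unfolding h_def by (auto intro!: continuous_intros)
    qed (auto simp: h_def norm_mult)
    moreover have "integral {0..1} (h j) = (if j = - k then of_real (exp (- pi * t * (of_int k)^2)) else 0)" for j
    proof -
      have "h j x = complex_of_real (exp (- pi * t * (of_int j)^2)) * cis (2 * pi * of_int (j + k) * x)" for x
        unfolding h_def mult.assoc cis_mult by (simp add: algebra_simps)
      then have "h j = (\<lambda>x. complex_of_real (exp (- pi * t * (of_int j)^2)) * cis (2 * pi * of_int (j + k) * x))" ..
      then have "integral {0..1} (h j) = complex_of_real (exp (- pi * t * (of_int j)^2)) * integral {0..1} (\<lambda>x. cis (2 * pi * of_int (j + k) * x))"
        by (simp only: integral_mult_right)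
      also have "\<dots> = (if j = - k then of_real (exp (- pi * t * (of_int k)^2)) else 0)"
        unfolding integral_cis_period by auto
      finally show ?thesis .
    qed
    ultimately have "((\<lambda>j. if j = - k then of_real (exp (- pi * t * (of_int k)^2)) else 0) has_sum integral {0..1} (\<lambda>x. \<Sum>\<^sub>\<infinity>j::int. h j x)) UNIV"
      by simp
    moreover have "((\<lambda>j. if j = - k then of_real (exp (- pi * t * (of_int k)^2)) else 0) has_sum complex_of_real (exp (- pi * t * (of_int k)^2))) UNIV"
      by (rule has_sum_finite_neutralI[of "{-k}"]) auto
    ultimately show ?thesis unfolding GH using has_sum_unique by blast
  qed
  have "d x = 0"
  proof (rule even_periodic_fourier_unique)
    show "continuous_on UNIV d" unfolding d_def by (intro continuous_intros cF cG)
    show "d (- x) = d x" "d (x + 1) = d x" for x by (simp_all add: d_def evF evG perF perG)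
    fix k
    have i: "(\<lambda>x. F x * cis (2 * pi * of_int k * x)) integrable_on {0..1}" "(\<lambda>x. of_real (sqrt t) * (G x * cis (2 * pi * of_int k * x))) integrable_on {0..1}"
      by (auto intro!: integrable_continuous_real continuous_intros continuous_on_subset[OF cF] continuous_on_subset[OF cG])
    have "integral {0..1} (\<lambda>x. d x * cis (2 * pi * of_int k * x)) = integral {0..1} (\<lambda>x. F x * cis (2 * pi * of_int k * x) - of_real (sqrt t) * (G x * cis (2 * pi * of_int k * x)))"
      by (simp add: d_def algebra_simps)
    also have "\<dots> = integral {0..1} (\<lambda>x. F x * cis (2 * pi * of_int k * x)) - of_real (sqrt t) * integral {0..1} (\<lambda>x. G x * cis (2 * pi * of_int k * x))"
      by (subst integral_diff[OF i]) simp
    also have "\<dots> = 0" by (simp only: coefF coefG) simp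
    finally show "integral {0..1} (\<lambda>x. d x * cis (2 * pi * of_int k * x)) = 0" .
  qed
  then show ?thesis by (simp add: d_def F_def G_def)
qed

section \<open>Holomorphy of the theta series and analytic continuation\<close>

lemma exp_series_field_derivative:
  fixes a :: "'i \<Rightarrow> complex"
  assumes \<delta>: "0 < \<delta>"
    and sm: "(\<lambda>i. norm (c i * exp (a i * z)) * exp (\<delta> * norm (a i))) summable_on I"
  shows "(\<lambda>z. \<Sum>\<^sub>\<infinity>i\<in>I. c i * exp (a i * z)) field_differentiable (at z)"
proof -
  have "((\<lambda>z. \<Sum>\<^sub>\<infinity>i\<in>I. c i * exp (a i * z)) has_derivative
          (\<lambda>v. \<Sum>\<^sub>\<infinity>i\<in>I. c i * exp (a i * z) * (a i * v))) (at z)"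
    by (rule exp_series_has_derivative[where a = "\<lambda>i v. a i * v" and K = "\<lambda>i. norm (a i)", OF _ _ _ \<delta> sm])
       (auto simp: norm_mult linear_iff algebra_simps)
  also have "(\<lambda>v. \<Sum>\<^sub>\<infinity>i\<in>I. c i * exp (a i * z) * (a i * v)) = (\<lambda>v. (\<Sum>\<^sub>\<infinity>i\<in>I. c i * exp (a i * z) * a i) * v)"
    by (subst infsum_cmult_left'[symmetric]) (simp add: mult.assoc)
  finally show ?thesis
    unfolding field_differentiable_def has_field_derivative_def by blast
qed

lemma summable_on_int_gaussian_bound:
  fixes f :: "int \<Rightarrow> real"
  assumes "\<epsilon> > 0" and "\<And>n. f n \<le> - \<epsilon> * (of_int n)^2 + C * \<bar>of_int n\<bar>"
  shows "(\<lambda>n. exp (f n)) summable_on UNIV"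
  by (rule summable_on_comparison_test[OF summable_on_int_gaussian[OF assms(1), of C]])
     (use assms(2) in auto)

text \<open>The Jacobi theta function usually written theta_3, with period 1 in w.\<close>

definition jtheta :: "complex \<Rightarrow> complex \<Rightarrow> complex" where
  "jtheta \<tau> w = (\<Sum>\<^sub>\<infinity>n::int. exp (pi * \<i> * (\<tau> * (of_int n)^2 + 2 * of_int n * w)))"

lemma Re_jtheta_exponent:
  "Re (pi * \<i> * (\<tau> * (of_int n)^2 + 2 * of_int n * w)) \<le> - (pi * Im \<tau>) * (of_int n)^2 + (2 * pi * \<bar>Im w\<bar>) * \<bar>of_int n\<bar>"
proof -
  have "Re (pi * \<i> * (\<tau> * (of_int n)^2 + 2 * of_int n * w)) = - (pi * Im \<tau>) * (of_int n)^2 + 2 * pi * (- (of_int n * Im w))"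
    by (simp add: algebra_simps flip: of_int_power)
  also have "- (of_int n * Im w) \<le> \<bar>Im w\<bar> * \<bar>of_int n\<bar>"
    using abs_ge_minus_self[of "of_int n * Im w"] by (simp add: abs_mult mult.commute)
  finally show ?thesis by (simp add: mult.assoc)
qed

lemma jtheta_holomorphic_w:
  assumes "Im \<tau> > 0"
  shows "jtheta \<tau> holomorphic_on UNIV"
proof -
  have "jtheta \<tau> field_differentiable (at w)" for w
  proof -
    have e: "exp (pi * \<i> * (\<tau> * (of_int n)^2 + 2 * of_int n * w)) = exp (pi * \<i> * \<tau> * (of_int n)^2) * exp (2 * pi * \<i> * of_int n * w)" for n :: int and w
      by (simp add: algebra_simps flip: exp_add)
    have "(\<lambda>w. \<Sum>\<^sub>\<infinity>n::int. exp (pi * \<i> * \<tau> * (of_int n)^2) * exp (2 * pi * \<i> * of_int n * w)) field_differentiable (at w)"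
    proof (rule exp_series_field_derivative[of 1])
      have "norm (exp (pi * \<i> * \<tau> * (of_int n)^2) * exp (2 * pi * \<i> * of_int n * w)) * exp (1 * norm (2 * pi * \<i> * of_int n)) =
        exp (Re (pi * \<i> * (\<tau> * (of_int n)^2 + 2 * of_int n * w)) + 2 * pi * \<bar>of_int n\<bar>)" for n :: int
        unfolding e[symmetric] norm_exp_eq_Re by (simp add: norm_mult flip: exp_add)
      moreover have "(\<lambda>n::int. exp (Re (pi * \<i> * (\<tau> * (of_int n)^2 + 2 * of_int n * w)) + 2 * pi * \<bar>of_int n\<bar>)) summable_on UNIV"
      proof (rule summable_on_int_gaussian_bound)
        fix n :: int
        show "Re (pi * \<i> * (\<tau> * (of_int n)^2 + 2 * of_int n * w)) + 2 * pi * \<bar>of_int n\<bar>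
          \<le> - (pi * Im \<tau>) * (of_int n)^2 + (2 * pi * \<bar>Im w\<bar> + 2 * pi) * \<bar>of_int n\<bar>"
          using Re_jtheta_exponent[of \<tau> n w] by (simp only: ring_distribs)
      qed (use assms in auto)
      ultimately show "(\<lambda>n::int. norm (exp (pi * \<i> * \<tau> * (of_int n)^2) * exp (2 * pi * \<i> * of_int n * w)) * exp (1 * norm (2 * pi * \<i> * of_int n))) summable_on UNIV"
        by (simp only:)
    qed simp
    then show ?thesis unfolding e[symmetric] jtheta_def[symmetric] by simp
  qed
  then show ?thesis by (simp add: holomorphic_on_def field_differentiable_at_within)
qed

text \<open>This is \<open>jtheta s (s * w)\<close>. Although both arguments move with s, the
  exponents remain linear in s, so the lemma on exponential series applies; it is used at s =
  -1/\<tau>.\<close>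

lemma shifted_theta_holomorphic:
  "(\<lambda>s. \<Sum>\<^sub>\<infinity>n::int. exp (pi * \<i> * s * ((of_int n)^2 + 2 * of_int n * w))) holomorphic_on {s. Im s > 0}"
proof -
  have "(\<lambda>s. \<Sum>\<^sub>\<infinity>n::int. exp (pi * \<i> * s * ((of_int n)^2 + 2 * of_int n * w))) field_differentiable (at s)"
    if s: "Im s > 0" for s
  proof -
    let ?a = "\<lambda>n::int. pi * \<i> * ((of_int n)^2 + 2 * of_int n * w)"
    have "(\<lambda>s. \<Sum>\<^sub>\<infinity>n::int. 1 * exp (?a n * s)) field_differentiable (at s)"
    \<comment> \<open>The choice Im s / 2 spends half of the Gaussian decay on the weight and keeps
      the other half for convergence.\<close>
    proof (rule exp_series_field_derivative[of "Im s / 2"])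
      have na: "norm (?a n) \<le> pi * (of_int n)^2 + 2 * pi * norm w * \<bar>of_int n\<bar>" for n
      proof -
        have "norm (?a n) = pi * norm ((of_int n)^2 + 2 * of_int n * w)" by (simp add: norm_mult)
        also have "\<dots> \<le> pi * ((of_int n)^2 + 2 * \<bar>of_int n\<bar> * norm w)"
          by (intro mult_left_mono order_trans[OF norm_triangle_ineq]) (auto simp: norm_mult norm_power)
        finally show ?thesis by (simp add: algebra_simps)
      qed
      have "(\<lambda>n. exp (Re (?a n * s) + Im s / 2 * norm (?a n))) summable_on UNIV"
      proof (rule summable_on_int_gaussian_bound)
        fix n :: int
        have "?a n * s = pi * \<i> * (s * (of_int n)^2 + 2 * of_int n * (w * s))" by (simp add: algebra_simps)
        then have "Re (?a n * s) \<le> - (pi * Im s) * (of_int n)^2 + (2 * pi * \<bar>Im (w * s)\<bar>) * \<bar>of_int n\<bar>"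
          using Re_jtheta_exponent[of s n "w * s"] by (simp only:)
        moreover have "Im s / 2 * norm (?a n) \<le> Im s / 2 * (pi * (of_int n)^2 + 2 * pi * norm w * \<bar>of_int n\<bar>)"
          using s na by (intro mult_left_mono) auto
        ultimately have "Re (?a n * s) + Im s / 2 * norm (?a n) \<le>
           (- (pi * Im s) * (of_int n)^2 + (2 * pi * \<bar>Im (w * s)\<bar>) * \<bar>of_int n\<bar>) + Im s / 2 * (pi * (of_int n)^2 + 2 * pi * norm w * \<bar>of_int n\<bar>)"
          by (rule add_mono)
        also have "\<dots> = - (pi * Im s / 2) * (of_int n)^2 + (2 * pi * \<bar>Im (w * s)\<bar> + Im s * pi * norm w) * \<bar>of_int n\<bar>"
          by (simp add: field_simps)
        finally show "Re (?a n * s) + Im s / 2 * norm (?a n) \<le>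
          - (pi * Im s / 2) * (of_int n)^2 + (2 * pi * \<bar>Im (w * s)\<bar> + Im s * pi * norm w) * \<bar>of_int n\<bar>" .
      qed (use s in auto)
      then show "(\<lambda>n. norm (1 * exp (?a n * s)) * exp (Im s / 2 * norm (?a n))) summable_on UNIV"
        by (simp only: mult_1 norm_exp_eq_Re exp_add)
    qed (use s in auto)
    then show ?thesis by (simp add: mult_ac)
  qed
  then show ?thesis by (simp add: holomorphic_on_def field_differentiable_at_within)
qed

lemma shifted_gaussian_eq_jtheta:
  "(\<Sum>\<^sub>\<infinity>n::int. exp (pi * \<i> * s * (of_int n + w)^2)) = exp (pi * \<i> * s * w^2) * jtheta s (s * w)"
  unfolding jtheta_def
  by (subst infsum_cmult_right'[symmetric], rule infsum_cong)
     (simp add: power2_eq_square algebra_simps flip: exp_add)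

lemma zero_islimpt_Reals: "(0::complex) islimpt \<real>"
  unfolding islimpt_approachable
proof safe
  fix e :: real assume "e > 0"
  then show "\<exists>x'\<in>\<real>. x' \<noteq> (0::complex) \<and> dist x' 0 < e"
    by (intro bexI[of _ "of_real (e/2)"]) auto
qed

text \<open>For real w this is Poisson summation with \<tau> = i t. Both sides are entire in w, so
  the identity theorem extends it from the real line to all w.\<close>

lemma jacobi_transformation_imaginary_axis:
  assumes t: "t > 0"
  shows "exp (pi * \<i> * (-1/(\<i> * of_real t)) * w^2) * jtheta (-1/(\<i> * of_real t)) (-1/(\<i> * of_real t) * w) = of_real (sqrt t) * jtheta (\<i> * of_real t) w"
proof -
  let ?s = "-1/(\<i> * of_real t) :: complex"
  have s: "?s = \<i> / of_real t" using t by (simp add: field_simps)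
  have Ims: "Im ?s > 0" unfolding s using t by (simp add: Im_divide_of_real)
  have hs: "(\<lambda>w. jtheta ?s (?s * w)) holomorphic_on UNIV"
  proof -
    have "(\<lambda>w. ?s * w) holomorphic_on UNIV" by (intro holomorphic_intros)
    from holomorphic_on_compose_gen[OF this jtheta_holomorphic_w[OF Ims]] show ?thesis
      by (simp only: o_def subset_UNIV)
  qed
  have ht: "jtheta (\<i> * of_real t) holomorphic_on UNIV" 
    by (rule jtheta_holomorphic_w) (use t in auto)
  have "exp (pi * \<i> * ?s * w^2) * jtheta ?s (?s * w) - of_real (sqrt t) * jtheta (\<i> * of_real t) w = 0"
  proof (rule analytic_continuation[of "\<lambda>w. exp (pi * \<i> * ?s * w^2) * jtheta ?s (?s * w) - of_real (sqrt t) * jtheta (\<i> * of_real t) w" UNIV \<real> 0])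
    show "(\<lambda>w. exp (pi * \<i> * ?s * w^2) * jtheta ?s (?s * w) - of_real (sqrt t) * jtheta (\<i> * of_real t) w) holomorphic_on UNIV"
      by (intro holomorphic_intros hs ht)
    fix z :: complex assume "z \<in> \<real>"
    then obtain x where z: "z = of_real x" by (auto elim: Reals_cases)
    have e1: "exp (pi * \<i> * ?s * (of_int n + z)^2) = complex_of_real (exp (- pi * (x + of_int n)^2 / t))" for n :: int
    proof -
      have "pi * \<i> * ?s * (of_int n + z)^2 = complex_of_real (- pi * (x + of_int n)^2 / t)"
        unfolding z using t by (simp add: field_simps)
      then show ?thesis by (simp only: exp_of_real)
    qed
    have e2: "exp (pi * \<i> * ((\<i> * of_real t) * (of_int n)^2 + 2 * of_int n * z)) = of_real (exp (- pi * t * (of_int n)^2)) * cis (2 * pi * of_int n * x)" for n :: int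
    proof -
      have "pi * \<i> * ((\<i> * of_real t) * (of_int n)^2 + 2 * of_int n * z) = complex_of_real (- pi * t * (of_int n)^2) + \<i> * of_real (2 * pi * of_int n * x)"
        unfolding z by (simp add: algebra_simps)
      then show ?thesis by (simp only: exp_add cis_conv_exp exp_of_real)
    qed
    show "exp (pi * \<i> * ?s * z^2) * jtheta ?s (?s * z) - of_real (sqrt t) * jtheta (\<i> * of_real t) z = 0"
      using poisson_gaussian_real[OF t, of x]
      unfolding shifted_gaussian_eq_jtheta[symmetric] jtheta_def[of "\<i> * of_real t" z] e1 e2 by simp
  qed (use zero_islimpt_Reals in auto)
  then show ?thesis by simp
qed

text \<open>A second continuation, now in \<tau>, from the positive imaginary axis to the upper half
  plane.\<close>

theorem jacobi_transformation:
  assumes \<tau>: "Im \<tau> > 0"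
  shows "(\<Sum>\<^sub>\<infinity>n::int. exp (- pi * \<i> * (of_int n + w)^2 / \<tau>)) = csqrt (- \<i> * \<tau>) * jtheta \<tau> w"
proof -
  define S where "S = {s::complex. Im s > 0}"
  define f where "f \<tau> = exp (pi * \<i> * (-1/\<tau>) * w^2) * (\<Sum>\<^sub>\<infinity>n::int. exp (pi * \<i> * (-1/\<tau>) * ((of_int n)^2 + 2 * of_int n * w)))" for \<tau>
  have oS: "open S" unfolding S_def by (rule open_halfspace_Im_gt)
  have cS: "connected S" unfolding S_def by (intro convex_connected convex_halfspace_Im_gt)
  have inv: "Im (-1/s) > 0" if "Im s > 0" for s
    using that by (simp add: Im_divide' divide_neg_pos sum_power2_gt_zero_iff) (auto simp: complex_eq_iff)
  have nz: "s \<noteq> 0" if "s \<in> S" for s using that by (auto simp: S_def)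
  have "(\<lambda>\<tau>. \<Sum>\<^sub>\<infinity>n::int. exp (pi * \<i> * (-1/\<tau>) * ((of_int n)^2 + 2 * of_int n * w))) holomorphic_on S"
  proof -
    have "(\<lambda>\<tau>. -1/\<tau>) holomorphic_on S" using nz by (intro holomorphic_intros) auto
    moreover have "(\<lambda>\<tau>. -1/\<tau>) ` S \<subseteq> {s. Im s > 0}"
      using inv unfolding S_def by blast
    ultimately show ?thesis
      using holomorphic_on_compose_gen[OF _ shifted_theta_holomorphic[of w], of "\<lambda>\<tau>. -1/\<tau>" S]
      by (simp only: o_def)
  qed
  then have hf: "f holomorphic_on S"
    unfolding f_def using nz by (intro holomorphic_intros) auto
  have "jtheta s w = (\<Sum>\<^sub>\<infinity>n::int. exp (2 * pi * \<i> * of_int n * w) * exp ((pi * \<i> * (of_int n)^2) * s))" for s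
    unfolding jtheta_def by (rule infsum_cong) (simp add: algebra_simps flip: exp_add)
  moreover have "(\<lambda>s. \<Sum>\<^sub>\<infinity>n::int. exp (2 * pi * \<i> * of_int n * w) * exp ((pi * \<i> * (of_int n)^2) * s)) field_differentiable (at s)"
    if s: "Im s > 0" for s
  proof (rule exp_series_field_derivative[of "Im s / 2"])
    have "norm (exp (2 * pi * \<i> * of_int n * w) * exp ((pi * \<i> * (of_int n)^2) * s)) * exp (Im s / 2 * norm (pi * \<i> * (of_int n)^2))
      = exp (Re (pi * \<i> * (s * (of_int n)^2 + 2 * of_int n * w)) + Im s / 2 * (pi * (of_int n)^2))" for n :: int
    proof -
      have "exp (2 * pi * \<i> * of_int n * w) * exp ((pi * \<i> * (of_int n)^2) * s) = exp (pi * \<i> * (s * (of_int n)^2 + 2 * of_int n * w))"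
        by (simp add: algebra_simps flip: exp_add)
      moreover have "norm (pi * \<i> * (of_int n)^2) = pi * (of_int n)^2" by (simp add: norm_mult norm_power)
      ultimately show ?thesis by (simp only: norm_exp_eq_Re exp_add)
    qed
    moreover have "(\<lambda>n::int. exp (Re (pi * \<i> * (s * (of_int n)^2 + 2 * of_int n * w)) + Im s / 2 * (pi * (of_int n)^2))) summable_on UNIV"
    proof (rule summable_on_int_gaussian_bound)
      fix n :: int
      have "- (pi * Im s / 2) * (of_int n)^2 = - (pi * Im s) * (of_int n)^2 + Im s / 2 * (pi * (of_int n)^2)" by (simp add: field_simps)
      then show "Re (pi * \<i> * (s * (of_int n)^2 + 2 * of_int n * w)) + Im s / 2 * (pi * (of_int n)^2)
        \<le> - (pi * Im s / 2) * (of_int n)^2 + (2 * pi * \<bar>Im w\<bar>) * \<bar>of_int n\<bar>"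
        using Re_jtheta_exponent[of s n w] by linarith
    qed (use s in auto)
    ultimately show "(\<lambda>n::int. norm (exp (2 * pi * \<i> * of_int n * w) * exp ((pi * \<i> * (of_int n)^2) * s)) * exp (Im s / 2 * norm (pi * \<i> * (of_int n)^2))) summable_on UNIV"
      by (simp only:)
  qed (use s in auto)
  ultimately have hj: "(\<lambda>s. jtheta s w) holomorphic_on S"
    by (simp add: holomorphic_on_def field_differentiable_at_within S_def)
  \<comment> \<open>The real part of -i s is Im s > 0, so the principal root is holomorphic here and
    is the positive root on the imaginary axis.\<close>
  have "- \<i> * s \<notin> \<real>\<^sub>\<le>\<^sub>0" if "s \<in> S" for s
    using that by (simp add: S_def complex_nonpos_Reals_iff)
  then have "(\<lambda>s. csqrt (- \<i> * s)) holomorphic_on S"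
    by (intro holomorphic_on_csqrt' holomorphic_intros)
  then have hg: "(\<lambda>s. csqrt (- \<i> * s) * jtheta s w) holomorphic_on S"
    by (rule holomorphic_on_mult[OF _ hj])
  have fj: "f s = exp (pi * \<i> * (-1/s) * w^2) * jtheta (-1/s) ((-1/s) * w)" for s
  proof -
    have e: "pi * \<i> * c * ((of_int n)^2 + 2 * of_int n * w) = pi * \<i> * (c * (of_int n)^2 + 2 * of_int n * (c * w))" for c :: complex and n :: int
      by (simp add: algebra_simps)
    show ?thesis unfolding f_def jtheta_def e by (rule refl)
  qed
  have "f \<tau> - csqrt (- \<i> * \<tau>) * jtheta \<tau> w = 0"
  proof (rule analytic_continuation[of "\<lambda>\<tau>. f \<tau> - csqrt (- \<i> * \<tau>) * jtheta \<tau> w" S "{\<i> * of_real t |t. t > 0}" \<i>])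
    show "(\<lambda>\<tau>. f \<tau> - csqrt (- \<i> * \<tau>) * jtheta \<tau> w) holomorphic_on S"
      by (intro holomorphic_intros hf hg)
    show "\<i> islimpt {\<i> * of_real t |t. t > 0}"
      unfolding islimpt_approachable
    proof safe
      fix e :: real assume e: "e > 0"
      have "dist (\<i> * of_real (1 + e/2)) \<i> = e / 2"
        using e by (simp add: dist_norm algebra_simps norm_mult)
      with e show "\<exists>x'\<in>{\<i> * of_real t |t. t > 0}. x' \<noteq> \<i> \<and> dist x' \<i> < e"
        by (intro bexI[of _ "\<i> * of_real (1 + e/2)"]) (auto simp: complex_eq_iff intro!: exI[of _ "1 + e/2"])
    qed
    fix z assume "z \<in> {\<i> * complex_of_real t |t. t > 0}"
    then obtain t where t: "z = \<i> * of_real t" "t > 0" by auto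
    have "csqrt (- \<i> * z) = of_real (sqrt t)" using t by (simp add: csqrt_of_real_nonneg flip: of_real_sqrt)
    then show "f z - csqrt (- \<i> * z) * jtheta z w = 0"
      using jacobi_transformation_imaginary_axis[OF t(2), of w] by (simp add: fj t(1))
  qed (use \<tau> in \<open>auto simp: S_def oS[unfolded S_def] cS[unfolded S_def]\<close>)
  moreover have "(\<Sum>\<^sub>\<infinity>n::int. exp (- pi * \<i> * (of_int n + w)^2 / \<tau>)) = f \<tau>"
    unfolding fj shifted_gaussian_eq_jtheta[symmetric] by (simp add: mult_ac)
  ultimately show ?thesis by simp
qed

section \<open>The \<open>E\<^sub>8\<close> theta series\<close>

text \<open>Vectors of the \<open>E\<^sub>8\<close> lattice are represented by their coordinates multiplied by 2.\<close>

definition E8 :: "(8 \<Rightarrow> int) set" where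
  "E8 = {x. (\<forall>k l. x k mod 2 = x l mod 2) \<and> 4 dvd (\<Sum>k\<in>UNIV. x k)}"

text \<open>With doubled coordinates, the classes of 0 and 1 stand for integral and half-integral
  coordinates.\<close>

definition resid :: "int \<Rightarrow> int set" where "resid a = {n. n mod 2 = a}"

lemma bij_betw_resid: "a \<in> {0,1} \<Longrightarrow> bij_betw (\<lambda>p. 2 * p + a) UNIV (resid a)"
  by (rule bij_betw_byWitness[where f' = "\<lambda>n. (n - a) div 2"]) (auto simp: resid_def, presburger)

lemma bij_betw_resid_minus: "bij_betw (\<lambda>p. 2 * p - 1) UNIV (resid 1)"
  by (rule bij_betw_byWitness[where f' = "\<lambda>n. (n + 1) div 2"]) (auto simp: resid_def, presburger+)

text \<open>The indicator of \<open>E8\<close> is a sum over characters modulo 4, which turns lattice sums into products of one-dimensional ones.\<close>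

lemma infsum_E8_prod:
  fixes f :: "8 \<Rightarrow> int \<Rightarrow> complex"
  assumes sm: "\<And>k. (\<lambda>n. norm (f k n)) summable_on UNIV"
  shows "(\<Sum>\<^sub>\<infinity>x\<in>E8. \<Prod>k\<in>UNIV. f k (x k)) =
    (\<Sum>a\<in>{0,1}. \<Sum>b\<in>{0,1::int}. \<Prod>k\<in>UNIV. \<Sum>\<^sub>\<infinity>n\<in>resid a. exp (pi * \<i> * of_int b * of_int n / 2) * f k n) / 2"
proof -
  define C where "C a = (PiE UNIV (\<lambda>_. resid a) :: (8 \<Rightarrow> int) set)" for a
  have C: "C a = {x. \<forall>k. x k mod 2 = a}" for a
    by (auto simp: C_def resid_def PiE_UNIV_domain Pi_def)
  have E8: "E8 = (C 0 \<inter> E8) \<union> (C 1 \<inter> E8)"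
  proof -
    have "x \<in> C 0 \<or> x \<in> C 1" if "x \<in> E8" for x
    proof -
      have "\<forall>k. x k mod 2 = x 0 mod 2" using that unfolding E8_def by blast
      moreover have "x 0 mod 2 = 0 \<or> x 0 mod 2 = 1" by presburger
      ultimately have "(\<forall>k. x k mod 2 = 0) \<or> (\<forall>k. x k mod 2 = 1)" by metis
      then show ?thesis unfolding C by (simp only: mem_Collect_eq)
    qed
    then show ?thesis by blast
  qed
  have disj: "(C 0 \<inter> E8) \<inter> (C 1 \<inter> E8) = {}" unfolding C by auto
  define g where "g b k n = exp (pi * \<i> * of_int b * of_int n / 2) * f k n" for b :: int and k n
  have ng: "norm (g b k n) = norm (f k n)" for b k n
    by (simp add: g_def norm_mult)
  have smg: "(\<lambda>n. norm (g b k n)) summable_on resid a" for a b k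
    unfolding ng by (rule summable_on_subset[OF sm]) auto
  have smC: "(\<lambda>x. \<Prod>k\<in>UNIV. g b k (x k)) summable_on C a" for a b
    unfolding C_def
    by (rule abs_summable_summable) (use smg in \<open>auto simp: prod_norm[symmetric] intro!: summable_on_prod_PiE\<close>)
  \<comment> \<open>Eight entries of equal parity have an even sum s, so exp (pi i s / 2) is 1 or
    -1, and 1 plus it equals 2 or 0 according to whether 4 divides s.\<close>
  have key: "(\<Sum>b\<in>{0,1::int}. \<Prod>k\<in>UNIV. g b k (x k)) = (if x \<in> E8 then 2 * (\<Prod>k\<in>UNIV. f k (x k)) else 0)"
    if x: "x \<in> C a" for x a
  proof -
    define s where "s = (\<Sum>k\<in>UNIV. x k)"
    have "(\<Prod>k\<in>UNIV. g b k (x k)) = exp (pi * \<i> * of_int b * of_int s / 2) * (\<Prod>k\<in>UNIV. f k (x k))" for b :: int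
      by (simp add: g_def prod.distrib s_def sum_distrib_left sum_divide_distrib flip: exp_sum)
    then have *: "(\<Sum>b\<in>{0,1::int}. \<Prod>k\<in>UNIV. g b k (x k)) = (1 + exp (pi * \<i> * of_int s / 2)) * (\<Prod>k\<in>UNIV. f k (x k))"
      by (simp add: ring_distribs)
    have E: "x \<in> E8 \<longleftrightarrow> 4 dvd s" using x unfolding C E8_def s_def by auto
    have "even s"
    proof -
      have "s mod 2 = (\<Sum>k\<in>UNIV. x k mod 2) mod 2" unfolding s_def by (rule mod_sum_eq[symmetric])
      also have "\<dots> = (\<Sum>k\<in>(UNIV::8 set). a) mod 2" using x unfolding C by simp
      also have "\<dots> = 0" by simp
      finally show ?thesis by auto
    qed
    then obtain h where h: "s = 2 * h" by (elim evenE)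
    have "exp (pi * \<i> * of_int s / 2) = exp (of_int h * (pi * \<i>))" by (simp add: h mult_ac)
    also have "\<dots> = (if even h then 1 else -1)"
    proof (cases "even h")
      case True
      then obtain j where "h = 2 * j" by (elim evenE)
      then have "exp (of_int h * (pi * \<i>)) = exp (2 * of_int j * pi * \<i>)" by (simp add: mult_ac)
      also have "\<dots> = 1" by (rule exp_integer_2pi) simp
      finally show ?thesis using True by simp
    next
      case False
      then obtain j where j: "h = 2 * j + 1" by (elim oddE)
      have "exp (of_int h * (pi * \<i>)) = exp (2 * of_int j * pi * \<i> + pi * \<i>)" by (simp add: j algebra_simps)
      also have "\<dots> = exp (2 * of_int j * pi * \<i>) * exp (pi * \<i>)" by (rule exp_add)
      also have "exp (2 * of_int j * pi * \<i>) = 1" by (rule exp_integer_2pi) simp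
      finally show ?thesis using False by simp
    qed
    also have "even h \<longleftrightarrow> 4 dvd s" unfolding h by presburger
    finally show ?thesis unfolding * E by simp
  qed
  have half: "(\<Sum>b\<in>{0,1}. \<Prod>k\<in>UNIV. infsum (g b k) (resid a)) = 2 * (\<Sum>\<^sub>\<infinity>x\<in>C a \<inter> E8. \<Prod>k\<in>UNIV. f k (x k))" for a
  proof -
    have "(\<Sum>b\<in>{0,1}. \<Prod>k\<in>UNIV. infsum (g b k) (resid a)) = (\<Sum>b\<in>{0,1}. \<Sum>\<^sub>\<infinity>x\<in>C a. \<Prod>k\<in>UNIV. g b k (x k))"
      unfolding C_def by (subst infsum_prod_PiE_abs) (use smg in auto)
    also have "\<dots> = (\<Sum>\<^sub>\<infinity>x\<in>C a. \<Sum>b\<in>{0,1}. \<Prod>k\<in>UNIV. g b k (x k))"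
      using infsum_add[OF smC[of 0 a] smC[of 1 a]] by simp
    also have "\<dots> = (\<Sum>\<^sub>\<infinity>x\<in>C a. if x \<in> E8 then 2 * (\<Prod>k\<in>UNIV. f k (x k)) else 0)"
      by (rule infsum_cong) (rule key)
    also have "\<dots> = (\<Sum>\<^sub>\<infinity>x\<in>C a \<inter> E8. 2 * (\<Prod>k\<in>UNIV. f k (x k)))"
      by (rule infsum_cong_neutral) auto
    also have "\<dots> = 2 * (\<Sum>\<^sub>\<infinity>x\<in>C a \<inter> E8. \<Prod>k\<in>UNIV. f k (x k))" by (rule infsum_cmult_right')
    finally show ?thesis .
  qed
  have smf: "(\<lambda>x. \<Prod>k\<in>UNIV. f k (x k)) summable_on (C a \<inter> E8)" for a
    using smC[of 0 a] by (auto simp: g_def intro: summable_on_subset_banach)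
  have "(\<Sum>\<^sub>\<infinity>x\<in>E8. \<Prod>k\<in>UNIV. f k (x k)) = (\<Sum>\<^sub>\<infinity>x\<in>C 0 \<inter> E8. \<Prod>k\<in>UNIV. f k (x k)) + (\<Sum>\<^sub>\<infinity>x\<in>C 1 \<inter> E8. \<Prod>k\<in>UNIV. f k (x k))"
    by (subst E8, rule infsum_Un_disjoint[OF smf smf disj])
  also have "\<dots> = (\<Sum>a\<in>{0,1}. \<Sum>b\<in>{0,1}. \<Prod>k\<in>UNIV. infsum (g b k) (resid a)) / 2"
    using half[of 0] half[of 1] by (simp add: add_divide_distrib)
  moreover have "g b k = (\<lambda>n. exp (pi * \<i> * of_int b * of_int n / 2) * f k n)" for b k
    by (rule ext) (rule g_def)
  ultimately show ?thesis by (simp only:)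
qed

text \<open>Inversion for theta functions with characteristics: it exchanges the residue class
  \<open>a\<close> with the character \<open>b\<close>, at the cost of a root of unity.\<close>

lemma jacobi_transformation_characteristics:
  assumes \<tau>: "Im \<tau> > 0" and ab: "a \<in> {0,1}" "b \<in> {0,1::int}"
  shows "(\<Sum>\<^sub>\<infinity>n\<in>resid a. exp (pi * \<i> * of_int b * of_int n / 2) * exp (- (pi * \<i> / 4) * (of_int n + u)^2 / \<tau>)) =
    exp (pi * \<i> * of_int (a * b) / 2) * csqrt (- \<i> * \<tau>) *
    (\<Sum>\<^sub>\<infinity>n\<in>resid b. exp (pi * \<i> * of_int a * of_int n / 2) * exp (pi * \<i> / 4 * (\<tau> * (of_int n)^2 + 2 * of_int n * u)))"
proof -
  have nz: "\<tau> \<noteq> 0" using \<tau> by auto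
  define w where "w = (of_int a + u) / 2"
  have L: "(\<Sum>\<^sub>\<infinity>n\<in>resid a. exp (pi * \<i> * of_int b * of_int n / 2) * exp (- (pi * \<i> / 4) * (of_int n + u)^2 / \<tau>))
    = (\<Sum>\<^sub>\<infinity>p::int. exp (pi * \<i> * of_int b * (2 * of_int p + of_int a) / 2) * exp (- pi * \<i> * (of_int p + w)^2 / \<tau>))"
  proof -
    have "- (pi * \<i> / 4) * (of_int (2 * p + a) + u)^2 / \<tau> = - pi * \<i> * (of_int p + w)^2 / \<tau>" for p :: int
    proof -
      have "of_int (2 * p + a) + u = 2 * (of_int p + w)" by (simp add: w_def)
      then show ?thesis by (simp only: power_mult_distrib) simp
    qed
    then show ?thesis
      by (subst infsum_reindex_bij_betw[OF bij_betw_resid[OF ab(1)], symmetric]) simp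
  qed
  show ?thesis
  proof (cases "b = 0")
    case True
    have "(\<Sum>\<^sub>\<infinity>n\<in>resid b. exp (pi * \<i> * of_int a * of_int n / 2) * exp (pi * \<i> / 4 * (\<tau> * (of_int n)^2 + 2 * of_int n * u)))
       = (\<Sum>\<^sub>\<infinity>k::int. exp (pi * \<i> * of_int a * of_int (2 * k + b) / 2) * exp (pi * \<i> / 4 * (\<tau> * (of_int (2 * k + b))^2 + 2 * of_int (2 * k + b) * u)))"
      by (rule infsum_reindex_bij_betw[OF bij_betw_resid[OF ab(2)], symmetric])
    also have "\<dots> = jtheta \<tau> w"
      unfolding jtheta_def True
      by (rule infsum_cong, unfold exp_add[symmetric], intro arg_cong[where f = exp])
         (simp add: w_def power2_eq_square field_simps)
    finally show ?thesis unfolding L using jacobi_transformation[OF \<tau>, of w] True by simp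
  next
    case False
    \<comment> \<open>For b = 1 the sign exp (pi i p) on the left is absorbed by completing the
      square with w replaced by w - \<tau>/2. Writing the odd numbers as 2 k - 1 produces the same
      shift on the right.\<close>
    then have b: "b = 1" using ab by simp
    have "(\<Sum>\<^sub>\<infinity>n\<in>resid b. exp (pi * \<i> * of_int a * of_int n / 2) * exp (pi * \<i> / 4 * (\<tau> * (of_int n)^2 + 2 * of_int n * u)))
       = (\<Sum>\<^sub>\<infinity>k::int. exp (pi * \<i> * of_int a * of_int (2 * k - 1) / 2) * exp (pi * \<i> / 4 * (\<tau> * (of_int (2 * k - 1))^2 + 2 * of_int (2 * k - 1) * u)))"
      unfolding b by (rule infsum_reindex_bij_betw[OF bij_betw_resid_minus, symmetric])
    also have "\<dots> = (\<Sum>\<^sub>\<infinity>k::int. exp (- pi * \<i> * w + pi * \<i> * \<tau> / 4) * exp (pi * \<i> * (\<tau> * (of_int k)^2 + 2 * of_int k * (w - \<tau> / 2))))"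
      by (rule infsum_cong, unfold exp_add[symmetric], intro arg_cong[where f = exp])
         (simp add: w_def power2_eq_square field_simps)
    also have "\<dots> = exp (- pi * \<i> * w + pi * \<i> * \<tau> / 4) * jtheta \<tau> (w - \<tau> / 2)"
      unfolding jtheta_def by (rule infsum_cmult_right')
    finally have R: "(\<Sum>\<^sub>\<infinity>n\<in>resid b. exp (pi * \<i> * of_int a * of_int n / 2) * exp (pi * \<i> / 4 * (\<tau> * (of_int n)^2 + 2 * of_int n * u)))
        = exp (- pi * \<i> * w + pi * \<i> * \<tau> / 4) * jtheta \<tau> (w - \<tau> / 2)" .
    have "exp (pi * \<i> * of_int b * (2 * of_int p + of_int a) / 2) * exp (- pi * \<i> * (of_int p + w)^2 / \<tau>)
      = exp (pi * \<i> * of_int a / 2) * exp (- pi * \<i> * w + pi * \<i> * \<tau> / 4) * exp (- pi * \<i> * (of_int p + (w - \<tau> / 2))^2 / \<tau>)" for p :: int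
      unfolding b exp_add[symmetric] using nz by (intro arg_cong[where f = exp]) (simp add: power2_eq_square field_simps)
    then have "(\<Sum>\<^sub>\<infinity>p::int. exp (pi * \<i> * of_int b * (2 * of_int p + of_int a) / 2) * exp (- pi * \<i> * (of_int p + w)^2 / \<tau>))
      = exp (pi * \<i> * of_int a / 2) * exp (- pi * \<i> * w + pi * \<i> * \<tau> / 4) * (\<Sum>\<^sub>\<infinity>p::int. exp (- pi * \<i> * (of_int p + (w - \<tau> / 2))^2 / \<tau>))"
      by (simp only: infsum_cmult_right')
    then show ?thesis unfolding L R jacobi_transformation[OF \<tau>] by (simp add: b)
  qed
qed

lemma summable_on_resid_gaussian:
  assumes "Im s > 0"
  shows "(\<lambda>n::int. norm (exp (pi * \<i> / 4 * (s * (of_int n)^2 + 2 * of_int n * u)))) summable_on UNIV"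
  unfolding norm_exp_eq_Re
proof (rule summable_on_int_gaussian_bound)
  fix n :: int
  have "pi * \<i> / 4 * (s * (of_int n)^2 + 2 * of_int n * u) = pi * \<i> * (s / 4 * (of_int n)^2 + 2 * of_int n * (u / 4))"
    by (simp add: algebra_simps)
  then show "Re (pi * \<i> / 4 * (s * (of_int n)^2 + 2 * of_int n * u)) \<le> - (pi * Im (s / 4)) * (of_int n)^2 + (2 * pi * \<bar>Im (u / 4)\<bar>) * \<bar>of_int n\<bar>"
    using Re_jtheta_exponent[of "s / 4" n "u / 4"] by (simp only:)
qed (use assms in auto)

text \<open>The sum over pairs (a, b) is symmetric under the exchange of a and b; in this
  description that symmetry expresses the self-duality of the lattice. The eighth power removes the
  root of unity and turns the square root into \<tau>^4.\<close>

theorem E8_theta_transformation: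
  fixes u :: "8 \<Rightarrow> complex"
  assumes \<tau>: "Im \<tau> > 0"
  shows "(\<Sum>\<^sub>\<infinity>x\<in>E8. exp (- (pi * \<i> / 4) * (\<Sum>k\<in>UNIV. (of_int (x k) + u k)^2) / \<tau>)) =
     \<tau>^4 * (\<Sum>\<^sub>\<infinity>x\<in>E8. exp (pi * \<i> / 4 * (\<tau> * (\<Sum>k\<in>UNIV. (of_int (x k))^2) + 2 * (\<Sum>k\<in>UNIV. of_int (x k) * u k))))"
proof -
  define f where "f k n = exp (- (pi * \<i> / 4) * (of_int n + u k)^2 / \<tau>)" for k and n :: int
  define g where "g k n = exp (pi * \<i> / 4 * (\<tau> * (of_int n)^2 + 2 * of_int n * u k))" for k and n :: int
  have nz: "\<tau> \<noteq> 0" using \<tau> by auto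
  have smg: "(\<lambda>n. norm (g k n)) summable_on UNIV" for k
    unfolding g_def by (rule summable_on_resid_gaussian[OF \<tau>])
  have smf: "(\<lambda>n. norm (f k n)) summable_on UNIV" for k
  proof -
    have inv: "Im (-1/\<tau>) > 0"
      using \<tau> by (simp add: Im_divide' divide_neg_pos sum_power2_gt_zero_iff) (auto simp: complex_eq_iff)
    have "f k n = exp (- (pi * \<i> / 4) * (u k)^2 / \<tau>) * exp (pi * \<i> / 4 * ((-1/\<tau>) * (of_int n)^2 + 2 * of_int n * (- u k / \<tau>)))" for n
      unfolding f_def exp_add[symmetric] using nz by (intro arg_cong[where f = exp]) (simp add: power2_eq_square field_simps)
    then show ?thesis
      using summable_on_cmult_right[OF summable_on_resid_gaussian[OF inv, of "- u k / \<tau>"], of "norm (exp (- (pi * \<i> / 4) * (u k)^2 / \<tau>))"]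
      by (simp only: norm_mult)
  qed
  \<comment> \<open>The eighth power of the root is (-i \<tau>)^4, and (-i)^4 = 1: rank 8 leaves
    neither a sign nor a choice of branch.\<close>
  have c8: "csqrt (- \<i> * \<tau>) ^ 8 = \<tau>^4"
  proof -
    have "z ^ 8 = (z^2)^4" for z :: complex by (simp flip: power_mult)
    then have "csqrt (- \<i> * \<tau>) ^ 8 = (- \<i> * \<tau>)^4" by (simp only: power2_csqrt)
    also have "\<dots> = \<tau>^4" by (simp add: power_mult_distrib)
    finally show ?thesis .
  qed
  have e8: "exp (pi * \<i> * of_int j / 2) ^ 8 = 1" for j :: int
  proof -
    have "exp (pi * \<i> * of_int j / 2) ^ 8 = exp (2 * of_int (2 * j) * pi * \<i>)"
      by (simp add: mult_ac flip: exp_of_nat_mult)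
    also have "\<dots> = 1" by (rule exp_integer_2pi) simp
    finally show ?thesis .
  qed
  define A where "A a b k = (\<Sum>\<^sub>\<infinity>n\<in>resid a. exp (pi * \<i> * of_int b * of_int n / 2) * g k n)" for a b :: int and k
  have "(\<Prod>k\<in>UNIV. \<Sum>\<^sub>\<infinity>n\<in>resid a. exp (pi * \<i> * of_int b * of_int n / 2) * f k n) = \<tau>^4 * (\<Prod>k\<in>UNIV. A b a k)"
    if "a \<in> {0,1}" "b \<in> {0,1}" for a b :: int
  proof -
    have "(\<Prod>k\<in>UNIV. \<Sum>\<^sub>\<infinity>n\<in>resid a. exp (pi * \<i> * of_int b * of_int n / 2) * f k n)
       = (\<Prod>k\<in>(UNIV::8 set). exp (pi * \<i> * of_int (a * b) / 2) * csqrt (- \<i> * \<tau>) * A b a k)"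
      unfolding A_def f_def g_def by (rule prod.cong[OF refl]) (rule jacobi_transformation_characteristics[OF \<tau> that])
    also have "\<dots> = exp (pi * \<i> * of_int (a * b) / 2) ^ 8 * csqrt (- \<i> * \<tau>) ^ 8 * (\<Prod>k\<in>UNIV. A b a k)"
    proof -
      have "card (UNIV :: 8 set) = 8" by simp
      then show ?thesis by (simp only: prod.distrib prod_constant)
    qed
    finally show ?thesis by (simp only: c8 e8 mult_1)
  qed
  then have "(\<Sum>\<^sub>\<infinity>x\<in>E8. \<Prod>k\<in>UNIV. f k (x k)) = \<tau>^4 * (\<Sum>\<^sub>\<infinity>x\<in>E8. \<Prod>k\<in>UNIV. g k (x k))"
    unfolding infsum_E8_prod[OF smf] infsum_E8_prod[OF smg] A_def by (simp add: algebra_simps add_divide_distrib)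
  moreover have "(\<Prod>k\<in>UNIV. f k (x k)) = exp (- (pi * \<i> / 4) * (\<Sum>k\<in>UNIV. (of_int (x k) + u k)^2) / \<tau>)" for x
    by (simp add: f_def sum_distrib_left sum_divide_distrib flip: exp_sum sum_negf)
  moreover have "(\<Prod>k\<in>UNIV. g k (x k)) = exp (pi * \<i> / 4 * (\<tau> * (\<Sum>k\<in>UNIV. (of_int (x k))^2) + 2 * (\<Sum>k\<in>UNIV. of_int (x k) * u k)))" for x
    by (simp add: g_def sum_distrib_left sum.distrib mult.assoc ring_distribs flip: exp_sum)
  ultimately show ?thesis by (simp only:)
qed

section \<open>The action of the integral symplectic group\<close>

declare transpose_matrix_vector [simp del]

lemma matrix_add_rdistrib: "(A + B) ** C = A ** C + B ** (C :: 'a::semiring_1 ^ 'p ^ 'n)"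
  by (simp add: matrix_matrix_mult_def vec_eq_iff distrib_right sum.distrib)

lemma matrix_inv:
  assumes "invertible A"
  shows "A ** matrix_inv A = mat 1" "matrix_inv A ** A = mat 1"
  using someI_ex[OF assms[unfolded invertible_def]] by (auto simp: matrix_inv_def)

lemma rowdot_matrix: "rowdot (M *v x) y = rowdot x (transpose M *v y)"
proof -
  have "rowdot (M *v x) y = (\<Sum>i\<in>UNIV. \<Sum>j\<in>UNIV. M $ i $ j * x $ j * y $ i)"
    by (simp add: rowdot_def matrix_vector_mult_def sum_distrib_right)
  also have "\<dots> = (\<Sum>j\<in>UNIV. \<Sum>i\<in>UNIV. M $ i $ j * x $ j * y $ i)" by (rule sum.swap)
  finally show ?thesis
    by (simp add: rowdot_def matrix_vector_mult_def transpose_def sum_distrib_left mult_ac)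
qed

lemma rowdot_add: "rowdot (x + y) z = rowdot x z + rowdot y z" "rowdot z (x + y) = rowdot z x + rowdot z y"
  and rowdot_diff: "rowdot (x - y) z = rowdot x z - rowdot y z" "rowdot z (x - y) = rowdot z x - rowdot z y"
  and rowdot_0: "rowdot 0 z = 0" "rowdot z 0 = 0"
  by (simp_all add: rowdot_def sum.distrib sum_subtractf algebra_simps)

lemma rowdot_commute: "rowdot x y = rowdot y x"
  by (simp add: rowdot_def mult.commute)

lemma rowdot_eqI: "(\<And>x. rowdot x y = rowdot x z) \<Longrightarrow> y = z"
proof -
  assume h: "\<And>x. rowdot x y = rowdot x z"
  have "y $ i = z $ i" for i
    using h[of "axis i 1"] by (simp add: rowdot_def axis_def if_distrib if_distribR cong: if_cong)
  then show "y = z" by (simp add: vec_eq_iff)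
qed

section \<open>The symplectic form and its invariance\<close>

lemma sum_UNIV_Plus:
  fixes f :: "('a::finite + 'b::finite) \<Rightarrow> 'c::comm_monoid_add"
  shows "(\<Sum>k\<in>UNIV. f k) = (\<Sum>a\<in>UNIV. f (Inl a)) + (\<Sum>b\<in>UNIV. f (Inr b))"
proof -
  have "(UNIV :: ('a + 'b) set) = range Inl \<union> range Inr" by (rule UNIV_sum)
  then have "(\<Sum>k\<in>UNIV. f k) = sum f (range Inl) + sum f (range Inr)"
    using sum.union_disjoint[of "range Inl :: ('a + 'b) set" "range Inr" f] by fastforce
  then show ?thesis by (simp add: sum.reindex)
qed

lemma Jmat_nth [simp]:
  "Jmat $ Inl a $ Inl b = 0" "Jmat $ Inr a $ Inr b = 0"
  "Jmat $ Inl a $ Inr b = (if a = b then 1 else 0)" "Jmat $ Inr a $ Inl b = (if a = b then -1 else 0)"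
  by (simp_all add: Jmat_def)

definition sympl :: "int ^ ('g::finite + 'g) \<Rightarrow> int ^ ('g + 'g) \<Rightarrow> int" where
  "sympl x y = (\<Sum>a\<in>UNIV. x $ Inl a * y $ Inr a - x $ Inr a * y $ Inl a)"

lemma transpose_Jmat_mult_nth:
  "(transpose M ** Jmat ** M) $ i $ j = sympl (column i M) (column j M)"
proof -
  have "(transpose M ** Jmat ** M) $ i $ j = (\<Sum>l\<in>UNIV. M $ l $ i * (Jmat ** M) $ l $ j)"
  proof -
    have "(transpose M ** X) $ i $ j = (\<Sum>l\<in>UNIV. M $ l $ i * X $ l $ j)" for X
      by (simp add: matrix_matrix_mult_def transpose_def)
    then show ?thesis by (simp only: matrix_mul_assoc[symmetric])
  qed
  moreover have "(Jmat ** M) $ Inl a $ j = M $ Inr a $ j" for a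
    by (simp add: matrix_matrix_mult_def sum_UNIV_Plus if_distrib if_distribR cong: if_cong)
  moreover have "(Jmat ** M) $ Inr a $ j = - M $ Inl a $ j" for a
    by (simp add: matrix_matrix_mult_def sum_UNIV_Plus if_distrib if_distribR cong: if_cong)
  ultimately show ?thesis
    by (simp add: sum_UNIV_Plus sympl_def column_def sum_subtractf sum_negf)
qed

text \<open>Membership is read as a condition on columns: they form a symplectic basis. Left
  multiplication acts on each column separately, which is what the reduction to generators
  exploits.\<close>

lemma Sp_Z_iff: "M \<in> Sp_Z \<longleftrightarrow> (\<forall>i j. sympl (column i M) (column j M) = Jmat $ i $ j)"
  by (simp add: Sp_Z_def vec_eq_iff transpose_Jmat_mult_nth)

lemma Sp_Z_mult: "M \<in> Sp_Z \<Longrightarrow> N \<in> Sp_Z \<Longrightarrow> M ** N \<in> Sp_Z"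
  by (simp add: Sp_Z_def matrix_transpose_mul) (metis matrix_mul_assoc)

lemma blk_mult:
  "blkA (M ** N) = blkA M ** blkA N + blkB M ** blkC N"
  "blkB (M ** N) = blkA M ** blkB N + blkB M ** blkD N"
  "blkC (M ** N) = blkC M ** blkA N + blkD M ** blkC N"
  "blkD (M ** N) = blkC M ** blkB N + blkD M ** blkD N"
  by (simp_all add: vec_eq_iff blkA_def blkB_def blkC_def blkD_def matrix_matrix_mult_def sum_UNIV_Plus)

lemma blk_relations:
  assumes "M \<in> Sp_Z"
  shows "transpose (blkA M) ** blkC M = transpose (blkC M) ** blkA M"
    and "transpose (blkB M) ** blkD M = transpose (blkD M) ** blkB M"
    and "transpose (blkA M) ** blkD M = mat 1 + transpose (blkC M) ** blkB M"
    and "transpose (blkD M) ** blkA M = mat 1 + transpose (blkB M) ** blkC M"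
proof -
  have r: "sympl (column i M) (column j M) = Jmat $ i $ j" for i j
    using assms by (simp add: Sp_Z_iff)
  have c: "of_int (sympl (column i M) (column j M)) =
     (\<Sum>a\<in>UNIV. of_int (M $ Inl a $ i) * of_int (M $ Inr a $ j) :: complex) - (\<Sum>a\<in>UNIV. of_int (M $ Inr a $ i) * of_int (M $ Inl a $ j))" for i j
    by (simp add: sympl_def column_def sum_subtractf)
  note [simp] = vec_eq_iff blkA_def blkB_def blkC_def blkD_def matrix_matrix_mult_def transpose_def mat_def
  show "transpose (blkA M) ** blkC M = transpose (blkC M) ** blkA M"
    using c[unfolded r, of "Inl _" "Inl _"] by simp
  show "transpose (blkB M) ** blkD M = transpose (blkD M) ** blkB M"
    using c[unfolded r, of "Inr _" "Inr _"] by simp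
  have e: "(\<Sum>a\<in>UNIV. of_int (M $ Inl a $ Inl i) * of_int (M $ Inr a $ Inr j) :: complex) = (if i = j then 1 else 0) + (\<Sum>a\<in>UNIV. of_int (M $ Inr a $ Inl i) * of_int (M $ Inl a $ Inr j))" for i j
    using c[unfolded r, of "Inl i" "Inr j"] by (simp add: algebra_simps split: if_splits)
  show "transpose (blkA M) ** blkD M = mat 1 + transpose (blkC M) ** blkB M"
    using e by simp
  show "transpose (blkD M) ** blkA M = mat 1 + transpose (blkB M) ** blkC M"
    using e by (simp add: mult.commute eq_commute[of "_ :: 'a"])
qed

text \<open>Invariance of the symplectic form on complex vectors, in block form. Symmetry and
  positivity of the transformed point, invertibility of C Z + D and the cocycle of the exponential
  factor are all specialisations of it.\<close>

lemma Sp_Z_symplectic_form: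
  assumes M: "M \<in> Sp_Z"
  shows "rowdot (blkC M *v p' + blkD M *v q') (blkA M *v p + blkB M *v q)
       - rowdot (blkA M *v p' + blkB M *v q') (blkC M *v p + blkD M *v q)
       = rowdot q' p - rowdot p' q"
  using blk_relations[OF M]
  by (simp add: rowdot_add rowdot_matrix matrix_vector_mul_assoc matrix_vector_mult_add_rdistrib)

lemma siegel_H_sym: "Z \<in> siegel_H \<Longrightarrow> transpose Z = Z"
  by (simp add: siegel_H_def)

text \<open>With u = a + i b the mixed terms cancel by symmetry of Z, which leaves the values of the
  form Im Z at the real vectors a and b.\<close>

lemma siegel_H_hermitian_pos:
  assumes Z: "Z \<in> siegel_H" and u: "u \<noteq> 0"
  shows "Im (rowdot (\<chi> i. cnj (u $ i)) (Z *v u)) > 0"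
proof -
  let ?q = "\<lambda>x::real^'a. \<Sum>i\<in>UNIV. \<Sum>j\<in>UNIV. x $ i * Im (Z $ i $ j) * x $ j"
  have pos: "x \<noteq> 0 \<Longrightarrow> ?q x > 0" for x using Z by (auto simp: siegel_H_def)
  then have nonneg: "?q x \<ge> 0" for x by (cases "x = 0") (auto intro: less_imp_le)
  have sym: "Z $ i $ j = Z $ j $ i" for i j
    using siegel_H_sym[OF Z] by (simp add: vec_eq_iff transpose_def)
  define a where "a = (\<chi> i. Re (u $ i))"
  define b where "b = (\<chi> i. Im (u $ i))"
  have "Im (rowdot (\<chi> i. cnj (u $ i)) (Z *v u)) = (\<Sum>i\<in>UNIV. \<Sum>j\<in>UNIV. Im (cnj (u $ i) * (Z $ i $ j * u $ j)))"
    by (simp only: rowdot_def matrix_vector_mult_def vec_lambda_beta sum_distrib_left Im_sum)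
  also have "\<dots> = (\<Sum>i\<in>UNIV. \<Sum>j\<in>UNIV. (a $ i * Im (Z $ i $ j) * a $ j + b $ i * Im (Z $ i $ j) * b $ j) + (a $ i * Re (Z $ i $ j) * b $ j - b $ i * Re (Z $ i $ j) * a $ j))"
    by (intro sum.cong refl) (simp add: a_def b_def algebra_simps)
  also have "\<dots> = ?q a + ?q b + ((\<Sum>i\<in>UNIV. \<Sum>j\<in>UNIV. a $ i * Re (Z $ i $ j) * b $ j) - (\<Sum>i\<in>UNIV. \<Sum>j\<in>UNIV. b $ i * Re (Z $ i $ j) * a $ j))"
    by (simp add: sum.distrib sum_subtractf)
  also have "(\<Sum>i\<in>UNIV. \<Sum>j\<in>UNIV. b $ i * Re (Z $ i $ j) * a $ j) = (\<Sum>i\<in>UNIV. \<Sum>j\<in>UNIV. a $ i * Re (Z $ i $ j) * b $ j)"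
    by (subst sum.swap) (intro sum.cong refl, simp add: sym mult_ac)
  finally have eq: "Im (rowdot (\<chi> i. cnj (u $ i)) (Z *v u)) = ?q a + ?q b" by simp
  have "a \<noteq> 0 \<or> b \<noteq> 0" using u by (auto simp: a_def b_def vec_eq_iff complex_eq_iff)
  then show ?thesis unfolding eq using pos[of a] pos[of b] nonneg[of a] nonneg[of b] by linarith
qed

lemma cnj_blk_mult:
  "(\<chi> i. cnj ((blkA M *v p + blkB M *v q) $ i)) = blkA M *v (\<chi> i. cnj (p $ i)) + blkB M *v (\<chi> i. cnj (q $ i))"
  "(\<chi> i. cnj ((blkC M *v p + blkD M *v q) $ i)) = blkC M *v (\<chi> i. cnj (p $ i)) + blkD M *v (\<chi> i. cnj (q $ i))"
  by (simp_all add: vec_eq_iff matrix_vector_mult_def blkA_def blkB_def blkC_def blkD_def)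

section \<open>The action on the half space and its factor of automorphy\<close>

definition autf :: "int ^ ('g::finite + 'g) ^ ('g + 'g) \<Rightarrow> complex ^ 'g ^ 'g \<Rightarrow> complex ^ 'g ^ 'g" where
  "autf M Z = blkC M ** Z + blkD M"

definition numf :: "int ^ ('g::finite + 'g) ^ ('g + 'g) \<Rightarrow> complex ^ 'g ^ 'g \<Rightarrow> complex ^ 'g ^ 'g" where
  "numf M Z = blkA M ** Z + blkB M"

definition mact :: "int ^ ('g::finite + 'g) ^ ('g + 'g) \<Rightarrow> complex ^ 'g ^ 'g \<Rightarrow> complex ^ 'g ^ 'g" where
  "mact M Z = numf M Z ** matrix_inv (autf M Z)"

lemma autf_mult_vec: "autf M Z *v u = blkC M *v (Z *v u) + blkD M *v u"
  and numf_mult_vec: "numf M Z *v u = blkA M *v (Z *v u) + blkB M *v u"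
  by (simp_all add: autf_def numf_def matrix_vector_mult_add_rdistrib matrix_vector_mul_assoc)

text \<open>\<open>M\<close> sends the pair (Z u, u) to (\<open>numf M Z *v u\<close>,
  \<open>autf M Z *v u\<close>). Being real it commutes with conjugation, so the symplectic form of
  a vector with its conjugate is preserved.\<close>

lemma Im_rowdot_autf_numf:
  assumes M: "M \<in> Sp_Z" and Z: "Z \<in> siegel_H"
  shows "Im (rowdot (\<chi> i. cnj ((autf M Z *v u) $ i)) (numf M Z *v u)) = Im (rowdot (\<chi> i. cnj (u $ i)) (Z *v u))"
proof -
  let ?c = "\<lambda>v::complex^'a. \<chi> i. cnj (v $ i)"
  have cr: "rowdot (?c x) y = cnj (rowdot (?c y) x)" for x y
    by (simp add: rowdot_def mult.commute)
  have "rowdot (?c (autf M Z *v u)) (numf M Z *v u) - rowdot (?c (numf M Z *v u)) (autf M Z *v u)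
      = rowdot (?c u) (Z *v u) - rowdot (?c (Z *v u)) u"
    unfolding autf_mult_vec numf_mult_vec cnj_blk_mult by (rule Sp_Z_symplectic_form[OF M])
  then have "Im (rowdot (?c (autf M Z *v u)) (numf M Z *v u) - rowdot (?c (numf M Z *v u)) (autf M Z *v u)) = 
     Im (rowdot (?c u) (Z *v u) - rowdot (?c (Z *v u)) u)" by simp
  moreover have "Im (rowdot (?c (numf M Z *v u)) (autf M Z *v u)) = - Im (rowdot (?c (autf M Z *v u)) (numf M Z *v u))"
    by (subst cr) simp
  moreover have "Im (rowdot (?c (Z *v u)) u) = - Im (rowdot (?c u) (Z *v u))"
    by (subst cr) simp
  ultimately show ?thesis by simp
qed

text \<open>On a kernel vector the preserved hermitian value would be both zero and
  positive.\<close>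

lemma invertible_autf:
  assumes M: "M \<in> Sp_Z" and Z: "Z \<in> siegel_H"
  shows "invertible (autf M Z)"
proof -
  have "u = 0" if "autf M Z *v u = 0" for u
  proof (rule ccontr)
    assume "u \<noteq> 0"
    from siegel_H_hermitian_pos[OF Z this] Im_rowdot_autf_numf[OF M Z, of u] that
    show False by (simp add: rowdot_def)
  qed
  then show ?thesis
    unfolding invertible_left_inverse matrix_left_invertible_ker by blast
qed

lemma matrix_inv_mult_vec:
  assumes "invertible Y"
  shows "Y *v (matrix_inv Y *v x) = x" "matrix_inv Y *v (Y *v x) = x"
  using assms by (simp_all add: matrix_vector_mul_assoc matrix_inv)

lemma mact_autf: "invertible (autf M Z) \<Longrightarrow> mact M Z ** autf M Z = numf M Z"
  by (simp add: mact_def matrix_mul_assoc[symmetric] matrix_inv)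

text \<open>Every x has the form (C Z + D) u. In terms of u, symmetry is the bilinear and positivity
  the hermitian version of symplectic invariance.\<close>

lemma mact_siegel_H:
  assumes M: "M \<in> Sp_Z" and Z: "Z \<in> siegel_H"
  shows "mact M Z \<in> siegel_H"
proof -
  note inv = invertible_autf[OF M Z]
  let ?N = "matrix_inv (autf M Z)"
  have mv: "mact M Z *v x = numf M Z *v (?N *v x)" for x
    by (simp add: mact_def matrix_vector_mul_assoc)
  have sym: "rowdot x (mact M Z *v y) = rowdot y (mact M Z *v x)" for x y
  proof -
    define u v where "u = ?N *v x" and "v = ?N *v y"
    have xy: "x = autf M Z *v u" "y = autf M Z *v v" by (simp_all add: u_def v_def matrix_inv_mult_vec[OF inv])
    have "rowdot (autf M Z *v u) (numf M Z *v v) - rowdot (numf M Z *v u) (autf M Z *v v) = rowdot u (Z *v v) - rowdot (Z *v u) v"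
      unfolding autf_mult_vec numf_mult_vec by (rule Sp_Z_symplectic_form[OF M])
    also have "rowdot (Z *v u) v = rowdot u (Z *v v)" by (simp add: rowdot_matrix siegel_H_sym[OF Z])
    finally show ?thesis unfolding mv u_def[symmetric] v_def[symmetric] unfolding xy by (simp add: rowdot_commute)
  qed
  have tr: "transpose (mact M Z) = mact M Z"
  proof -
    have "transpose (mact M Z) *v y = mact M Z *v y" for y
      by (rule rowdot_eqI) (metis rowdot_matrix rowdot_commute sym)
    then show ?thesis by (simp add: matrix_eq)
  qed
  show ?thesis
    unfolding siegel_H_def
  proof (safe intro!: tr)
    fix x :: "real ^ 'a" assume x: "x \<noteq> 0"
    define X where "X = (\<chi> i. complex_of_real (x $ i))"
    define u where "u = ?N *v X"
    have Xu: "X = autf M Z *v u" by (simp add: u_def matrix_inv_mult_vec[OF inv])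
    have "X \<noteq> 0" using x by (auto simp: X_def vec_eq_iff)
    then have u0: "u \<noteq> 0" using Xu by auto
    have cX: "(\<chi> i. cnj (X $ i)) = X" by (simp add: X_def vec_eq_iff)
    have "Im (rowdot X (mact M Z *v X)) = Im (rowdot (\<chi> i. cnj (X $ i)) (numf M Z *v u))"
      by (simp add: cX mv u_def)
    also have "\<dots> > 0"
      using Im_rowdot_autf_numf[OF M Z, of u] siegel_H_hermitian_pos[OF Z u0] by (simp add: Xu)
    also have "Im (rowdot X (mact M Z *v X)) = (\<Sum>i\<in>UNIV. \<Sum>j\<in>UNIV. Im (X $ i * (mact M Z $ i $ j * X $ j)))"
      by (simp only: rowdot_def matrix_vector_mult_def vec_lambda_beta sum_distrib_left Im_sum)
    also have "\<dots> = (\<Sum>i\<in>UNIV. \<Sum>j\<in>UNIV. x $ i * Im (mact M Z $ i $ j) * x $ j)"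
      by (intro sum.cong refl) (simp add: X_def mult_ac)
    finally show "0 < (\<Sum>i\<in>UNIV. \<Sum>j\<in>UNIV. x $ i * Im (mact M Z $ i $ j) * x $ j)" .
  qed
qed

lemma autf_mult:
  assumes "invertible (autf N Z)"
  shows "autf (M ** N) Z = autf M (mact N Z) ** autf N Z"
    and "numf (M ** N) Z = numf M (mact N Z) ** autf N Z"
proof -
  have "(blkC M ** mact N Z + blkD M) ** autf N Z = blkC M ** numf N Z + blkD M ** autf N Z"
    by (simp add: matrix_add_rdistrib matrix_mul_assoc[symmetric] mact_autf[OF assms])
  then show "autf (M ** N) Z = autf M (mact N Z) ** autf N Z"
    by (simp add: autf_def numf_def blk_mult matrix_add_rdistrib matrix_add_ldistrib matrix_mul_assoc algebra_simps)
  have "(blkA M ** mact N Z + blkB M) ** autf N Z = blkA M ** numf N Z + blkB M ** autf N Z"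
    by (simp add: matrix_add_rdistrib matrix_mul_assoc[symmetric] mact_autf[OF assms])
  then show "numf (M ** N) Z = numf M (mact N Z) ** autf N Z"
    by (simp add: autf_def numf_def blk_mult matrix_add_rdistrib matrix_add_ldistrib matrix_mul_assoc algebra_simps)
qed

lemma matrix_inv_unique: "A ** B = mat 1 \<Longrightarrow> B ** A = mat 1 \<Longrightarrow> matrix_inv A = B"
  by (metis invertible_def matrix_inv(2) matrix_mul_assoc matrix_mul_lid matrix_mul_rid)

lemma matrix_inv_mult:
  assumes "invertible A" "invertible B"
  shows "matrix_inv (A ** B) = matrix_inv B ** matrix_inv A"
proof (rule matrix_inv_unique)
  have "A ** B ** (matrix_inv B ** matrix_inv A) = A ** (B ** matrix_inv B) ** matrix_inv A"
    by (simp add: matrix_mul_assoc)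
  then show "A ** B ** (matrix_inv B ** matrix_inv A) = mat 1" by (simp add: matrix_inv assms)
  have "matrix_inv B ** matrix_inv A ** (A ** B) = matrix_inv B ** (matrix_inv A ** A) ** B"
    by (simp add: matrix_mul_assoc)
  then show "matrix_inv B ** matrix_inv A ** (A ** B) = mat 1" by (simp add: matrix_inv assms)
qed

lemma slash_altdef:
  "slash k m M \<phi> Z W = det (autf M Z) powi (- k)
     * exp (- 2 * of_real pi * \<i> * of_nat m * rowdot (W v* matrix_inv (autf M Z)) (blkC M *v W))
     * \<phi> (mact M Z) (W v* matrix_inv (autf M Z))"
  by (simp add: slash_def autf_def mact_def numf_def Let_def)

text \<open>The determinant and the action follow the usual cocycle rule; the substance lies in the
  exponents, where the terms of \<open>M\<close> and \<open>N\<close> have to add up.\<close>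

theorem slash_mult:
  assumes M: "M \<in> Sp_Z" and N: "N \<in> Sp_Z" and Z: "Z \<in> siegel_H"
  shows "slash k m (M ** N) \<phi> Z W = slash k m N (slash k m M \<phi>) Z W"
proof -
  note iN = invertible_autf[OF N Z]
  note iM = invertible_autf[OF M mact_siegel_H[OF N Z]]
  let ?Z = "mact N Z"
  let ?N2 = "matrix_inv (autf N Z)" and ?N1 = "matrix_inv (autf M ?Z)"
  have inv: "matrix_inv (autf (M ** N) Z) = ?N2 ** ?N1"
    by (simp add: autf_mult(1)[OF iN] matrix_inv_mult iN iM)
  have act: "mact (M ** N) Z = mact M ?Z"
  proof -
    have "mact (M ** N) Z = numf M ?Z ** (autf N Z ** ?N2) ** ?N1"
      unfolding mact_def[of "M ** N"] inv autf_mult(2)[OF iN] by (simp add: matrix_mul_assoc)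
    then show ?thesis by (simp add: matrix_inv iN mact_def[of M])
  qed
  define w where "w = W v* ?N2"
  define v where "v = w v* ?N1"
  have Wv: "W v* matrix_inv (autf (M ** N) Z) = v"
    by (simp add: inv v_def w_def vector_matrix_mul_assoc)
  have wv: "w = transpose (autf M ?Z) *v v"
    by (simp add: v_def transpose_matrix_vector vector_matrix_mul_assoc matrix_inv iM)
  \<comment> \<open>The transpose of (C Z + D)^{-1} equals A - Z' C with Z' the image of Z; this is
    the symplectic relation with one of the four vectors equal to 0. It expresses \<open>w\<close>
    without inverse matrices.\<close>
  have key: "blkA N *v W - ?Z *v (blkC N *v W) = w"
  proof (rule rowdot_eqI)
    fix x
    define u where "u = ?N2 *v x"
    have x: "x = autf N Z *v u" by (simp add: u_def matrix_inv_mult_vec[OF iN])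
    have "rowdot x (blkA N *v W - ?Z *v (blkC N *v W)) = rowdot x (blkA N *v W) - rowdot (?Z *v x) (blkC N *v W)"
      by (simp add: rowdot_diff rowdot_matrix siegel_H_sym[OF mact_siegel_H[OF N Z]])
    also have "?Z *v x = numf N Z *v u" by (simp add: mact_def u_def matrix_vector_mul_assoc)
    also have "rowdot x (blkA N *v W) - rowdot (numf N Z *v u) (blkC N *v W) = rowdot u W"
      using Sp_Z_symplectic_form[OF N, of "Z *v u" u W 0]
      unfolding x autf_mult_vec numf_mult_vec by (simp add: rowdot_0)
    also have "\<dots> = rowdot x w" by (simp add: u_def w_def rowdot_matrix transpose_matrix_vector)
    finally show "rowdot x (blkA N *v W - ?Z *v (blkC N *v W)) = rowdot x w" .
  qed
  have ex: "rowdot v (blkC (M ** N) *v W) = rowdot w (blkC N *v W) + rowdot v (blkC M *v w)"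
  proof -
    have "rowdot w (blkC N *v W) = rowdot v (autf M ?Z *v (blkC N *v W))"
      unfolding wv by (simp add: rowdot_matrix)
    also have "\<dots> = rowdot v (blkC M *v (?Z *v (blkC N *v W))) + rowdot v (blkD M *v (blkC N *v W))"
      by (simp add: autf_mult_vec rowdot_add)
    moreover have "rowdot v (blkC M *v w) = rowdot v (blkC M *v (blkA N *v W)) - rowdot v (blkC M *v (?Z *v (blkC N *v W)))"
      unfolding key[symmetric] by (simp add: matrix_vector_mult_diff_distrib rowdot_diff)
    moreover have "rowdot v (blkC (M ** N) *v W) = rowdot v (blkC M *v (blkA N *v W)) + rowdot v (blkD M *v (blkC N *v W))"
      by (simp add: blk_mult matrix_vector_mult_add_rdistrib rowdot_add matrix_vector_mul_assoc)
    ultimately show ?thesis by simp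
  qed
  have dt: "det (autf (M ** N) Z) powi (- k) = det (autf M ?Z) powi (- k) * det (autf N Z) powi (- k)"
    by (simp add: autf_mult(1)[OF iN] det_mul power_int_mult_distrib)
  have e: "exp (- 2 * of_real pi * \<i> * of_nat m * rowdot v (blkC (M ** N) *v W)) =
     exp (- 2 * of_real pi * \<i> * of_nat m * rowdot w (blkC N *v W)) * exp (- 2 * of_real pi * \<i> * of_nat m * rowdot v (blkC M *v w))"
    unfolding ex by (simp add: ring_distribs flip: exp_add)
  show ?thesis
    unfolding slash_altdef[of _ _ "M ** N"] slash_altdef[of _ _ N] slash_altdef[of _ _ M] Wv act dt e
    unfolding w_def[symmetric] v_def[symmetric] by (simp add: mult_ac)
qed

section \<open>Generators of the integral symplectic group\<close>

definition tmat :: "int ^ 'g ^ 'g \<Rightarrow> int ^ ('g::finite + 'g) ^ ('g + 'g)" where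
  "tmat S = (\<chi> k l. case (k, l) of
      (Inl a, Inr b) \<Rightarrow> S $ a $ b
    | _ \<Rightarrow> if k = l then 1 else 0)"

text \<open>The matrix (0 1; -1 0) placed in the i-th coordinate pair; on the half space it inverts
  in the single entry Z_ii.\<close>

definition jmat :: "'g \<Rightarrow> int ^ ('g::finite + 'g) ^ ('g + 'g)" where
  "jmat i = (\<chi> k l. if k = Inl i then (if l = Inr i then 1 else 0)
      else if k = Inr i then (if l = Inl i then -1 else 0)
      else if k = l then 1 else 0)"

lemma tmat_mult_vec [simp]:
  "(tmat S *v u) $ Inl a = u $ Inl a + (\<Sum>b\<in>UNIV. S $ a $ b * u $ Inr b)"
  "(tmat S *v u) $ Inr a = u $ Inr a"
  by (simp_all add: matrix_vector_mult_def tmat_def sum_UNIV_Plus if_distrib if_distribR cong: if_cong)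

lemma jmat_mult_vec_nth:
  "(jmat i *v u) $ k = (if k = Inl i then u $ Inr i else if k = Inr i then - u $ Inl i else u $ k)"
proof -
  have d: "(\<Sum>l\<in>UNIV. (if l = m then c else 0) * u $ l) = c * u $ m"
    "(\<Sum>l\<in>UNIV. (if m = l then c else 0) * u $ l) = c * u $ m" for m c
    by (simp_all add: mult_delta_left)
  show ?thesis
    by (cases "k = Inl i"; cases "k = Inr i") (simp_all add: matrix_vector_mult_def jmat_def d)
qed

lemma jmat_mult_vec [simp]:
  "(jmat i *v u) $ Inl a = (if a = i then u $ Inr i else u $ Inl a)"
  "(jmat i *v u) $ Inr a = (if a = i then - u $ Inl i else u $ Inr a)"
  by (simp_all add: jmat_mult_vec_nth)

lemma vec_Plus_eq_iff: "(x :: 'a ^ ('g::finite + 'g)) = y \<longleftrightarrow> (\<forall>a. x $ Inl a = y $ Inl a) \<and> (\<forall>a. x $ Inr a = y $ Inr a)"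
proof -
  have "(\<forall>k. x $ k = y $ k) \<longleftrightarrow> (\<forall>a. x $ Inl a = y $ Inl a) \<and> (\<forall>a. x $ Inr a = y $ Inr a)"
    by (metis sum.exhaust)
  then show ?thesis by (simp add: vec_eq_iff)
qed

lemma sympl_tmat:
  assumes "transpose S = S"
  shows "sympl (tmat S *v x) (tmat S *v y) = sympl x y"
proof -
  have sym: "S $ i $ j = S $ j $ i" for i j using assms by (simp add: vec_eq_iff transpose_def)
  have "sympl (tmat S *v x) (tmat S *v y) = sympl x y +
     ((\<Sum>a\<in>UNIV. \<Sum>b\<in>UNIV. S $ a $ b * x $ Inr b * y $ Inr a) - (\<Sum>a\<in>UNIV. \<Sum>b\<in>UNIV. S $ a $ b * x $ Inr a * y $ Inr b))"
    by (simp add: sympl_def algebra_simps sum.distrib sum_subtractf sum_distrib_left sum_distrib_right)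
  also have "(\<Sum>a\<in>UNIV. \<Sum>b\<in>UNIV. S $ a $ b * x $ Inr b * y $ Inr a) = (\<Sum>a\<in>UNIV. \<Sum>b\<in>UNIV. S $ a $ b * x $ Inr a * y $ Inr b)"
    by (subst sum.swap) (simp add: sym)
  finally show ?thesis by simp
qed

lemma sympl_jmat: "sympl (jmat i *v x) (jmat i *v y) = sympl x y"
  unfolding sympl_def by (intro sum.cong refl) (simp add: algebra_simps)

text \<open>Generators that do not touch the coordinate pairs in \<open>T\<close>. The reduction
  proceeds pair by pair, and \<open>T\<close> records the pairs already brought into standard
  position.\<close>

definition gensT :: "'g set \<Rightarrow> (int ^ ('g::finite + 'g) ^ ('g + 'g)) set" where
  "gensT T = {tmat S | S. transpose S = S \<and> (\<forall>a b. a \<in> T \<or> b \<in> T \<longrightarrow> S $ a $ b = 0)} \<union> {jmat i | i. i \<notin> T}"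

lemma sympl_gensT: "g \<in> gensT T \<Longrightarrow> sympl (g *v x) (g *v y) = sympl x y"
  by (auto simp: gensT_def sympl_tmat sympl_jmat)

lemma column_mult: "column k (A ** B) = A *v column k B"
  by (simp add: column_def matrix_matrix_mult_def matrix_vector_mult_def vec_eq_iff)

lemma column_mat_1: "column k (mat 1) = axis k 1"
  by (simp add: column_def mat_def axis_def vec_eq_iff)

lemma mat_1_Sp_Z: "mat 1 \<in> Sp_Z"
  by (simp add: Sp_Z_def transpose_mat)

lemma gensT_Sp_Z:
  assumes "g \<in> gensT T"
  shows "g \<in> Sp_Z"
proof -
  have "sympl (column i g) (column j g) = Jmat $ i $ j" for i j
  proof -
    have c: "column k g = g *v column k (mat 1)" for k
      using column_mult[of k g "mat 1"] by simp
    show ?thesis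
      unfolding c[of i] c[of j] sympl_gensT[OF assms] using mat_1_Sp_Z[unfolded Sp_Z_iff] by blast
  qed
  then show ?thesis by (simp add: Sp_Z_iff)
qed

lemma gensT_fixes:
  assumes "g \<in> gensT T" "i \<in> T"
  shows "g *v axis (Inl i) 1 = axis (Inl i) 1" "g *v axis (Inr i) 1 = axis (Inr i) 1"
proof -
  have "g *v axis (Inl i) 1 = axis (Inl i) 1 \<and> g *v axis (Inr i) 1 = axis (Inr i) 1"
  proof -
    from assms(1) consider (t) S where "g = tmat S" "\<forall>a b. a \<in> T \<or> b \<in> T \<longrightarrow> S $ a $ b = 0"
      | (j) k where "g = jmat k" "k \<notin> T" unfolding gensT_def by blast
    then show ?thesis
    proof cases
      case t
      have "(\<Sum>b\<in>UNIV. S $ a $ b * axis (Inr i) 1 $ Inr b) = 0" for a :: 'a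
        using t(2) assms(2) by (intro sum.neutral) (auto simp: axis_def)
      then show ?thesis unfolding t(1) vec_Plus_eq_iff by (simp add: axis_def)
    next
      case j
      then show ?thesis using assms(2) unfolding j(1) vec_Plus_eq_iff by (auto simp: axis_def)
    qed
  qed
  then show "g *v axis (Inl i) 1 = axis (Inl i) 1" "g *v axis (Inr i) 1 = axis (Inr i) 1" by auto
qed

lemma gensT_zero:
  assumes "g \<in> gensT T" "\<forall>i\<in>T. u $ Inl i = 0 \<and> u $ Inr i = 0"
  shows "\<forall>i\<in>T. (g *v u) $ Inl i = 0 \<and> (g *v u) $ Inr i = 0"
  using assms by (auto simp: gensT_def intro!: sum.neutral)

definition l1 :: "int ^ ('g::finite + 'g) \<Rightarrow> nat" where
  "l1 u = nat (\<Sum>a\<in>UNIV. \<bar>u $ Inl a\<bar> + \<bar>u $ Inr a\<bar>)"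

lemma l1_jmat: "l1 (jmat i *v u) = l1 u"
  unfolding l1_def by (intro arg_cong[where f = nat] sum.cong refl) auto

text \<open>A translation adds or subtracts the smaller entry from the larger one, as one step of
  the Euclidean algorithm.\<close>

lemma l1_reduce:
  assumes i: "i \<notin> T" and j: "j \<notin> T" and pq: "u $ Inl i \<noteq> 0" "u $ Inr j \<noteq> 0" "\<bar>u $ Inr j\<bar> \<le> \<bar>u $ Inl i\<bar>"
    and ij: "i = j \<or> u $ Inr i = 0 \<and> u $ Inl j = 0"
  shows "\<exists>g\<in>gensT T. l1 (g *v u) < l1 u"
proof -
  \<comment> \<open>The sign makes the two entries cancel in part. Symmetry of the matrix forces a
    partner entry at (j, i); hypothesis \<open>ij\<close> makes its contribution vanish when i and j
    differ.\<close>
  define c where "c = - sgn (u $ Inl i) * sgn (u $ Inr j)"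
  define S :: "int ^ 'a ^ 'a" where "S = (\<chi> a b. if (a = i \<and> b = j) \<or> (a = j \<and> b = i) then c else 0)"
  have "transpose S = S" by (auto simp: S_def transpose_def vec_eq_iff)
  then have g: "tmat S \<in> gensT T" using i j by (auto simp: gensT_def S_def)
  have Si: "(\<Sum>b\<in>UNIV. S $ i $ b * u $ Inr b) = c * u $ Inr j"
  proof -
    have "(\<Sum>b\<in>UNIV. S $ i $ b * u $ Inr b) = (\<Sum>b\<in>UNIV. if b = j then c * u $ Inr j else 0)"
      by (rule sum.cong) (auto simp: S_def)
    then show ?thesis by simp
  qed
  have Sa: "(\<Sum>b\<in>UNIV. S $ a $ b * u $ Inr b) = 0" if "a \<noteq> i" for a
    using that ij by (intro sum.neutral) (auto simp: S_def)
  have lt: "\<bar>u $ Inl i + c * u $ Inr j\<bar> < \<bar>u $ Inl i\<bar>"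
    using pq by (auto simp: c_def sgn_if split: if_splits)
  have "(\<Sum>a\<in>UNIV. \<bar>(tmat S *v u) $ Inl a\<bar> + \<bar>(tmat S *v u) $ Inr a\<bar>) < (\<Sum>a\<in>UNIV. \<bar>u $ Inl a\<bar> + \<bar>u $ Inr a\<bar>)"
  proof (rule sum_strict_mono_ex1)
    show "\<forall>a\<in>UNIV. \<bar>(tmat S *v u) $ Inl a\<bar> + \<bar>(tmat S *v u) $ Inr a\<bar> \<le> \<bar>u $ Inl a\<bar> + \<bar>u $ Inr a\<bar>"
    proof
      fix a show "\<bar>(tmat S *v u) $ Inl a\<bar> + \<bar>(tmat S *v u) $ Inr a\<bar> \<le> \<bar>u $ Inl a\<bar> + \<bar>u $ Inr a\<bar>"
        using lt by (cases "a = i") (simp_all add: Si Sa)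
    qed
    show "\<exists>a\<in>UNIV. \<bar>(tmat S *v u) $ Inl a\<bar> + \<bar>(tmat S *v u) $ Inr a\<bar> < \<bar>u $ Inl a\<bar> + \<bar>u $ Inr a\<bar>"
      using lt by (intro bexI[of _ i]) (simp_all add: Si)
  qed simp
  moreover have "0 \<le> (\<Sum>a\<in>UNIV. \<bar>(tmat S *v u) $ Inl a\<bar> + \<bar>(tmat S *v u) $ Inr a\<bar>)"
    by (intro sum_nonneg) auto
  ultimately have "l1 (tmat S *v u) < l1 u" unfolding l1_def by linarith
  with g show ?thesis by blast
qed

lemma jmat_axis:
  "jmat i *v axis (Inl i) c = axis (Inr i) (- c)" "jmat i *v axis (Inr i) c = axis (Inl i) c"
  by (simp_all add: vec_Plus_eq_iff axis_def)

text \<open>The induction on \<open>l1\<close> is a Euclidean algorithm.\<close>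

lemma gensT_transitive:
  fixes u :: "int ^ ('g::finite + 'g)"
  assumes step: "\<And>g u. g \<in> gensT T \<Longrightarrow> Q (g *v u) \<Longrightarrow> Q u"
    and s: "s \<notin> T" and base: "Q (axis (Inl s) 1)"
    and zero: "\<forall>i\<in>T. u $ Inl i = 0 \<and> u $ Inr i = 0" and prim: "\<exists>w. sympl u w = 1"
  shows "Q u"
  using zero prim
proof (induction "l1 u" arbitrary: u rule: less_induct)
  case less
  have J: "jmat i \<in> gensT T" if "i \<notin> T" for i using that by (auto simp: gensT_def)
  note QJ = step[OF J]
  have prim': "\<exists>w. sympl (g *v v) w = 1" if "g \<in> gensT T" "\<exists>w. sympl v w = 1" for g v
    using that sympl_gensT[OF that(1)] by metis
  have red: "Q v" if i: "i \<notin> T" and j: "j \<notin> T" and pq: "v $ Inl i \<noteq> 0" "v $ Inr j \<noteq> 0" "\<bar>v $ Inr j\<bar> \<le> \<bar>v $ Inl i\<bar>"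
    and ij: "i = j \<or> v $ Inr i = 0 \<and> v $ Inl j = 0"
    and v: "l1 v = l1 u" "\<forall>i\<in>T. v $ Inl i = 0 \<and> v $ Inr i = 0" "\<exists>w. sympl v w = 1" for i j v
  proof -
    obtain g where g: "g \<in> gensT T" "l1 (g *v v) < l1 v" using l1_reduce[OF i j pq ij] by blast
    have "Q (g *v v)"
      using g v by (intro less.hyps gensT_zero prim') auto
    then show ?thesis using step[OF g(1)] by blast
  qed
  have offT: "i \<notin> T" if "u $ Inl i \<noteq> 0 \<or> u $ Inr i \<noteq> 0" for i using less.prems(1) that by auto
  show ?case
  proof (cases "\<exists>i. u $ Inl i \<noteq> 0 \<and> u $ Inr i \<noteq> 0")
    case True
    then obtain i where i: "u $ Inl i \<noteq> 0" "u $ Inr i \<noteq> 0" by blast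
    have iT: "i \<notin> T" using offT i by blast
    show ?thesis
    proof (cases "\<bar>u $ Inr i\<bar> \<le> \<bar>u $ Inl i\<bar>")
      case True
      show ?thesis by (rule red[of i i]) (use i iT True less.prems in auto)
    next
      case False
      have "Q (jmat i *v u)"
        by (rule red[of i i])
           (use i iT False less.prems in \<open>auto simp: l1_jmat intro!: gensT_zero prim' J\<close>)
      then show ?thesis by (rule QJ[OF iT])
    qed
  next
    case False
    then have one: "u $ Inl i = 0 \<or> u $ Inr i = 0" for i by blast
    \<comment> \<open>No pair has both entries nonzero. Partial inversions, which preserve
      \<open>l1\<close>, move the larger entry to an \<open>Inl\<close> place and the smaller one to
      an \<open>Inr\<close> place, where a reduction applies.\<close>
    have two: "Q u" if ij: "i \<noteq> j" "u $ Inl i \<noteq> 0 \<or> u $ Inr i \<noteq> 0" "u $ Inl j \<noteq> 0 \<or> u $ Inr j \<noteq> 0"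
        "\<bar>u $ Inl j\<bar> + \<bar>u $ Inr j\<bar> \<le> \<bar>u $ Inl i\<bar> + \<bar>u $ Inr i\<bar>" for i j
    proof -
      have T: "i \<notin> T" "j \<notin> T" using ij offT by blast+
      define v where "v = (if u $ Inl i \<noteq> 0 then u else jmat i *v u)"
      define w where "w = (if u $ Inr j \<noteq> 0 then v else jmat j *v v)"
      have v: "l1 v = l1 u" "\<forall>i\<in>T. v $ Inl i = 0 \<and> v $ Inr i = 0" "\<exists>w. sympl v w = 1"
        using less.prems gensT_zero[OF J[OF T(1)] less.prems(1)] prim'[OF J[OF T(1)] less.prems(2)]
        by (auto simp: v_def l1_jmat simp del: jmat_mult_vec)
      have Qv: "Q v \<Longrightarrow> Q u" using QJ[OF T(1)] by (auto simp: v_def split: if_splits)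
      have w: "l1 w = l1 u" "\<forall>i\<in>T. w $ Inl i = 0 \<and> w $ Inr i = 0" "\<exists>w'. sympl w w' = 1"
        using v gensT_zero[OF J[OF T(2)] v(2)] prim'[OF J[OF T(2)] v(3)]
        by (auto simp: w_def l1_jmat simp del: jmat_mult_vec)
      have Qw: "Q w \<Longrightarrow> Q v" using QJ[OF T(2)] by (auto simp: w_def split: if_splits)
      have "Q w"
        by (rule red[OF T _ _ _ _ w(1-3)])
           (use ij one[of i] one[of j] in \<open>auto simp: w_def v_def\<close>)
      then show ?thesis using Qv Qw by blast
    qed
    show ?thesis
    proof (cases "\<exists>i j. i \<noteq> j \<and> (u $ Inl i \<noteq> 0 \<or> u $ Inr i \<noteq> 0) \<and> (u $ Inl j \<noteq> 0 \<or> u $ Inr j \<noteq> 0)")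
      case True
      then obtain i j where "i \<noteq> j" "u $ Inl i \<noteq> 0 \<or> u $ Inr i \<noteq> 0" "u $ Inl j \<noteq> 0 \<or> u $ Inr j \<noteq> 0" by blast
      then show ?thesis
        using two[of i j] two[of j i] linear[of "\<bar>u $ Inl i\<bar> + \<bar>u $ Inr i\<bar>" "\<bar>u $ Inl j\<bar> + \<bar>u $ Inr j\<bar>"] by blast
    next
      case False
      have "\<exists>i. u $ Inl i \<noteq> 0 \<or> u $ Inr i \<noteq> 0"
      proof (rule ccontr)
        assume "\<not> ?thesis"
        then have "sympl u w = 0" for w by (simp add: sympl_def)
        then show False using less.prems(2) by auto
      qed
      then obtain i where i: "u $ Inl i \<noteq> 0 \<or> u $ Inr i \<noteq> 0" by blast
      have iT: "i \<notin> T" using offT i by blast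
      have oth: "u $ Inl a = 0" "u $ Inr a = 0" if "a \<noteq> i" for a using False i that by blast+
      obtain w where "sympl u w = 1" using less.prems(2) by blast
      moreover have "sympl u w = (\<Sum>a\<in>UNIV. if a = i then u $ Inl i * w $ Inr i - u $ Inr i * w $ Inl i else 0)"
        unfolding sympl_def by (intro sum.cong refl) (auto simp: oth)
      ultimately have one1: "u $ Inl i * w $ Inr i - u $ Inr i * w $ Inl i = 1" by simp
      have axl: "u = axis (Inl i) c" if "u $ Inl i = c" "u $ Inr i = 0" for c
        unfolding vec_Plus_eq_iff
      proof (intro conjI allI)
        fix a
        show "u $ Inl a = axis (Inl i) c $ Inl a" "u $ Inr a = axis (Inl i) c $ Inr a"
          using that oth[of a] by (cases "a = i"; simp add: axis_def)+
      qed
      have axr: "u = axis (Inr i) c" if "u $ Inl i = 0" "u $ Inr i = c" for c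
        unfolding vec_Plus_eq_iff
      proof (intro conjI allI)
        fix a
        show "u $ Inl a = axis (Inr i) c $ Inl a" "u $ Inr a = axis (Inr i) c $ Inr a"
          using that oth[of a] by (cases "a = i"; simp add: axis_def)+
      qed
      \<comment> \<open>A vector with one nonzero coordinate that pairs to 1 with an integral vector
        has a unit there.\<close>
      have "u = axis (Inl i) 1 \<or> u = axis (Inl i) (-1) \<or> u = axis (Inr i) 1 \<or> u = axis (Inr i) (-1)"
      proof (cases "u $ Inr i = 0")
        case True
        then have "u $ Inl i * w $ Inr i = 1" using one1 by simp
        then have "u $ Inl i = 1 \<or> u $ Inl i = -1" using zmult_eq_1_iff by blast
        then show ?thesis using axl True by blast
      next
        case F: False
        then have z: "u $ Inl i = 0" using one[of i] by blast
        then have "u $ Inr i * (- w $ Inl i) = 1" using one1 by simp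
        then have "u $ Inr i = 1 \<or> u $ Inr i = -1" using zmult_eq_1_iff by blast
        then show ?thesis using axr z by blast
      qed
      \<comment> \<open>\<open>jmat i\<close> permutes these four vectors in one cycle, so
        \<open>Q\<close> at one of them gives \<open>Q\<close> at all.\<close>
      moreover have cyc: "Q (axis (Inl i) (-1)) \<and> Q (axis (Inr i) (-1)) \<and> Q (axis (Inl i) 1) \<and> Q (axis (Inr i) 1)"
        if "Q (axis (Inr i) 1) \<or> Q (axis (Inl i) 1)" "i \<notin> T" for i
      proof -
        have "Q (axis (Inr i) 1)" using that QJ[of i "axis (Inr i) 1"] by (auto simp: jmat_axis)
        moreover from this have "Q (axis (Inl i) (-1))" using that QJ[of i "axis (Inl i) (-1)"] by (auto simp: jmat_axis)
        moreover from this have "Q (axis (Inr i) (-1))" using that QJ[of i "axis (Inr i) (-1)"] by (auto simp: jmat_axis)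
        moreover from this have "Q (axis (Inl i) 1)" using that QJ[of i "axis (Inl i) 1"] by (auto simp: jmat_axis)
        ultimately show ?thesis by blast
      qed
      moreover have "Q (axis (Inr i) 1) \<or> Q (axis (Inl i) 1)"
      proof (cases "i = s")
        case True then show ?thesis using base by simp
      next
        case False
        \<comment> \<open>With e and f for the \<open>Inl\<close> and \<open>Inr\<close> axes,
          generators lead from f_i to e_s + f_i, to e_s + e_i, to -f_s + e_i and to -f_s;
          \<open>Q\<close> is transported along this chain backwards.\<close>
        define S :: "int ^ 'g ^ 'g" where "S = (\<chi> a b. if (a = i \<and> b = s) \<or> (a = s \<and> b = i) then 1 else 0)"
        have "transpose S = S" by (auto simp: S_def transpose_def vec_eq_iff)
        then have g: "tmat S \<in> gensT T" using iT s by (auto simp: gensT_def S_def)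
        have Si: "(\<Sum>b\<in>UNIV. S $ i $ b * x b) = x s" "(\<Sum>b\<in>UNIV. S $ s $ b * x b) = x i"
          and Sa: "a \<noteq> i \<Longrightarrow> a \<noteq> s \<Longrightarrow> (\<Sum>b\<in>UNIV. S $ a $ b * x b) = 0" for x :: "'g \<Rightarrow> int" and a
        proof -
          show "(\<Sum>b\<in>UNIV. S $ i $ b * x b) = x s" "(\<Sum>b\<in>UNIV. S $ s $ b * x b) = x i"
            using False by (simp_all add: S_def mult_delta_left)
          show "a \<noteq> i \<Longrightarrow> a \<noteq> s \<Longrightarrow> (\<Sum>b\<in>UNIV. S $ a $ b * x b) = 0"
            by (intro sum.neutral) (auto simp: S_def)
        qed
        have tS: "(tmat S *v v) $ Inl a = (if a = i then v $ Inl i + v $ Inr s else if a = s then v $ Inl s + v $ Inr i else v $ Inl a)" for v a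
          using False by (simp add: Si Sa)
        have "Q (axis (Inr s) (-1))" using cyc[of s] base s by blast
        moreover have "tmat S *v (axis (Inr s) (-1) + axis (Inl i) 1) = axis (Inr s) (-1)"
          unfolding vec_Plus_eq_iff tS using False by (auto simp: axis_def)
        ultimately have "Q (axis (Inr s) (-1) + axis (Inl i) 1)" using step[OF g] by metis
        moreover have "jmat s *v (axis (Inl s) 1 + axis (Inl i) 1) = axis (Inr s) (-1) + axis (Inl i) 1"
          unfolding vec_Plus_eq_iff using False by (auto simp: axis_def)
        ultimately have "Q (axis (Inl s) 1 + axis (Inl i) 1)" using QJ[OF s] by metis
        moreover have "jmat i *v (axis (Inl s) 1 + axis (Inr i) 1) = axis (Inl s) 1 + axis (Inl i) 1"
          unfolding vec_Plus_eq_iff using False by (auto simp: axis_def)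
        ultimately have "Q (axis (Inl s) 1 + axis (Inr i) 1)" using QJ[OF iT] by metis
        moreover have "tmat S *v (axis (Inr i) 1) = axis (Inl s) 1 + axis (Inr i) 1"
          unfolding vec_Plus_eq_iff tS using False by (auto simp: axis_def)
        ultimately show ?thesis using step[OF g] by metis
      qed
      ultimately show ?thesis using iT by metis
    qed
  qed
qed

text \<open>Normalises the second vector of a symplectic pair without moving the first. A
  translation clears all \<open>Inl\<close> coordinates; a partial inversion at \<open>j\<close>
  then exchanges a nonzero \<open>Inr\<close> entry with a zero, so their number drops.\<close>

lemma gensT_stabiliser_transitive:
  fixes v :: "int ^ ('g::finite + 'g)"
  assumes step: "\<And>g v. g \<in> gensT T \<Longrightarrow> g *v axis (Inl s) 1 = axis (Inl s) 1 \<Longrightarrow> R (g *v v) \<Longrightarrow> R v"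
    and s: "s \<notin> T" and base: "R (axis (Inr s) 1)"
    and zero: "\<forall>i\<in>T. v $ Inl i = 0 \<and> v $ Inr i = 0" and one: "v $ Inr s = 1"
  shows "R v"
  using zero one
proof (induction "card {j. j \<noteq> s \<and> v $ Inr j \<noteq> 0}" arbitrary: v rule: less_induct)
  case less
  \<comment> \<open>As \<open>v $ Inr s = 1\<close>, column s cancels the \<open>Inl\<close>
    coordinates. Row s is then determined by symmetry, and the corner entry compensates for its
    other contributions.\<close>
  define S :: "int ^ 'g ^ 'g" where "S = (\<chi> a b. if a = s \<and> b = s then - v $ Inl s + (\<Sum>j\<in>UNIV - {s}. v $ Inl j * v $ Inr j)
     else if a = s then - v $ Inl b else if b = s then - v $ Inl a else 0)"
  have "transpose S = S" by (auto simp: S_def transpose_def vec_eq_iff)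
  then have g: "tmat S \<in> gensT T" using less.prems s by (auto simp: gensT_def S_def)
  have gs: "tmat S *v axis (Inl s) 1 = axis (Inl s) 1"
    by (auto simp: vec_Plus_eq_iff axis_def)
  have p0: "(tmat S *v v) $ Inl a = 0" for a
  proof -
    have "(\<Sum>b\<in>UNIV. S $ a $ b * v $ Inr b) = S $ a $ s * v $ Inr s + (\<Sum>b\<in>UNIV - {s}. S $ a $ b * v $ Inr b)"
      by (rule sum.remove) auto
    also have "\<dots> = - v $ Inl a"
    proof (cases "a = s")
      case True
      have "(\<Sum>b\<in>UNIV - {s}. S $ a $ b * v $ Inr b) = (\<Sum>b\<in>UNIV - {s}. - (v $ Inl b * v $ Inr b))"
        by (intro sum.cong refl) (auto simp: S_def True)
      then show ?thesis using less.prems by (simp add: True S_def sum_negf)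
    next
      case False
      have "(\<Sum>b\<in>UNIV - {s}. S $ a $ b * v $ Inr b) = 0"
        by (intro sum.neutral) (auto simp: S_def False)
      then show ?thesis using less.prems False by (simp add: S_def)
    qed
    finally show ?thesis by simp
  qed
  have "R (tmat S *v v)"
  proof (cases "\<exists>j. j \<noteq> s \<and> v $ Inr j \<noteq> 0")
    case True
    then obtain j where j: "j \<noteq> s" "v $ Inr j \<noteq> 0" by blast
    then have jT: "j \<notin> T" using less.prems by auto
    have J: "jmat j \<in> gensT T" using jT by (auto simp: gensT_def)
    let ?w = "jmat j *v (tmat S *v v)"
    have "R ?w"
    proof (rule less.hyps)
      show "card {i. i \<noteq> s \<and> ?w $ Inr i \<noteq> 0} < card {i. i \<noteq> s \<and> v $ Inr i \<noteq> 0}"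
      proof (rule psubset_card_mono)
        show "{i. i \<noteq> s \<and> ?w $ Inr i \<noteq> 0} \<subset> {i. i \<noteq> s \<and> v $ Inr i \<noteq> 0}"
          using j by (auto simp: p0 simp del: tmat_mult_vec(1))
      qed simp
      show "\<forall>i\<in>T. ?w $ Inl i = 0 \<and> ?w $ Inr i = 0" by (intro gensT_zero J g less.prems)
      show "?w $ Inr s = 1" using j less.prems by simp
    qed
    moreover have "jmat j *v axis (Inl s) 1 = axis (Inl s) 1"
      using j by (auto simp: vec_Plus_eq_iff axis_def)
    ultimately show ?thesis using step[OF J] by blast
  next
    case False
    then have "tmat S *v v = axis (Inr s) 1"
      using less.prems p0 by (auto simp: vec_Plus_eq_iff axis_def simp del: tmat_mult_vec(1))
    then show ?thesis using base by simp
  qed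
  then show ?case using step[OF g gs] by blast
qed

lemma sympl_axis:
  "sympl (axis (Inl i) 1) w = w $ Inr i" "sympl (axis (Inr i) 1) w = - w $ Inl i"
  by (simp_all add: sympl_def axis_def mult_delta_left sum_negf)

text \<open>Induction on the number of pairs of columns that are not yet standard. Left
  multiplication by generators moves the first column of a new pair to its axis by transitivity,
  then the second by means of the stabiliser of that axis.\<close>

theorem Sp_Z_generated:
  fixes M :: "int ^ ('g::finite + 'g) ^ ('g + 'g)"
  assumes one: "P (mat 1)"
    and step: "\<And>g M. g \<in> gensT {} \<Longrightarrow> M \<in> Sp_Z \<Longrightarrow> P (g ** M) \<Longrightarrow> P M"
    and M: "M \<in> Sp_Z"
  shows "P M"
proof -
  define fixed where "fixed T M \<longleftrightarrow> (\<forall>i\<in>T. column (Inl i) M = axis (Inl i) 1 \<and> column (Inr i) M = axis (Inr i) (1::int))"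
    for T and M :: "int ^ ('g + 'g) ^ ('g + 'g)"
  have sub: "gensT T \<subseteq> gensT {}" for T :: "'g set" by (auto simp: gensT_def)
  \<comment> \<open>Orthogonality to the standard columns in \<open>T\<close> forces the remaining
    columns to vanish in these coordinates, so the reduction never leaves the smaller space.\<close>
  have zero: "\<forall>i\<in>T. column k M $ Inl i = 0 \<and> column k M $ Inr i = 0"
    if M: "M \<in> Sp_Z" "fixed T M" and k: "k = Inl s \<or> k = Inr s" "s \<notin> T" for T M k s
  proof
    fix i assume i: "i \<in> T"
    then have c: "column (Inl i) M = axis (Inl i) 1" "column (Inr i) M = axis (Inr i) 1"
      using M by (auto simp: fixed_def)
    have "sympl (column (Inl i) M) (column k M) = Jmat $ Inl i $ k" "sympl (column (Inr i) M) (column k M) = Jmat $ Inr i $ k"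
      using M(1) by (simp_all add: Sp_Z_iff)
    then show "column k M $ Inl i = 0 \<and> column k M $ Inr i = 0"
      unfolding c sympl_axis using k i by (cases "i = s") auto
  qed
  have mult: "g ** M \<in> Sp_Z" "fixed T (g ** M)" if "g \<in> gensT T" "M \<in> Sp_Z" "fixed T M" for g M T
    using that Sp_Z_mult[OF gensT_Sp_Z[OF that(1)]] by (auto simp: fixed_def column_mult gensT_fixes)
  have "P M" if "M \<in> Sp_Z" "fixed T M" for T M
    using that
  proof (induction "card (UNIV - T)" arbitrary: T M rule: less_induct)
    case less
    show ?case
    proof (cases "T = UNIV")
      case True
      have "column k M = column k (mat 1)" for k
        using less.prems(2) True unfolding column_mat_1 fixed_def by (cases k) auto
      then have "M = mat 1" by (simp add: column_def vec_eq_iff)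
      then show ?thesis using one by simp
    next
      case False
      then obtain s where s: "s \<notin> T" by blast
      have IH: "P M" if "M \<in> Sp_Z" "fixed (insert s T) M" for M
      proof (rule less.hyps[OF _ that])
        show "card (UNIV - insert s T) < card (UNIV - T)"
          using s by (intro psubset_card_mono) auto
      qed
      define R where "R v \<longleftrightarrow> (\<forall>M\<in>Sp_Z. fixed T M \<longrightarrow> column (Inl s) M = axis (Inl s) 1 \<longrightarrow> column (Inr s) M = v \<longrightarrow> P M)" for v
      define Q where "Q u \<longleftrightarrow> (\<forall>M\<in>Sp_Z. fixed T M \<longrightarrow> column (Inl s) M = u \<longrightarrow> P M)" for u
      have Rbase: "R (axis (Inr s) 1)" unfolding R_def using IH by (auto simp: fixed_def)
      have Rstep: "R v" if g: "g \<in> gensT T" "g *v axis (Inl s) 1 = axis (Inl s) 1" "R (g *v v)" for g v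
        unfolding R_def
      proof (intro ballI impI)
        fix M assume M: "M \<in> Sp_Z" "fixed T M" "column (Inl s) M = axis (Inl s) 1" "column (Inr s) M = v"
        have "P (g ** M)" using g(3) mult[OF g(1) M(1,2)] M(3,4) g(2) unfolding R_def by (simp add: column_mult)
        then show "P M" using step sub g(1) M(1) by blast
      qed
      have Qbase: "Q (axis (Inl s) 1)"
        unfolding Q_def
      proof (intro ballI impI)
        fix M assume M: "M \<in> Sp_Z" "fixed T M" "column (Inl s) M = axis (Inl s) 1"
        have "R (column (Inr s) M)"
        proof (rule gensT_stabiliser_transitive[where R = R, OF Rstep s Rbase])
          show "\<forall>i\<in>T. column (Inr s) M $ Inl i = 0 \<and> column (Inr s) M $ Inr i = 0"
            using zero[OF M(1,2)] s by blast
          have "sympl (column (Inl s) M) (column (Inr s) M) = 1" using M(1) by (simp add: Sp_Z_iff)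
          then show "column (Inr s) M $ Inr s = 1" unfolding M(3) sympl_axis .
        qed
        then show "P M" using M by (simp add: R_def)
      qed
      have Qstep: "Q u" if g: "g \<in> gensT T" "Q (g *v u)" for g u
        unfolding Q_def
      proof (intro ballI impI)
        fix M assume M: "M \<in> Sp_Z" "fixed T M" "column (Inl s) M = u"
        have "P (g ** M)" using g(2) mult[OF g(1) M(1,2)] M(3) unfolding Q_def by (simp add: column_mult)
        then show "P M" using step sub g(1) M(1) by blast
      qed
      have "Q (column (Inl s) M)"
      proof (rule gensT_transitive[where Q = Q, OF Qstep s Qbase])
        show "\<forall>i\<in>T. column (Inl s) M $ Inl i = 0 \<and> column (Inl s) M $ Inr i = 0"
          using zero[OF less.prems] s by blast
        show "\<exists>w. sympl (column (Inl s) M) w = 1"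
          using less.prems(1) by (intro exI[of _ "column (Inr s) M"]) (simp add: Sp_Z_iff)
      qed
      then show ?thesis using less.prems by (simp add: Q_def)
    qed
  qed
  from this[OF M, of "{}"] show ?thesis by (simp add: fixed_def)
qed

section \<open>The Siegel-Jacobi theta series of \<open>E\<^sub>8\<^sup>g\<close>\<close>

text \<open>In doubled coordinates this is four times the inner product of the lattice.
  \<open>sum8\<close> is \<open>ip8\<close> with the all-ones vector, which represents the root
  (1/2, ..., 1/2).\<close>

definition ip8 :: "(8 \<Rightarrow> int) \<Rightarrow> (8 \<Rightarrow> int) \<Rightarrow> int" where "ip8 x y = (\<Sum>k\<in>UNIV. x k * y k)"
definition sum8 :: "(8 \<Rightarrow> int) \<Rightarrow> int" where "sum8 x = (\<Sum>k\<in>UNIV. x k)"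

lemma ip8_commute: "ip8 x y = ip8 y x" by (simp add: ip8_def mult.commute)

text \<open>The lattice is even. For integral coordinates y the sum of y^2 has the parity of the sum
  of y, which is even; in the other class eight odd squares, each 1 modulo 8, are added.\<close>

lemma E8_norm:
  assumes "x \<in> E8"
  shows "8 dvd ip8 x x"
proof -
  have par: "\<And>k l. x k mod 2 = x l mod 2" and s: "4 dvd (\<Sum>k\<in>UNIV. x k)"
    using assms by (auto simp: E8_def)
  show ?thesis
  proof (cases "even (x 0)")
    case True
    then have "\<forall>k. \<exists>y. x k = 2 * y" using par by (metis dvdE mod_0_imp_dvd dvd_imp_mod_0)
    then obtain y where y: "\<And>k. x k = 2 * y k" by metis
    have "(\<Sum>k\<in>UNIV. x k) = 2 * (\<Sum>k\<in>UNIV. y k)" by (simp add: y sum_distrib_left)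
    then have "even (\<Sum>k\<in>UNIV. y k)" using s by presburger
    moreover have "even (\<Sum>k\<in>UNIV. y k * (y k - 1))" by (intro dvd_sum) auto
    moreover have "(\<Sum>k\<in>UNIV. y k * y k) = (\<Sum>k\<in>UNIV. y k * (y k - 1)) + (\<Sum>k\<in>UNIV. y k)"
      by (simp add: algebra_simps flip: sum.distrib)
    ultimately have "even (\<Sum>k\<in>UNIV. y k * y k)" by simp
    moreover have "ip8 x x = 4 * (\<Sum>k\<in>UNIV. y k * y k)"
      by (simp add: ip8_def y sum_distrib_left mult_ac)
    ultimately show ?thesis by presburger
  next
    case False
    then have "\<forall>k. \<exists>y. x k = 2 * y + 1" using par by (metis oddE odd_iff_mod_2_eq_one)
    then obtain y where y: "\<And>k. x k = 2 * y k + 1" by metis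
    have "8 dvd 4 * (y k * (y k + 1))" for k
    proof -
      have "even (y k * (y k + 1))" by auto
      then obtain h where "y k * (y k + 1) = 2 * h" by (elim evenE)
      then show ?thesis by simp
    qed
    then have "8 dvd (\<Sum>k\<in>UNIV. 4 * (y k * (y k + 1)))" by (intro dvd_sum) auto
    moreover have "ip8 x x = (\<Sum>k\<in>UNIV. 4 * (y k * (y k + 1))) + 8"
    proof -
      have "ip8 x x = (\<Sum>k\<in>UNIV. 4 * (y k * (y k + 1)) + 1)"
        unfolding ip8_def y by (intro sum.cong refl) (simp add: algebra_simps)
      then show ?thesis by (simp add: sum.distrib)
    qed
    ultimately show ?thesis by simp
  qed
qed

lemma E8_add:
  assumes "x \<in> E8" "y \<in> E8"
  shows "(\<lambda>k. x k + y k) \<in> E8"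
proof -
  have "(x k + y k) mod 2 = (x l + y l) mod 2" for k l
    using assms by (intro mod_add_cong) (simp_all add: E8_def)
  moreover have "4 dvd (\<Sum>k\<in>UNIV. x k + y k)"
    using assms by (auto simp: E8_def sum.distrib)
  ultimately show ?thesis by (auto simp: E8_def)
qed

lemma E8_const: "(\<lambda>k. c) \<in> E8"
  by (simp add: E8_def)

lemma E8_zero: "(\<lambda>k. 0) \<in> E8"
  by (rule E8_const)

text \<open>Polarisation of the divisibility of norms by 8.\<close>

lemma E8_ip8:
  assumes "x \<in> E8" "y \<in> E8"
  shows "4 dvd ip8 x y"
proof -
  have "ip8 (\<lambda>k. x k + y k) (\<lambda>k. x k + y k) = ip8 x x + ip8 y y + 2 * ip8 x y"
    by (simp add: ip8_def sum.distrib algebra_simps sum_distrib_left)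
  moreover have "8 dvd ip8 (\<lambda>k. x k + y k) (\<lambda>k. x k + y k)" "8 dvd ip8 x x" "8 dvd ip8 y y"
    using E8_norm E8_add assms by blast+
  ultimately show ?thesis by presburger
qed

lemma E8_sum8: "x \<in> E8 \<Longrightarrow> 4 dvd sum8 x"
  by (simp add: E8_def sum8_def)

definition E8n :: "('g::finite \<Rightarrow> 8 \<Rightarrow> int) set" where "E8n = {X. \<forall>i. X i \<in> E8}"

text \<open>In true coordinates the exponent is pi i times the trace of Z against the Gram matrix of
  X, plus 2 pi i times the sum of W_i (X_i, e) with e = (1/2, ..., 1/2); the doubling accounts for
  the factor 1/4.\<close>

definition texp :: "complex ^ 'g ^ 'g \<Rightarrow> complex ^ 'g \<Rightarrow> ('g::finite \<Rightarrow> 8 \<Rightarrow> int) \<Rightarrow> complex" where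
  "texp Z W X = pi * \<i> / 4 * ((\<Sum>i\<in>UNIV. \<Sum>j\<in>UNIV. Z $ i $ j * of_int (ip8 (X i) (X j))) + 2 * (\<Sum>i\<in>UNIV. W $ i * of_int (sum8 (X i))))"

definition Theta :: "complex ^ 'g ^ 'g \<Rightarrow> complex ^ 'g::finite \<Rightarrow> complex" where
  "Theta Z W = (if Z \<in> siegel_H then \<Sum>\<^sub>\<infinity>X\<in>E8n. exp (texp Z W X) else 0)"

section \<open>Convergence and holomorphy of the theta series\<close>

text \<open>The form attains a positive minimum on the compact unit sphere; homogeneity does the
  rest.\<close>

lemma siegel_H_coercive:
  fixes Z :: "complex ^ 'g::finite ^ 'g"
  assumes "Z \<in> siegel_H"
  obtains \<epsilon> where "\<epsilon> > 0" "\<And>x::'g \<Rightarrow> real. \<epsilon> * (\<Sum>i\<in>UNIV. (x i)^2) \<le> (\<Sum>i\<in>UNIV. \<Sum>j\<in>UNIV. x i * Im (Z $ i $ j) * x j)"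
proof -
  define Q where "Q x = (\<Sum>i\<in>UNIV. \<Sum>j\<in>UNIV. x $ i * Im (Z $ i $ j) * x $ j)" for x :: "real ^ 'g"
  have Qpos: "x \<noteq> 0 \<Longrightarrow> Q x > 0" for x using assms by (simp add: siegel_H_def Q_def)
  have "continuous_on (sphere 0 1) Q" unfolding Q_def by (intro continuous_intros)
  moreover have "sphere (0 :: real ^ 'g) 1 \<noteq> {}" by simp
  ultimately obtain e where e: "e \<in> sphere 0 1" "\<And>y. y \<in> sphere 0 1 \<Longrightarrow> Q e \<le> Q y"
    using continuous_attains_inf[OF compact_sphere] by blast
  have e0: "Q e > 0" using e(1) by (intro Qpos) auto
  have "Q e * (\<Sum>i\<in>UNIV. (x i)^2) \<le> (\<Sum>i\<in>UNIV. \<Sum>j\<in>UNIV. x i * Im (Z $ i $ j) * x j)" for x :: "'g \<Rightarrow> real"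
  proof -
    define v where "v = (\<chi> i. x i)"
    have n: "(\<Sum>i\<in>UNIV. (x i)^2) = (norm v)^2"
      by (simp add: norm_vec_def L2_set_def v_def sum_nonneg)
    have Qv: "(\<Sum>i\<in>UNIV. \<Sum>j\<in>UNIV. x i * Im (Z $ i $ j) * x j) = Q v" by (simp add: Q_def v_def)
    show ?thesis
    proof (cases "v = 0")
      case True then show ?thesis unfolding n Qv by (simp add: Q_def)
    next
      case False
      have "Q e \<le> Q ((1 / norm v) *\<^sub>R v)" using False by (intro e(2)) simp
      also have "\<dots> = (1 / norm v)^2 * Q v"
        by (simp add: Q_def sum_distrib_left power2_eq_square mult_ac)
      finally show ?thesis unfolding n Qv using False by (simp add: field_simps)
    qed
  qed
  with e0 show ?thesis using that by blast
qed

lemma summable_E8n_gaussian: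
  fixes \<epsilon> C :: real
  assumes "\<epsilon> > 0"
  shows "(\<lambda>X::'g::finite \<Rightarrow> 8 \<Rightarrow> int. exp (\<Sum>i\<in>UNIV. \<Sum>k\<in>UNIV. - \<epsilon> * (of_int (X i k))^2 + C * \<bar>of_int (X i k)\<bar>)) summable_on UNIV"
proof -
  have 1: "(\<lambda>x::8 \<Rightarrow> int. \<Prod>k\<in>UNIV. exp (- \<epsilon> * (of_int (x k))^2 + C * \<bar>of_int (x k)\<bar>)) summable_on (PiE UNIV (\<lambda>_. UNIV))"
    by (rule summable_on_prod_PiE) (use summable_on_int_gaussian[OF assms] in auto)
  have "(\<lambda>X::'g \<Rightarrow> 8 \<Rightarrow> int. \<Prod>i\<in>UNIV. \<Prod>k\<in>UNIV. exp (- \<epsilon> * (of_int (X i k))^2 + C * \<bar>of_int (X i k)\<bar>)) summable_on (PiE UNIV (\<lambda>_. UNIV))"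
    by (rule summable_on_prod_PiE) (use 1 in \<open>auto simp: PiE_UNIV_domain intro!: prod_nonneg\<close>)
  then show ?thesis by (simp add: exp_sum PiE_UNIV_domain)
qed

text \<open>Coercivity is applied separately to each of the eight coordinates k, with X i k as a
  vector indexed by i.\<close>

lemma Re_texp_le:
  fixes Z :: "complex ^ 'g::finite ^ 'g"
  assumes \<epsilon>: "\<And>x::'g \<Rightarrow> real. \<epsilon> * (\<Sum>i\<in>UNIV. (x i)^2) \<le> (\<Sum>i\<in>UNIV. \<Sum>j\<in>UNIV. x i * Im (Z $ i $ j) * x j)"
  shows "Re (texp Z W X) \<le> (\<Sum>i\<in>UNIV. \<Sum>k\<in>UNIV. - (pi * \<epsilon> / 4) * (of_int (X i k))^2 + (pi / 2 * norm W) * \<bar>of_int (X i k)\<bar>)"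
proof -
  have "Im (\<Sum>i\<in>UNIV. \<Sum>j\<in>UNIV. Z $ i $ j * of_int (ip8 (X i) (X j))) = (\<Sum>i\<in>UNIV. \<Sum>j\<in>UNIV. \<Sum>k\<in>UNIV. of_int (X i k) * Im (Z $ i $ j) * of_int (X j k))"
    by (simp add: ip8_def sum_distrib_left mult_ac)
  also have "\<dots> = (\<Sum>k\<in>UNIV. \<Sum>i\<in>UNIV. \<Sum>j\<in>UNIV. of_int (X i k) * Im (Z $ i $ j) * of_int (X j k))"
    by (subst sum.swap[of _ _ "UNIV :: 8 set"], subst (2) sum.swap) (rule refl)
  also have "\<dots> \<ge> (\<Sum>k\<in>UNIV. \<epsilon> * (\<Sum>i\<in>UNIV. (of_int (X i k))^2))"
    by (intro sum_mono \<epsilon>)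
  finally have 1: "Im (\<Sum>i\<in>UNIV. \<Sum>j\<in>UNIV. Z $ i $ j * of_int (ip8 (X i) (X j))) \<ge> \<epsilon> * (\<Sum>i\<in>UNIV. \<Sum>k\<in>UNIV. (of_int (X i k))^2)"
    by (subst sum.swap) (simp add: sum_distrib_left)
  have "- Im (\<Sum>i\<in>UNIV. W $ i * of_int (sum8 (X i))) \<le> norm (\<Sum>i\<in>UNIV. W $ i * of_int (sum8 (X i)))"
    using abs_Im_le_cmod abs_le_D2 by blast
  also have "\<dots> \<le> (\<Sum>i\<in>UNIV. norm W * (\<Sum>k\<in>UNIV. \<bar>of_int (X i k)\<bar>))"
  proof (intro sum_norm_le)
    fix i
    have "\<bar>real_of_int (sum8 (X i))\<bar> \<le> (\<Sum>k\<in>UNIV. \<bar>of_int (X i k)\<bar>)"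
      unfolding sum8_def of_int_sum by (rule sum_abs)
    then show "norm (W $ i * of_int (sum8 (X i))) \<le> norm W * (\<Sum>k\<in>UNIV. \<bar>of_int (X i k)\<bar>)"
      unfolding norm_mult norm_of_int by (intro mult_mono Finite_Cartesian_Product.norm_nth_le) auto
  qed
  finally have 2: "- Im (\<Sum>i\<in>UNIV. W $ i * of_int (sum8 (X i))) \<le> norm W * (\<Sum>i\<in>UNIV. \<Sum>k\<in>UNIV. \<bar>of_int (X i k)\<bar>)"
    by (simp add: sum_distrib_left)
  define A B where "A = (\<Sum>i\<in>UNIV. \<Sum>j\<in>UNIV. Z $ i $ j * of_int (ip8 (X i) (X j)))" and "B = (\<Sum>i\<in>UNIV. W $ i * of_int (sum8 (X i)))"
  have "Re (texp Z W X) = - (pi / 4) * Im A + (pi / 2) * (- Im B)"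
    unfolding texp_def A_def[symmetric] B_def[symmetric] by (simp add: field_simps)
  also have "\<dots> \<le> - (pi / 4) * (\<epsilon> * (\<Sum>i\<in>UNIV. \<Sum>k\<in>UNIV. (of_int (X i k))^2)) + (pi / 2) * (norm W * (\<Sum>i\<in>UNIV. \<Sum>k\<in>UNIV. \<bar>of_int (X i k)\<bar>))"
    by (intro add_mono mult_left_mono mult_left_mono_neg 1[folded A_def] 2[folded B_def]) auto
  also have "\<dots> = (\<Sum>i\<in>UNIV. \<Sum>k\<in>UNIV. - (pi * \<epsilon> / 4) * (of_int (X i k))^2 + (pi / 2 * norm W) * \<bar>of_int (X i k)\<bar>)"
    by (simp add: sum.distrib sum_subtractf sum_distrib_left mult_ac sum_negf)
  finally show ?thesis .
qed

lemma norm_Theta_summable: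
  fixes Z :: "complex ^ 'g::finite ^ 'g"
  assumes "Z \<in> siegel_H"
  shows "(\<lambda>X. norm (exp (texp Z W X))) summable_on UNIV"
proof -
  obtain \<epsilon> where \<epsilon>: "\<epsilon> > 0" "\<And>x::'g \<Rightarrow> real. \<epsilon> * (\<Sum>i\<in>UNIV. (x i)^2) \<le> (\<Sum>i\<in>UNIV. \<Sum>j\<in>UNIV. x i * Im (Z $ i $ j) * x j)"
    using siegel_H_coercive[OF assms] by blast
  show ?thesis
    unfolding norm_exp_eq_Re
    by (rule summable_on_comparison_test[OF summable_E8n_gaussian[of "pi * \<epsilon> / 4" "pi / 2 * norm W"]])
       (use \<epsilon>(1) Re_texp_le[OF \<epsilon>(2)] in auto)
qed

lemma Theta_summable: "Z \<in> siegel_H \<Longrightarrow> (\<lambda>X. exp (texp Z W X)) summable_on A"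
  using summable_on_subset_banach[OF abs_summable_summable[OF norm_Theta_summable]] by blast

text \<open>Supplies the bounds \<open>K\<close> for differentiating the series. The part linear in
  X is also bounded quadratically, since |n| \<le> n^2 for integers.\<close>

lemma norm_texp_le:
  fixes Z :: "complex ^ 'g::finite ^ 'g"
  shows "norm (texp Z W X) \<le> (pi / 4 * (real CARD('g) + 2)) * (\<Sum>i\<in>UNIV. \<Sum>k\<in>UNIV. (of_int (X i k))^2) * norm (Z, W)"
proof -
  define N where "N = (\<Sum>i\<in>UNIV. \<Sum>k\<in>UNIV. (real_of_int (X i k))^2)"
  have nZ: "norm (Z $ i $ j) \<le> norm (Z, W)" for i j
    using Finite_Cartesian_Product.norm_nth_le[of "Z $ i" j] Finite_Cartesian_Product.norm_nth_le[of Z i] norm_fst_le[of Z W] by linarith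
  have nW: "norm (W $ i) \<le> norm (Z, W)" for i
    using Finite_Cartesian_Product.norm_nth_le[of W i] norm_snd_le[of W Z] by linarith
  have ipb: "\<bar>real_of_int (ip8 (X i) (X j))\<bar> \<le> ((\<Sum>k\<in>UNIV. (of_int (X i k))^2) + (\<Sum>k\<in>UNIV. (of_int (X j k))^2)) / 2" for i j
  proof -
    have "\<bar>real_of_int (ip8 (X i) (X j))\<bar> \<le> (\<Sum>k\<in>UNIV. \<bar>of_int (X i k) * of_int (X j k)\<bar>)"
      unfolding ip8_def of_int_sum of_int_mult by (rule sum_abs)
    also have "\<dots> \<le> (\<Sum>k\<in>UNIV. ((of_int (X i k))^2 + (of_int (X j k))^2) / 2)"
    proof (intro sum_mono)
      fix k
      show "\<bar>real_of_int (X i k) * of_int (X j k)\<bar> \<le> ((of_int (X i k))^2 + (of_int (X j k))^2) / 2"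
        using sum_squares_bound[of "\<bar>real_of_int (X i k)\<bar>" "\<bar>real_of_int (X j k)\<bar>"] by (simp add: abs_mult)
    qed
    finally show ?thesis by (simp add: sum.distrib sum_divide_distrib add_divide_distrib)
  qed
  have "norm (\<Sum>i\<in>UNIV. \<Sum>j\<in>UNIV. Z $ i $ j * of_int (ip8 (X i) (X j))) \<le> (\<Sum>i\<in>(UNIV::'g set). \<Sum>j\<in>(UNIV::'g set). norm (Z, W) * (((\<Sum>k\<in>UNIV. (of_int (X i k))^2) + (\<Sum>k\<in>UNIV. (of_int (X j k))^2)) / 2))"
    by (intro sum_norm_le) (unfold norm_mult norm_of_int, intro mult_mono nZ ipb, auto)
  also have "\<dots> = norm (Z, W) * ((\<Sum>i\<in>(UNIV::'g set). \<Sum>j\<in>(UNIV::'g set). (\<Sum>k\<in>UNIV. (of_int (X i k))^2) + (\<Sum>k\<in>UNIV. (of_int (X j k))^2)) / 2)"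
    by (simp only: sum_distrib_left sum_divide_distrib)
  also have "(\<Sum>i\<in>(UNIV::'g set). \<Sum>j\<in>(UNIV::'g set). (\<Sum>k\<in>UNIV. (of_int (X i k))^2) + (\<Sum>k\<in>UNIV. (of_int (X j k))^2)) = 2 * real CARD('g) * N"
    by (simp add: sum.distrib N_def sum_distrib_left mult.assoc)
  finally have 1: "norm (\<Sum>i\<in>UNIV. \<Sum>j\<in>UNIV. Z $ i $ j * of_int (ip8 (X i) (X j))) \<le> real CARD('g) * N * norm (Z, W)"
    by (simp add: mult_ac)
  have "norm (\<Sum>i\<in>UNIV. W $ i * of_int (sum8 (X i))) \<le> (\<Sum>i\<in>UNIV. norm (Z, W) * (\<Sum>k\<in>UNIV. (of_int (X i k))^2))"
  proof (intro sum_norm_le)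
    fix i
    have "\<bar>real_of_int (sum8 (X i))\<bar> \<le> (\<Sum>k\<in>UNIV. \<bar>of_int (X i k)\<bar>)"
      unfolding sum8_def of_int_sum by (rule sum_abs)
    also have "\<dots> \<le> (\<Sum>k\<in>UNIV. (of_int (X i k))^2)"
    proof (intro sum_mono)
      fix k
      have "\<bar>X i k\<bar> \<le> (X i k)^2"
      proof (cases "X i k = 0")
        case False
        then have "\<bar>X i k\<bar> * 1 \<le> \<bar>X i k\<bar> * \<bar>X i k\<bar>" by (intro mult_left_mono) auto
        then show ?thesis by (simp add: power2_eq_square)
      qed simp
      then show "\<bar>real_of_int (X i k)\<bar> \<le> (of_int (X i k))^2" by (simp flip: of_int_power of_int_abs)
    qed
    finally show "norm (W $ i * of_int (sum8 (X i))) \<le> norm (Z, W) * (\<Sum>k\<in>UNIV. (of_int (X i k))^2)"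
      unfolding norm_mult norm_of_int by (intro mult_mono nW) auto
  qed
  then have 2: "norm (\<Sum>i\<in>UNIV. W $ i * of_int (sum8 (X i))) \<le> N * norm (Z, W)"
    by (simp add: N_def sum_distrib_left mult_ac)
  have "norm (texp Z W X) = pi / 4 * norm ((\<Sum>i\<in>UNIV. \<Sum>j\<in>UNIV. Z $ i $ j * of_int (ip8 (X i) (X j))) + 2 * (\<Sum>i\<in>UNIV. W $ i * of_int (sum8 (X i))))"
    by (simp add: texp_def norm_mult)
  also have "\<dots> \<le> pi / 4 * (real CARD('g) * N * norm (Z, W) + 2 * (N * norm (Z, W)))"
    by (intro mult_left_mono norm_triangle_le add_mono 1) (use 2 in \<open>auto simp: norm_mult\<close>)
  finally show ?thesis unfolding N_def[symmetric] by (simp add: algebra_simps)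
qed

lemma texp_linear: "linear (\<lambda>p. texp (fst p) (snd p) X)"
proof (rule linearI)
  show "texp (fst (p + q)) (snd (p + q)) X = texp (fst p) (snd p) X + texp (fst q) (snd q) X" for p q
    by (simp add: texp_def algebra_simps sum.distrib)
  show "texp (fst (r *\<^sub>R p)) (snd (r *\<^sub>R p)) X = r *\<^sub>R texp (fst p) (snd p) X" for r p
    unfolding texp_def fst_scaleR snd_scaleR vector_scaleR_component unfolding scaleR_conv_of_real
    by (simp add: sum_distrib_left mult_ac ring_distribs)
qed

lemma texp_cmul_pair: "texp (fst (cmul_pair c p)) (snd (cmul_pair c p)) X = c * texp (fst p) (snd p) X"
  by (simp add: texp_def cmul_pair_def algebra_simps sum_distrib_left)

lemma holo_HC_Theta: "holo_HC (Theta :: complex ^ 'g::finite ^ 'g \<Rightarrow> _)"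
  unfolding holo_HC_def
proof
  fix p :: "(complex ^ 'g ^ 'g) \<times> (complex ^ 'g)" assume p: "p \<in> siegel_H \<times> UNIV"
  obtain \<epsilon> where \<epsilon>: "\<epsilon> > 0" "\<And>x::'g \<Rightarrow> real. \<epsilon> * (\<Sum>i\<in>UNIV. (x i)^2) \<le> (\<Sum>i\<in>UNIV. \<Sum>j\<in>UNIV. x i * Im (fst p $ i $ j) * x j)"
  proof -
    have "fst p \<in> siegel_H" using p by auto
    from siegel_H_coercive[OF this] show ?thesis using that by blast
  qed
  define D where "D = pi / 4 * (real CARD('g) + 2)"
  have D: "D > 0" by (simp add: D_def)
  define N where "N X = (\<Sum>i\<in>UNIV. \<Sum>k\<in>UNIV. (real_of_int (X i k))^2)" for X :: "'g \<Rightarrow> 8 \<Rightarrow> int"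
  \<comment> \<open>Chosen so that the weight costs half of the Gaussian decay: pi \<epsilon> / 4
    becomes pi \<epsilon> / 8.\<close>
  define \<delta> where "\<delta> = pi * \<epsilon> / 8 / D"
  let ?L = "\<lambda>v. \<Sum>\<^sub>\<infinity>X\<in>E8n. 1 * exp (texp (fst p) (snd p) X) * texp (fst v) (snd v) X"
  have "((\<lambda>q. \<Sum>\<^sub>\<infinity>X\<in>E8n. 1 * exp (texp (fst q) (snd q) X)) has_derivative ?L) (at p)"
  proof (rule exp_series_has_derivative[where K = "\<lambda>X. D * N X" and \<delta> = \<delta> and a = "\<lambda>X q. texp (fst q) (snd q) X"])
    show "linear (\<lambda>q. texp (fst q) (snd q) X)" for X :: "'g \<Rightarrow> 8 \<Rightarrow> int" by (rule texp_linear)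
    show "norm (texp (fst v) (snd v) X) \<le> D * N X * norm v" for X and v :: "(complex ^ 'g ^ 'g) \<times> (complex ^ 'g)"
      using norm_texp_le[of "fst v" "snd v" X] by (simp add: D_def N_def)
    show "D * N X \<ge> 0" for X using D by (auto simp: N_def intro!: mult_nonneg_nonneg sum_nonneg)
    show "\<delta> > 0" using \<epsilon> D by (simp add: \<delta>_def)
    have "(\<lambda>X::'g \<Rightarrow> 8 \<Rightarrow> int. exp (Re (texp (fst p) (snd p) X) + \<delta> * (D * N X))) summable_on UNIV"
    proof (rule summable_on_comparison_test[OF summable_E8n_gaussian[of "pi * \<epsilon> / 8" "pi / 2 * norm (snd p)"]])
      fix X :: "'g \<Rightarrow> 8 \<Rightarrow> int"
      have "Re (texp (fst p) (snd p) X) + \<delta> * (D * N X) \<le>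
        (\<Sum>i\<in>UNIV. \<Sum>k\<in>UNIV. - (pi * \<epsilon> / 4) * (of_int (X i k))^2 + (pi / 2 * norm (snd p)) * \<bar>of_int (X i k)\<bar>) + pi * \<epsilon> / 8 * N X"
      proof (rule add_mono[OF Re_texp_le[OF \<epsilon>(2)]])
        show "\<delta> * (D * N X) \<le> pi * \<epsilon> / 8 * N X" using D by (simp add: \<delta>_def)
      qed
      also have "\<dots> = (\<Sum>i\<in>UNIV. \<Sum>k\<in>UNIV. - (pi * \<epsilon> / 8) * (of_int (X i k))^2 + (pi / 2 * norm (snd p)) * \<bar>of_int (X i k)\<bar>)"
        unfolding N_def sum_distrib_left sum.distrib[symmetric] by (intro sum.cong refl) (simp add: field_simps)
      finally show "exp (Re (texp (fst p) (snd p) X) + \<delta> * (D * N X)) \<le> exp (\<Sum>i\<in>UNIV. \<Sum>k\<in>UNIV. - (pi * \<epsilon> / 8) * (of_int (X i k))^2 + (pi / 2 * norm (snd p)) * \<bar>of_int (X i k)\<bar>)"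
        by simp
    qed (use \<epsilon> in auto)
    then have "(\<lambda>X::'g \<Rightarrow> 8 \<Rightarrow> int. exp (Re (texp (fst p) (snd p) X) + \<delta> * (D * N X))) summable_on E8n"
      by (rule summable_on_subset_banach) auto
    then show "(\<lambda>X. norm (1 * exp (texp (fst p) (snd p) X)) * exp (\<delta> * (D * N X))) summable_on E8n"
      by (simp only: mult_1 norm_exp_eq_Re exp_add)
  qed
  then have d: "((\<lambda>q. \<Sum>\<^sub>\<infinity>X\<in>E8n. 1 * exp (texp (fst q) (snd q) X)) has_derivative ?L) (at p within siegel_H \<times> UNIV)"
    by (rule has_derivative_at_withinI)
  have "((\<lambda>q. Theta (fst q) (snd q)) has_derivative ?L) (at p within siegel_H \<times> UNIV)"
    by (rule has_derivative_transform[OF p _ d]) (auto simp: Theta_def)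
  moreover have "?L (cmul_pair \<i> v) = \<i> * ?L v" for v
    unfolding texp_cmul_pair by (subst infsum_cmult_right'[symmetric]) (simp add: mult_ac)
  ultimately show "\<exists>L. ((\<lambda>q. Theta (fst q) (snd q)) has_derivative L) (at p within siegel_H \<times> UNIV) \<and> (\<forall>v. L (cmul_pair \<i> v) = \<i> * L v)"
    by blast
qed

section \<open>Invariance under the Heisenberg group\<close>

lemma exp_2pi_int: "exp (2 * pi * \<i> * of_int n) = 1"
  using exp_integer_2pi[of "of_int n"] by (simp add: mult_ac)

lemma e2pi_add: "e2pi (x + y) = e2pi x * e2pi y"
  by (simp add: e2pi_def ring_distribs exp_add)

lemma e2pi_of_int: "e2pi (of_int n) = 1"
  using exp_2pi_int[of n] by (simp add: e2pi_def)

text \<open>Shifting each X_i by \<open>lam $ i\<close> times the all-ones vector permutes the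
  lattice and produces the quadratic factor in \<open>lam\<close>. The shift by \<open>mu\<close>
  multiplies terms by exp of 2 pi i times an integer, because 4 divides \<open>sum8\<close>.\<close>

lemma Theta_heis:
  assumes Z: "Z \<in> siegel_H"
  shows "heis_slash 1 lam mu x Theta Z W = Theta Z W"
proof -
  define l where "l = ((\<chi> i. of_int (lam $ i)) :: complex ^ 'a)"
  define u where "u = ((\<chi> i. of_int (mu $ i)) :: complex ^ 'a)"
  have sym: "Z $ i $ j = Z $ j $ i" for i j
    using siegel_H_sym[OF Z] by (simp add: vec_eq_iff transpose_def)
  define sh where "sh X = (\<lambda>i k. X i k + lam $ i)" for X :: "'a \<Rightarrow> 8 \<Rightarrow> int"
  have bij: "bij_betw sh E8n E8n"
  proof (rule bij_betw_byWitness[where f' = "\<lambda>X i k. X i k - lam $ i"])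
    show "sh ` E8n \<subseteq> E8n"
      by (auto simp: E8n_def sh_def intro!: E8_add E8_const)
    have "(\<lambda>k. X i k + (- lam $ i)) \<in> E8" if "X \<in> E8n" for X i
      using that by (intro E8_add E8_const) (auto simp: E8n_def)
    then show "(\<lambda>X i k. X i k - lam $ i) ` E8n \<subseteq> E8n"
      by (auto simp: E8n_def)
  qed (auto simp: sh_def)
  have key: "exp (texp Z W (sh X)) = e2pi (of_nat 1 * (rowdot (l v* Z) l + 2 * rowdot l W + of_int x + rowdot u l)) * exp (texp Z (W + l v* Z + u) X)"
    if X: "X \<in> E8n" for X
  proof -
    \<comment> \<open>The 8 is the norm of the all-ones vector; with the factor pi i / 4 it gives 2
      pi i, hence index 1.\<close>
    have ips: "ip8 (sh X i) (sh X j) = ip8 (X i) (X j) + lam $ i * sum8 (X j) + lam $ j * sum8 (X i) + 8 * (lam $ i * lam $ j)" for i j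
      by (simp add: ip8_def sum8_def sh_def algebra_simps sum.distrib sum_distrib_left)
    have sms: "sum8 (sh X i) = sum8 (X i) + 8 * lam $ i" for i
      by (simp add: sum8_def sh_def sum.distrib)
    have "\<forall>i. \<exists>t. sum8 (X i) = 4 * t" using X E8_sum8 by (auto simp: E8n_def dvd_def)
    then obtain t where t: "\<And>i. sum8 (X i) = 4 * t i" by metis
    have lZ: "(l v* Z) $ j = (\<Sum>i\<in>UNIV. l $ i * Z $ i $ j)" for j
      by (simp add: vector_matrix_mult_def mult.commute)
    define P1 where "P1 = (\<Sum>i\<in>UNIV. \<Sum>j\<in>UNIV. Z $ i $ j * of_int (ip8 (X i) (X j)))"
    define P2 where "P2 = (\<Sum>i\<in>UNIV. \<Sum>j\<in>UNIV. Z $ i $ j * l $ i * of_int (sum8 (X j)))"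
    define P3 where "P3 = (\<Sum>i\<in>UNIV. \<Sum>j\<in>UNIV. Z $ i $ j * l $ i * l $ j)"
    define P4 where "P4 = (\<Sum>i\<in>UNIV. W $ i * of_int (sum8 (X i)))"
    define P5 where "P5 = (\<Sum>i\<in>UNIV. l $ i * W $ i)"
    define n1 where "n1 = x + (\<Sum>i\<in>UNIV. mu $ i * lam $ i)"
    define n2 where "n2 = (\<Sum>i\<in>UNIV. mu $ i * t i)"
    have "(\<Sum>i\<in>UNIV. \<Sum>j\<in>UNIV. Z $ i $ j * l $ j * of_int (sum8 (X i))) = P2"
      unfolding P2_def by (subst sum.swap) (simp add: sym)
    then have "(\<Sum>i\<in>UNIV. \<Sum>j\<in>UNIV. Z $ i $ j * of_int (ip8 (sh X i) (sh X j))) = P1 + 2 * P2 + 8 * P3"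
      by (simp add: ips P1_def P2_def P3_def l_def algebra_simps sum.distrib sum_distrib_left)
    moreover have "(\<Sum>i\<in>UNIV. W $ i * of_int (sum8 (sh X i))) = P4 + 8 * P5"
      by (simp add: sms P4_def P5_def l_def algebra_simps sum.distrib sum_distrib_left)
    ultimately have L: "texp Z W (sh X) = pi * \<i> / 4 * (P1 + 2 * P2 + 8 * P3 + 2 * (P4 + 8 * P5))"
      by (simp add: texp_def)
    have "(\<Sum>i\<in>UNIV. (l v* Z) $ i * of_int (sum8 (X i))) = P2"
      unfolding P2_def lZ sum_distrib_right by (subst sum.swap) (simp add: mult_ac)
    moreover have "(\<Sum>i\<in>UNIV. u $ i * of_int (sum8 (X i))) = of_int (4 * n2)"
      by (simp add: u_def t n2_def sum_distrib_left mult_ac)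
    ultimately have R1: "texp Z (W + l v* Z + u) X = pi * \<i> / 4 * (P1 + 2 * (P4 + P2 + of_int (4 * n2)))"
      by (simp add: texp_def P1_def P4_def ring_distribs sum.distrib)
    have "rowdot (l v* Z) l = P3"
      unfolding rowdot_def P3_def lZ sum_distrib_right by (subst sum.swap) (simp add: mult_ac)
    moreover have "rowdot l W = P5" by (simp add: rowdot_def P5_def)
    moreover have "of_int x + rowdot u l = of_int n1" by (simp add: n1_def rowdot_def u_def l_def)
    ultimately have R2: "of_nat 1 * (rowdot (l v* Z) l + 2 * rowdot l W + of_int x + rowdot u l) = P3 + 2 * P5 + of_int n1"
      by (simp add: add.assoc)
    have "e2pi (P3 + 2 * P5 + of_int n1) * exp (pi * \<i> / 4 * (P1 + 2 * (P4 + P2 + of_int (4 * n2)))) =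
       exp (pi * \<i> / 4 * (P1 + 2 * P2 + 8 * P3 + 2 * (P4 + 8 * P5))) * exp (2 * pi * \<i> * of_int (n1 + n2))"
      unfolding e2pi_def exp_add[symmetric] by (intro arg_cong[where f = exp]) (simp add: field_simps)
    then show ?thesis unfolding L R1 R2 exp_2pi_int by simp
  qed
  have "Theta Z W = (\<Sum>\<^sub>\<infinity>X\<in>E8n. exp (texp Z W (sh X)))"
    using Z infsum_reindex_bij_betw[OF bij, of "\<lambda>X. exp (texp Z W X)"] by (simp add: Theta_def)
  also have "\<dots> = (\<Sum>\<^sub>\<infinity>X\<in>E8n. e2pi (of_nat 1 * (rowdot (l v* Z) l + 2 * rowdot l W + of_int x + rowdot u l)) * exp (texp Z (W + l v* Z + u) X))"
    by (rule infsum_cong) (rule key)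
  also have "\<dots> = e2pi (of_nat 1 * (rowdot (l v* Z) l + 2 * rowdot l W + of_int x + rowdot u l)) * Theta Z (W + l v* Z + u)"
    using Z by (simp only: Theta_def if_True infsum_cmult_right')
  finally show ?thesis by (simp only: heis_slash_def Let_def l_def u_def)
qed

section \<open>Modular invariance, by generators\<close>

lemma symmetric_sum_even:
  fixes f :: "'g::finite \<Rightarrow> 'g \<Rightarrow> int"
  assumes "\<And>i j. f i j = f j i" and "\<And>i. even (f i i)" and "finite A"
  shows "even (\<Sum>i\<in>A. \<Sum>j\<in>A. f i j)"
  using assms(3)
proof (induction A rule: finite_induct)
  case (insert a A)
  have "(\<Sum>i\<in>insert a A. \<Sum>j\<in>insert a A. f i j) = f a a + 2 * (\<Sum>j\<in>A. f a j) + (\<Sum>i\<in>A. \<Sum>j\<in>A. f i j)"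
  proof -
    have "(\<Sum>i\<in>A. f i a) = (\<Sum>j\<in>A. f a j)" by (rule sum.cong[OF refl assms(1)])
    then show ?thesis using insert.hyps by (simp add: sum.distrib)
  qed
  then show ?case using insert.IH assms(2) by simp
qed simp

text \<open>Off-diagonal entries of S occur twice and diagonal Gram entries are even, so the trace
  of S against the Gram matrix is an even integer and the exponent changes by a multiple of 2 pi
  i.\<close>

lemma Theta_translate:
  assumes Z: "Z \<in> siegel_H" "Z + (\<chi> i j. of_int (S $ i $ j)) \<in> siegel_H" and S: "transpose S = S"
  shows "Theta (Z + (\<chi> i j. of_int (S $ i $ j))) W = Theta Z W"
proof -
  have "exp (texp (Z + (\<chi> i j. of_int (S $ i $ j))) W X) = exp (texp Z W X)" if X: "X \<in> E8n" for X
  proof -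
    have "\<forall>i j. \<exists>b. ip8 (X i) (X j) = 4 * b" using X E8_ip8 by (auto simp: E8n_def dvd_def)
    then obtain b where b: "\<And>i j. ip8 (X i) (X j) = 4 * b i j" by metis
    have bev: "even (b i i)" for i
    proof -
      have "8 dvd ip8 (X i) (X i)" using X E8_norm by (auto simp: E8n_def)
      then show ?thesis unfolding b by presburger
    qed
    have bS: "S $ i $ j * b i j = S $ j $ i * b j i" for i j
    proof -
      have "b i j = b j i" using b[of i j] b[of j i] ip8_commute[of "X i" "X j"] by simp
      moreover have "S $ i $ j = S $ j $ i" using S by (simp add: vec_eq_iff transpose_def)
      ultimately show ?thesis by simp
    qed
    have "even (\<Sum>i\<in>UNIV. \<Sum>j\<in>UNIV. S $ i $ j * b i j)"
      by (rule symmetric_sum_even[of "\<lambda>i j. S $ i $ j * b i j"]) (rule bS, simp_all add: bev)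
    then obtain n where n: "(\<Sum>i\<in>UNIV. \<Sum>j\<in>UNIV. S $ i $ j * b i j) = 2 * n" by (elim evenE)
    have "(\<Sum>i\<in>UNIV. \<Sum>j\<in>UNIV. of_int (S $ i $ j) * of_int (ip8 (X i) (X j))) = complex_of_int (4 * (\<Sum>i\<in>UNIV. \<Sum>j\<in>UNIV. S $ i $ j * b i j))"
      by (simp add: b sum_distrib_left mult_ac)
    then have "texp (Z + (\<chi> i j. of_int (S $ i $ j))) W X = texp Z W X + 2 * pi * \<i> * of_int n"
      unfolding n by (simp add: texp_def ring_distribs sum.distrib)
    then show ?thesis by (simp only: exp_add exp_2pi_int mult_1_right)
  qed
  then show ?thesis using Z by (simp add: Theta_def cong: infsum_cong)
qed

lemma blk_tmat: "blkA (tmat S) = mat 1" "blkB (tmat S) = (\<chi> i j. of_int (S $ i $ j))" "blkC (tmat S) = 0" "blkD (tmat S) = mat 1"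
  by (simp_all add: vec_eq_iff blkA_def blkB_def blkC_def blkD_def tmat_def mat_def)

lemma slash_tmat: "slash k m (tmat S) \<phi> Z W = \<phi> (Z + (\<chi> i j. of_int (S $ i $ j))) W"
proof -
  have 1: "autf (tmat S) Z = mat 1" "numf (tmat S) Z = Z + (\<chi> i j. of_int (S $ i $ j))"
    by (simp_all add: autf_def numf_def blk_tmat)
  have 2: "matrix_inv (mat 1 :: complex ^ 'a ^ 'a) = mat 1" by (rule matrix_inv_unique) auto
  have 3: "rowdot x ((0 :: complex ^ 'a ^ 'a) *v y) = 0" for x y :: "complex ^ 'a" by (simp add: rowdot_def)
  show ?thesis unfolding slash_altdef mact_def 1 2 blk_tmat 3 by simp
qed

text \<open>Isolates the dependence on the i-th lattice vector: a rank 8 theta exponent with modulus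
  Z_ii, whose elliptic argument collects W_i and the other vectors.\<close>

lemma texp_fun_upd:
  fixes Z :: "complex ^ 'g::finite ^ 'g"
  assumes Z: "transpose Z = Z" and r: "r i = (\<lambda>k. 0)"
  shows "texp Z W (r(i := x)) = texp Z W r + pi * \<i> / 4 * (Z $ i $ i * (\<Sum>k\<in>UNIV. (of_int (x k))^2)
     + 2 * (\<Sum>k\<in>UNIV. of_int (x k) * (W $ i + (\<Sum>l\<in>UNIV. Z $ i $ l * of_int (r l k)))))"
proof -
  have sym: "Z $ j $ l = Z $ l $ j" for j l using Z by (simp add: vec_eq_iff transpose_def)
  have r0: "ip8 (r i) y = 0" "ip8 y (r i) = 0" "sum8 (r i) = 0" for y
    by (simp_all add: r ip8_def sum8_def)
  define d :: "'g \<Rightarrow> complex" where "d j = (if j = i then 1 else 0)" for j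
  have ip: "of_int (ip8 ((r(i := x)) j) ((r(i := x)) l)) = of_int (ip8 (r j) (r l)) + d j * of_int (ip8 x (r l)) + d l * of_int (ip8 x (r j)) + d j * d l * of_int (ip8 x x)" for j l
    by (auto simp: d_def r0 ip8_commute)
  have sm: "of_int (sum8 ((r(i := x)) j)) = of_int (sum8 (r j)) + d j * of_int (sum8 x)" for j
    by (auto simp: d_def r0)
  have dsum: "(\<Sum>j\<in>UNIV. d j * h j) = h i" for h :: "'g \<Rightarrow> complex"
    by (simp add: d_def mult_delta_left)
  have A2: "(\<Sum>j\<in>UNIV. \<Sum>l\<in>UNIV. Z $ j $ l * (d j * of_int (ip8 x (r l)))) = (\<Sum>l\<in>UNIV. Z $ i $ l * of_int (ip8 x (r l)))"
  proof -
    have "(\<Sum>j\<in>UNIV. \<Sum>l\<in>UNIV. Z $ j $ l * (d j * of_int (ip8 x (r l)))) = (\<Sum>j\<in>UNIV. d j * (\<Sum>l\<in>UNIV. Z $ j $ l * of_int (ip8 x (r l))))"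
      by (simp add: sum_distrib_left mult_ac)
    then show ?thesis by (simp only: dsum)
  qed
  have A3: "(\<Sum>j\<in>UNIV. \<Sum>l\<in>UNIV. Z $ j $ l * (d l * of_int (ip8 x (r j)))) = (\<Sum>l\<in>UNIV. Z $ i $ l * of_int (ip8 x (r l)))"
    unfolding A2[symmetric] by (subst sum.swap) (simp add: sym)
  have A4: "(\<Sum>j\<in>UNIV. \<Sum>l\<in>UNIV. Z $ j $ l * (d j * d l * of_int (ip8 x x))) = Z $ i $ i * of_int (ip8 x x)"
  proof -
    have "(\<Sum>j\<in>UNIV. \<Sum>l\<in>UNIV. Z $ j $ l * (d j * d l * of_int (ip8 x x))) = (\<Sum>j\<in>UNIV. d j * (\<Sum>l\<in>UNIV. d l * (Z $ j $ l * of_int (ip8 x x))))"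
      by (simp add: sum_distrib_left mult_ac)
    then show ?thesis by (simp only: dsum)
  qed
  have B2: "(\<Sum>j\<in>UNIV. W $ j * (d j * of_int (sum8 x))) = W $ i * of_int (sum8 x)"
  proof -
    have "(\<Sum>j\<in>UNIV. W $ j * (d j * of_int (sum8 x))) = (\<Sum>j\<in>UNIV. d j * (W $ j * of_int (sum8 x)))"
      by (simp add: mult_ac)
    then show ?thesis by (simp only: dsum)
  qed
  have E: "(\<Sum>k\<in>UNIV. of_int (x k) * (W $ i + (\<Sum>l\<in>UNIV. Z $ i $ l * of_int (r l k)))) = W $ i * of_int (sum8 x) + (\<Sum>l\<in>UNIV. Z $ i $ l * of_int (ip8 x (r l)))"
  proof -
    have "(\<Sum>k\<in>UNIV. of_int (x k) * (\<Sum>l\<in>UNIV. Z $ i $ l * of_int (r l k))) = (\<Sum>k\<in>UNIV. \<Sum>l\<in>UNIV. Z $ i $ l * (of_int (x k) * of_int (r l k)))"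
      by (simp add: sum_distrib_left mult_ac)
    also have "\<dots> = (\<Sum>l\<in>UNIV. Z $ i $ l * of_int (ip8 x (r l)))"
      by (subst sum.swap) (simp add: ip8_def sum_distrib_left)
    finally show ?thesis by (simp add: ring_distribs sum.distrib sum8_def sum_distrib_left mult.commute)
  qed
  have S: "(\<Sum>k\<in>UNIV. (of_int (x k))^2) = (of_int (ip8 x x) :: complex)"
    by (simp add: ip8_def power2_eq_square)
  show ?thesis
    unfolding texp_def E S unfolding ip sm ring_distribs(1) sum.distrib A2 A3 A4 B2 by (simp add: algebra_simps)
qed

definition resti :: "'g \<Rightarrow> ('g::finite \<Rightarrow> 8 \<Rightarrow> int) set" where
  "resti i = {X. X i = (\<lambda>k. 0) \<and> (\<forall>j. X j \<in> E8)}"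

lemma bij_betw_resti: "bij_betw (\<lambda>(r, x). r(i := x)) (resti i \<times> E8) E8n"
  by (rule bij_betw_byWitness[where f' = "\<lambda>X. (X(i := (\<lambda>k. 0)), X i)"])
     (auto simp: resti_def E8n_def E8_zero fun_eq_iff)

lemma Theta_split:
  fixes Z :: "complex ^ 'g::finite ^ 'g"
  assumes Z: "Z \<in> siegel_H"
  shows "Theta Z W = (\<Sum>\<^sub>\<infinity>r\<in>resti i. \<Sum>\<^sub>\<infinity>x\<in>E8. exp (texp Z W (r(i := x))))"
proof -
  let ?h = "\<lambda>(r, x). r(i := x)"
  have "(\<lambda>p. exp (texp Z W (?h p))) summable_on (resti i \<times> E8)"
    using summable_on_reindex_bij_betw[OF bij_betw_resti[of i], of "\<lambda>X. exp (texp Z W X)"] Theta_summable[OF Z] by blast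
  from infsum_Sigma_banach[OF this]
  have "(\<Sum>\<^sub>\<infinity>r\<in>resti i. \<Sum>\<^sub>\<infinity>x\<in>E8. exp (texp Z W (r(i := x)))) = (\<Sum>\<^sub>\<infinity>p\<in>resti i \<times> E8. exp (texp Z W (?h p)))"
    by simp
  also have "\<dots> = (\<Sum>\<^sub>\<infinity>X\<in>E8n. exp (texp Z W X))"
    by (rule infsum_reindex_bij_betw[OF bij_betw_resti])
  finally show ?thesis using Z by (simp add: Theta_def)
qed

lemma siegel_H_diag:
  assumes "Z \<in> siegel_H"
  shows "Im (Z $ i $ i) > 0"
proof -
  have "axis i (1::real) \<noteq> 0" by (simp add: axis_eq_0_iff)
  then have "0 < (\<Sum>j\<in>UNIV. \<Sum>l\<in>UNIV. axis i (1::real) $ j * Im (Z $ j $ l) * axis i 1 $ l)"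
    using assms by (auto simp: siegel_H_def)
  also have "\<dots> = (\<Sum>j\<in>UNIV. if j = i then Im (Z $ i $ i) else 0)"
    by (intro sum.cong refl) (simp add: axis_def mult_delta_right mult_delta_left)
  finally show ?thesis by simp
qed

lemma blk_jmat:
  "blkA (jmat i) = (\<chi> j l. if j = l \<and> j \<noteq> i then 1 else 0)" "blkB (jmat i) = (\<chi> j l. if j = l \<and> j = i then 1 else 0)"
  "blkC (jmat i) = (\<chi> j l. if j = l \<and> j = i then -1 else 0)" "blkD (jmat i) = (\<chi> j l. if j = l \<and> j \<noteq> i then 1 else 0)"
  by (auto simp: vec_eq_iff blkA_def blkB_def blkC_def blkD_def jmat_def)

lemma sum_single: "(\<Sum>m\<in>(UNIV::'g::finite set). (if j = m \<and> P then c else 0) * f m) = (if P then c * f j else (0::complex))"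
  by (cases P) (simp_all add: mult_delta_left)

lemma autf_jmat: "autf (jmat i) Z = (\<chi> j l. if j = i then - Z $ i $ l else if j = l then 1 else 0)"
  by (auto simp: vec_eq_iff autf_def blk_jmat matrix_matrix_mult_def sum_single)

lemma numf_jmat: "numf (jmat i) Z = (\<chi> j l. if j = i then (if l = i then 1 else 0) else Z $ j $ l)"
  by (auto simp: vec_eq_iff numf_def blk_jmat matrix_matrix_mult_def sum_single)

text \<open>Explicit inverse of C Z + D for \<open>jmat i\<close>.\<close>

definition ninv :: "'g \<Rightarrow> complex ^ 'g::finite ^ 'g \<Rightarrow> complex ^ 'g ^ 'g" where
  "ninv i Z = (\<chi> j l. if j = i then (if l = i then -1 / Z $ i $ i else - Z $ i $ l / Z $ i $ i) else if j = l then 1 else 0)"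

lemma sum_ninv: "(\<Sum>m\<in>UNIV. f m * ninv i Z $ m $ l) = f i * ninv i Z $ i $ l + (if l = i then 0 else f l)"
proof -
  have "(\<Sum>m\<in>UNIV. f m * ninv i Z $ m $ l) = f i * ninv i Z $ i $ l + (\<Sum>m\<in>UNIV - {i}. f m * ninv i Z $ m $ l)"
    by (rule sum.remove) auto
  also have "(\<Sum>m\<in>UNIV - {i}. f m * ninv i Z $ m $ l) = (\<Sum>m\<in>UNIV - {i}. if m = l then f l else 0)"
    by (intro sum.cong refl) (auto simp: ninv_def)
  finally show ?thesis by simp
qed

lemma matrix_inv_autf_jmat:
  assumes "Z $ i $ i \<noteq> 0"
  shows "matrix_inv (autf (jmat i) Z) = ninv i Z"
proof -
  have "autf (jmat i) Z ** ninv i Z = mat 1"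
    unfolding vec_eq_iff matrix_matrix_mult_def
    by (simp add: sum_ninv) (auto simp: autf_jmat ninv_def mat_def assms field_simps)
  then show ?thesis using matrix_left_right_inverse matrix_inv_unique by blast
qed

text \<open>C Z + D is the identity with row i replaced, so Cramer's rule reads off its
  determinant.\<close>

lemma det_autf_jmat: "det (autf (jmat i) Z) = - Z $ i $ i"
proof -
  define x where "x = (\<chi> l. - Z $ i $ l)"
  have "(\<Sum>l\<in>UNIV. x $ l *s row l (mat 1)) = x"
    by (simp add: vec_eq_iff row_def mat_def mult_delta_right)
  then have "autf (jmat i) Z = (\<chi> j. if j = i then (\<Sum>l\<in>UNIV. x $ l *s row l (mat 1)) else row j (mat 1))"
    by (auto simp: vec_eq_iff autf_jmat row_def mat_def x_def)
  then show ?thesis using cramer_lemma_transpose[where x = x and k = i and A = "mat 1"] by (simp add: x_def)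
qed

text \<open>With the other lattice vectors fixed, the sum over the i-th is the \<open>E8\<close>
  inversion at \<tau> = Z_ii. The factor \<tau>^4 cancels the fourth power of the determinant
  -\<tau>, and exp (2 pi i W_i^2 / \<tau>) cancels the exponential factor of index 1.\<close>

lemma slash_jmat_Theta:
  fixes Z :: "complex ^ 'g::finite ^ 'g"
  assumes Z: "Z \<in> siegel_H" and Z': "mact (jmat i) Z \<in> siegel_H"
  shows "slash 4 1 (jmat i) Theta Z W = Theta Z W"
proof -
  define \<tau> where "\<tau> = Z $ i $ i"
  have \<tau>: "Im \<tau> > 0" unfolding \<tau>_def by (rule siegel_H_diag[OF Z])
  then have nz: "\<tau> \<noteq> 0" "Z $ i $ i \<noteq> 0" by (auto simp: \<tau>_def)
  have sym: "Z $ j $ l = Z $ l $ j" for j l using siegel_H_sym[OF Z] by (simp add: vec_eq_iff transpose_def)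
  define Z' where "Z' = mact (jmat i) Z"
  define W' where "W' = W v* ninv i Z"
  have inv: "matrix_inv (autf (jmat i) Z) = ninv i Z" by (rule matrix_inv_autf_jmat[OF nz(2)])
  have Z'nth: "Z' $ j $ l = numf (jmat i) Z $ j $ i * ninv i Z $ i $ l + (if l = i then 0 else numf (jmat i) Z $ j $ l)" for j l
    unfolding Z'_def mact_def inv by (simp add: matrix_matrix_mult_def sum_ninv)
  have Zii: "Z' $ i $ i = -1 / \<tau>" unfolding Z'nth by (simp add: numf_jmat ninv_def \<tau>_def)
  have Zil: "Z' $ i $ l = - Z $ i $ l / \<tau>" if "l \<noteq> i" for l unfolding Z'nth using that by (simp add: numf_jmat ninv_def \<tau>_def)
  have Zjl: "Z' $ j $ l = Z $ j $ l - Z $ i $ j * Z $ i $ l / \<tau>" if "j \<noteq> i" "l \<noteq> i" for j l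
    unfolding Z'nth using that by (simp add: numf_jmat ninv_def \<tau>_def sym[of j i])
  have W'nth: "W' $ l = W $ i * ninv i Z $ i $ l + (if l = i then 0 else W $ l)" for l
    unfolding W'_def vector_matrix_mult_def by (simp add: sum_ninv[of "\<lambda>m. W $ m"] mult.commute[of "ninv i Z $ _ $ _" "W $ _"])
  have Wi: "W' $ i = - W $ i / \<tau>" unfolding W'nth by (simp add: ninv_def \<tau>_def)
  have Wl: "W' $ l = W $ l - W $ i * Z $ i $ l / \<tau>" if "l \<noteq> i" for l unfolding W'nth using that by (simp add: ninv_def \<tau>_def)
  have ex: "rowdot W' (blkC (jmat i) *v W) = (W $ i)^2 / \<tau>"
  proof -
    have "(blkC (jmat i) *v W) $ j = (if j = i then - W $ i else 0)" for j
      by (simp add: matrix_vector_mult_def blk_jmat sum_single)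
    then have "rowdot W' (blkC (jmat i) *v W) = (\<Sum>j\<in>UNIV. if j = i then W' $ i * - W $ i else 0)"
      unfolding rowdot_def by (intro sum.cong refl) simp
    then show ?thesis by (simp add: Wi power2_eq_square)
  qed
  define u where "u r k = W $ i + (\<Sum>l\<in>UNIV. Z $ i $ l * of_int (r l k))" for r :: "'g \<Rightarrow> 8 \<Rightarrow> int" and k
  \<comment> \<open>Away from index i the point Z' is the Schur complement of Z_ii in Z. Its
    correction terms assemble into the squares of \<open>u r k\<close>, apart from W_i^2, which
    occurs once in each of the eight coordinates.\<close>
  have texpr: "texp Z' W' r = texp Z W r - pi * \<i> / 4 * ((\<Sum>k\<in>UNIV. (u r k)^2) - 8 * (W $ i)^2) / \<tau>" if r: "r i = (\<lambda>k. 0)" for r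
  proof -
    have r0: "ip8 (r i) y = 0" "ip8 y (r i) = 0" "sum8 (r i) = 0" for y
      by (simp_all add: r ip8_def sum8_def)
    define v where "v k = (\<Sum>l\<in>UNIV. Z $ i $ l * of_int (r l k))" for k
    have vv: "(\<Sum>k\<in>UNIV. (v k)^2) = (\<Sum>j\<in>UNIV. \<Sum>l\<in>UNIV. Z $ i $ j * Z $ i $ l * of_int (ip8 (r j) (r l)))"
    proof -
      have "(\<Sum>k\<in>UNIV. (v k)^2) = (\<Sum>k\<in>UNIV. \<Sum>j\<in>UNIV. \<Sum>l\<in>UNIV. Z $ i $ j * Z $ i $ l * (of_int (r j k) * of_int (r l k)))"
        by (simp add: v_def power2_eq_square sum_product mult_ac)
      also have "\<dots> = (\<Sum>j\<in>UNIV. \<Sum>l\<in>UNIV. \<Sum>k\<in>UNIV. Z $ i $ j * Z $ i $ l * (of_int (r j k) * of_int (r l k)))"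
        by (subst sum.swap, subst (2) sum.swap) (rule refl)
      finally show ?thesis by (simp add: ip8_def sum_distrib_left)
    qed
    have v1: "(\<Sum>k\<in>UNIV. v k) = (\<Sum>l\<in>UNIV. Z $ i $ l * of_int (sum8 (r l)))"
      unfolding v_def by (subst sum.swap) (simp add: sum8_def sum_distrib_left)
    have uu: "(\<Sum>k\<in>UNIV. (u r k)^2) = 8 * (W $ i)^2 + 2 * W $ i * (\<Sum>k\<in>UNIV. v k) + (\<Sum>k\<in>UNIV. (v k)^2)"
      by (simp add: u_def v_def[symmetric] power2_sum sum.distrib sum_distrib_left)
    have "(\<Sum>j\<in>UNIV. \<Sum>l\<in>UNIV. Z' $ j $ l * of_int (ip8 (r j) (r l))) = (\<Sum>j\<in>UNIV. \<Sum>l\<in>UNIV. Z $ j $ l * of_int (ip8 (r j) (r l)) - Z $ i $ j * Z $ i $ l * of_int (ip8 (r j) (r l)) / \<tau>)"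
    proof (intro sum.cong refl)
      fix j l
      show "Z' $ j $ l * of_int (ip8 (r j) (r l)) = Z $ j $ l * of_int (ip8 (r j) (r l)) - Z $ i $ j * Z $ i $ l * of_int (ip8 (r j) (r l)) / \<tau>"
        by (cases "j = i"; cases "l = i") (simp_all add: r0 Zjl algebra_simps)
    qed
    also have "\<dots> = (\<Sum>j\<in>UNIV. \<Sum>l\<in>UNIV. Z $ j $ l * of_int (ip8 (r j) (r l))) - (\<Sum>k\<in>UNIV. (v k)^2) / \<tau>"
      unfolding vv by (simp add: sum_subtractf sum_divide_distrib)
    finally have 1: "(\<Sum>j\<in>UNIV. \<Sum>l\<in>UNIV. Z' $ j $ l * of_int (ip8 (r j) (r l))) = (\<Sum>j\<in>UNIV. \<Sum>l\<in>UNIV. Z $ j $ l * of_int (ip8 (r j) (r l))) - (\<Sum>k\<in>UNIV. (v k)^2) / \<tau>" .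
    have "(\<Sum>j\<in>UNIV. W' $ j * of_int (sum8 (r j))) = (\<Sum>j\<in>UNIV. W $ j * of_int (sum8 (r j)) - W $ i * (Z $ i $ j * of_int (sum8 (r j))) / \<tau>)"
    proof (intro sum.cong refl)
      fix j
      show "W' $ j * of_int (sum8 (r j)) = W $ j * of_int (sum8 (r j)) - W $ i * (Z $ i $ j * of_int (sum8 (r j))) / \<tau>"
        by (cases "j = i") (simp_all add: r0 Wl algebra_simps)
    qed
    also have "\<dots> = (\<Sum>j\<in>UNIV. W $ j * of_int (sum8 (r j))) - W $ i * (\<Sum>k\<in>UNIV. v k) / \<tau>"
      unfolding v1 by (simp add: sum_subtractf sum_divide_distrib sum_distrib_left)
    finally have 2: "(\<Sum>j\<in>UNIV. W' $ j * of_int (sum8 (r j))) = (\<Sum>j\<in>UNIV. W $ j * of_int (sum8 (r j))) - W $ i * (\<Sum>k\<in>UNIV. v k) / \<tau>" .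
    show ?thesis unfolding texp_def 1 2 uu using nz by (simp add: field_simps)
  qed
  have inner: "(\<Sum>\<^sub>\<infinity>x\<in>E8. exp (texp Z' W' (r(i := x)))) = exp (2 * pi * \<i> * (W $ i)^2 / \<tau>) * \<tau>^4 * (\<Sum>\<^sub>\<infinity>x\<in>E8. exp (texp Z W (r(i := x))))"
    if "r \<in> resti i" for r
  proof -
    have r: "r i = (\<lambda>k. 0)" using that by (simp add: resti_def)
    have rl: "Z' $ i $ l * of_int (r l k) = - (Z $ i $ l * of_int (r l k)) / \<tau>" for l k
      using r Zil[of l] by (cases "l = i") simp_all
    have L: "exp (texp Z' W' (r(i := x))) = exp (texp Z W r + 2 * pi * \<i> * (W $ i)^2 / \<tau>) * exp (- (pi * \<i> / 4) * (\<Sum>k\<in>UNIV. (of_int (x k) + u r k)^2) / \<tau>)" for x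
    proof -
      have "W' $ i + (\<Sum>l\<in>UNIV. Z' $ i $ l * of_int (r l k)) = - u r k / \<tau>" for k
      proof -
        have "(\<Sum>l\<in>UNIV. - (Z $ i $ l * of_int (r l k)) / \<tau>) = - (\<Sum>l\<in>UNIV. Z $ i $ l * of_int (r l k)) / \<tau>"
          by (simp add: sum_negf sum_divide_distrib)
        then show ?thesis unfolding rl Wi u_def by (simp add: diff_divide_distrib)
      qed
      then have "texp Z' W' (r(i := x)) = texp Z' W' r + pi * \<i> / 4 * (-1 / \<tau> * (\<Sum>k\<in>UNIV. (of_int (x k))^2) + 2 * (\<Sum>k\<in>UNIV. of_int (x k) * (- u r k / \<tau>)))"
        using texp_fun_upd[where r = r and i = i, OF siegel_H_sym[OF Z'[folded Z'_def]] r, of W' x] by (simp only: Zii)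
      also have "(\<Sum>k\<in>UNIV. of_int (x k) * (- u r k / \<tau>)) = - (\<Sum>k\<in>UNIV. of_int (x k) * u r k) / \<tau>"
        by (simp add: sum_negf sum_divide_distrib)
      finally have a: "texp Z' W' (r(i := x)) = texp Z' W' r + pi * \<i> / 4 * (-1 / \<tau> * (\<Sum>k\<in>UNIV. (of_int (x k))^2) + 2 * (- (\<Sum>k\<in>UNIV. of_int (x k) * u r k) / \<tau>))" .
      have b: "(\<Sum>k\<in>UNIV. (of_int (x k) + u r k)^2) = (\<Sum>k\<in>UNIV. (of_int (x k))^2) + 2 * (\<Sum>k\<in>UNIV. of_int (x k) * u r k) + (\<Sum>k\<in>UNIV. (u r k)^2)"
        by (simp add: power2_sum sum.distrib sum_distrib_left mult.assoc)
      show ?thesis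
        unfolding exp_add[symmetric] a b texpr[of r, OF r] using nz by (intro arg_cong[where f = exp]) (simp add: field_simps)
    qed
    have R: "exp (texp Z W (r(i := x))) = exp (texp Z W r) * exp (pi * \<i> / 4 * (\<tau> * (\<Sum>k\<in>UNIV. (of_int (x k))^2) + 2 * (\<Sum>k\<in>UNIV. of_int (x k) * u r k)))" for x
      unfolding exp_add[symmetric] texp_fun_upd[where r = r and i = i, OF siegel_H_sym[OF Z] r] u_def \<tau>_def by (rule refl)
    show ?thesis
      unfolding L R infsum_cmult_right' E8_theta_transformation[OF \<tau>] by (simp add: exp_add)
  qed
  have "Theta Z' W' = exp (2 * pi * \<i> * (W $ i)^2 / \<tau>) * \<tau>^4 * Theta Z W"
  proof -
    have "Theta Z' W' = (\<Sum>\<^sub>\<infinity>r\<in>resti i. \<Sum>\<^sub>\<infinity>x\<in>E8. exp (texp Z' W' (r(i := x))))"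
      by (rule Theta_split) (use Z' in \<open>simp add: Z'_def\<close>)
    also have "\<dots> = (\<Sum>\<^sub>\<infinity>r\<in>resti i. exp (2 * pi * \<i> * (W $ i)^2 / \<tau>) * \<tau>^4 * (\<Sum>\<^sub>\<infinity>x\<in>E8. exp (texp Z W (r(i := x)))))"
      by (rule infsum_cong) (rule inner)
    also have "\<dots> = exp (2 * pi * \<i> * (W $ i)^2 / \<tau>) * \<tau>^4 * Theta Z W"
      unfolding infsum_cmult_right' Theta_split[OF Z, of W i] by (rule refl)
    finally show ?thesis .
  qed
  moreover have "det (autf (jmat i) Z) powi (- 4) = inverse (\<tau>^4)"
    by (simp add: det_autf_jmat \<tau>_def power_int_minus)
  moreover have "exp (- 2 * of_real pi * \<i> * of_nat 1 * ((W $ i)^2 / \<tau>)) * exp (2 * pi * \<i> * (W $ i)^2 / \<tau>) = 1"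
    by (simp flip: exp_add)
  ultimately show ?thesis
    unfolding slash_altdef inv W'_def[symmetric] Z'_def[symmetric] ex using nz
    by (simp add: mult_ac)
qed

text \<open>Invariance under a generator g and under g M gives invariance under M by the composition
  rule; the identity is itself a generator, the translation by 0.\<close>

theorem slash_Theta:
  fixes M :: "int ^ ('g::finite + 'g) ^ ('g + 'g)"
  assumes M: "M \<in> Sp_Z" and Z: "Z \<in> siegel_H"
  shows "slash 4 1 M Theta Z W = Theta Z W"
proof -
  have gen: "slash 4 1 g Theta Z W = Theta Z W" if g: "g \<in> gensT {}" and Z: "Z \<in> siegel_H" for g :: "int ^ ('g + 'g) ^ ('g + 'g)" and Z W
  proof -
    note H = mact_siegel_H[OF gensT_Sp_Z[OF g] Z]
    from g consider (t) S where "g = tmat S" "transpose S = S" | (j) i where "g = jmat i"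
      unfolding gensT_def by blast
    then show ?thesis
    proof cases
      case t
      have "mact g Z = Z + (\<chi> i j. of_int (S $ i $ j))"
      proof -
        have 1: "autf (tmat S) Z = mat 1" "numf (tmat S) Z = Z + (\<chi> i j. of_int (S $ i $ j))"
          by (simp_all add: autf_def numf_def blk_tmat)
        have "matrix_inv (mat 1 :: complex ^ 'g ^ 'g) = mat 1" by (rule matrix_inv_unique) auto
        then show ?thesis by (simp add: t(1) mact_def 1)
      qed
      then show ?thesis using H Theta_translate[OF Z _ t(2)] by (simp add: t(1) slash_tmat)
    next
      case j
      then show ?thesis using H slash_jmat_Theta[OF Z] by simp
    qed
  qed
  have "\<forall>Z\<in>siegel_H. \<forall>W. slash 4 1 M Theta Z W = Theta Z W"
    using M
  proof (rule Sp_Z_generated[rotated 2])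
    have "tmat 0 = (mat 1 :: int ^ ('g + 'g) ^ ('g + 'g))"
      by (auto simp: tmat_def mat_def vec_eq_iff split: sum.split)
    then have "mat 1 \<in> (gensT {} :: (int ^ ('g + 'g) ^ ('g + 'g)) set)"
      unfolding gensT_def by (auto simp: transpose_def vec_eq_iff intro!: exI[of _ 0])
    then show "\<forall>Z\<in>siegel_H. \<forall>W. slash 4 1 (mat 1) Theta Z W = (Theta :: complex ^ 'g ^ 'g \<Rightarrow> _) Z W"
      using gen by blast
  next
    fix g M :: "int ^ ('g + 'g) ^ ('g + 'g)"
    assume g: "g \<in> gensT {}" and M: "M \<in> Sp_Z" and gM: "\<forall>Z\<in>siegel_H. \<forall>W. slash 4 1 (g ** M) Theta Z W = Theta Z W"
    show "\<forall>Z\<in>siegel_H. \<forall>W. slash 4 1 M Theta Z W = Theta Z W"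
    proof (intro ballI allI)
      fix Z :: "complex ^ 'g ^ 'g" and W assume Z: "Z \<in> siegel_H"
      have "Theta Z W = slash 4 1 M (slash 4 1 g Theta) Z W"
        using gM Z slash_mult[OF gensT_Sp_Z[OF g] M Z, of 4 1 Theta W] by simp
      also have "\<dots> = slash 4 1 M Theta Z W"
        unfolding slash_altdef[of _ _ M] gen[OF g mact_siegel_H[OF M Z]] by (rule refl)
      finally show "slash 4 1 M Theta Z W = Theta Z W" by simp
    qed
  qed
  then show ?thesis using Z by blast
qed

section \<open>Fourier expansions and products of forms\<close>

definition fterm :: "real ^ 'g ^ 'g \<Rightarrow> real ^ 'g \<Rightarrow> complex ^ 'g::finite ^ 'g \<Rightarrow> complex ^ 'g \<Rightarrow> complex" where
  "fterm T R Z W = e2pi (\<Sum>i\<in>UNIV. \<Sum>j\<in>UNIV. of_real (T $ i $ j) * Z $ j $ i) * e2pi (\<Sum>i\<in>UNIV. W $ i * of_real (R $ i))"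

text \<open>An expansion with \<lambda> = 1 and prescribed coefficients. Invariance under the full
  group makes this one expansion valid for all transforms of the form.\<close>

definition fourier_coeffs :: "(real ^ 'g ^ 'g \<Rightarrow> real ^ 'g \<Rightarrow> complex) \<Rightarrow> nat \<Rightarrow> (complex ^ 'g ^ 'g \<Rightarrow> complex ^ 'g::finite \<Rightarrow> complex) \<Rightarrow> bool" where
  "fourier_coeffs c m \<psi> \<longleftrightarrow> (\<forall>Z\<in>siegel_H. \<forall>W. ((\<lambda>(T, R). c T R * fterm T R Z W) has_sum \<psi> Z W) fourier_index)
     \<and> (\<forall>T R. (T, R) \<in> fourier_index \<longrightarrow> c T R \<noteq> 0 \<longrightarrow> block_psd 1 m T R)"

lemma fourier_coeffsD:
  assumes "fourier_coeffs c m \<psi>"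
  shows "Z \<in> siegel_H \<Longrightarrow> ((\<lambda>(T, R). c T R * fterm T R Z W) has_sum \<psi> Z W) fourier_index"
    and "(T, R) \<in> fourier_index \<Longrightarrow> c T R \<noteq> 0 \<Longrightarrow> block_psd 1 m T R"
  using assms unfolding fourier_coeffs_def by blast+

definition fourier_nice :: "nat \<Rightarrow> (complex ^ 'g ^ 'g \<Rightarrow> complex ^ 'g::finite \<Rightarrow> complex) \<Rightarrow> bool" where
  "fourier_nice m \<psi> \<longleftrightarrow> (\<exists>c. fourier_coeffs c m \<psi>)"

text \<open>Series arise indexed by lattice vectors or by pairs of indices; terms with the same (T,
  R) are collected. On a fibre the exponential is constant, so the collected coefficient does not
  depend on Z and W, and if it is nonzero some term of the fibre has a nonzero coefficient.\<close>

lemma fourier_niceI: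
  fixes T :: "'i \<Rightarrow> real ^ 'g ^ 'g::finite"
  assumes sums: "\<And>Z W. Z \<in> siegel_H \<Longrightarrow> ((\<lambda>i. a i * fterm (T i) (R i) Z W) has_sum \<psi> Z W) I"
    and idx: "\<And>i. i \<in> I \<Longrightarrow> (T i, R i) \<in> fourier_index"
    and psd: "\<And>i. i \<in> I \<Longrightarrow> a i \<noteq> 0 \<Longrightarrow> block_psd 1 m (T i) (R i)"
  shows "fourier_nice m \<psi>"
proof -
  define fib where "fib p = {i \<in> I. (T i, R i) = p}" for p
  define c where "c T' R' = infsum a (fib (T', R'))" for T' R'
  have "((\<lambda>(T', R'). c T' R' * fterm T' R' Z W) has_sum \<psi> Z W) fourier_index" if Z: "Z \<in> siegel_H" for Z W
  proof -
    let ?h = "\<lambda>i. a i * fterm (T i) (R i) Z W"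
    have inj: "inj_on (\<lambda>i. ((T i, R i), i)) I" by (auto simp: inj_on_def)
    have im: "(\<lambda>i. ((T i, R i), i)) ` I = Sigma fourier_index fib"
      using idx by (auto simp: fib_def)
    have "((\<lambda>(p, i). ?h i) has_sum \<psi> Z W) (Sigma fourier_index fib)"
      unfolding im[symmetric] has_sum_reindex[OF inj] using sums[OF Z, of W] by (simp add: o_def)
    moreover have "((\<lambda>i. case (p, i) of (p, i) \<Rightarrow> ?h i) has_sum (\<lambda>(T', R'). c T' R' * fterm T' R' Z W) p) (fib p)"
      if "p \<in> fourier_index" for p
    proof (cases p)
      case (Pair T' R')
      have "?h summable_on fib p"
        by (rule summable_on_subset_banach[OF has_sum_imp_summable[OF sums[OF Z, of W]]]) (auto simp: fib_def)
      then have "(?h has_sum infsum ?h (fib p)) (fib p)" by simp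
      moreover have "infsum ?h (fib p) = (\<Sum>\<^sub>\<infinity>i\<in>fib p. a i * fterm T' R' Z W)"
        by (rule infsum_cong) (auto simp: fib_def Pair)
      ultimately show ?thesis by (simp add: Pair infsum_cmult_left' c_def)
    qed
    ultimately show ?thesis by (rule has_sum_Sigma')
  qed
  moreover have "block_psd 1 m T' R'" if "c T' R' \<noteq> 0" for T' R'
  proof -
    have "\<exists>i\<in>fib (T', R'). a i \<noteq> 0"
      using that infsum_0[of "fib (T', R')" a] unfolding c_def by blast
    then show ?thesis using psd by (auto simp: fib_def)
  qed
  ultimately have "fourier_coeffs c m \<psi>" unfolding fourier_coeffs_def by blast
  then show ?thesis unfolding fourier_nice_def by blast
qed

lemma fterm_add: "fterm (T1 + T2) (R1 + R2) Z W = fterm T1 R1 Z W * fterm T2 R2 Z W"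
  by (simp add: fterm_def ring_distribs sum.distrib e2pi_add)

text \<open>Summability of complex families is absolute, so the product family is summable and
  Fubini applies.\<close>

lemma has_sum_product_complex:
  fixes f :: "'a \<Rightarrow> complex" and g :: "'b \<Rightarrow> complex"
  assumes f: "(f has_sum a) A" and g: "(g has_sum b) B"
  shows "((\<lambda>(x, y). f x * g y) has_sum (a * b)) (A \<times> B)"
proof (rule has_sum_SigmaI)
  have nf: "(\<lambda>x. norm (f x)) summable_on A" and ng: "(\<lambda>x. norm (g x)) summable_on B"
    using has_sum_imp_summable[OF f] has_sum_imp_summable[OF g] by (simp_all add: summable_on_iff_abs_summable_on_complex)
  have "(\<lambda>(x, y). norm (f x) * norm (g y)) summable_on (A \<times> B)"
  proof (rule summable_on_SigmaI)
    show "((\<lambda>y. case (x, y) of (x, y) \<Rightarrow> norm (f x) * norm (g y)) has_sum (norm (f x) * infsum (\<lambda>y. norm (g y)) B)) B" for x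
      using ng by (auto intro!: has_sum_cmult_right)
    show "(\<lambda>x. norm (f x) * infsum (\<lambda>y. norm (g y)) B) summable_on A"
      by (rule summable_on_cmult_left[OF nf])
  qed auto
  then have "(\<lambda>p. norm (case p of (x, y) \<Rightarrow> f x * g y)) summable_on (A \<times> B)"
    by (simp add: case_prod_unfold norm_mult)
  then show "(\<lambda>(x, y). f x * g y) summable_on A \<times> B"
    by (rule abs_summable_summable)
  show "((\<lambda>y. case (x, y) of (x, y) \<Rightarrow> f x * g y) has_sum (f x * b)) B" for x
    using has_sum_cmult_right[OF g] by simp
  show "((\<lambda>x. f x * b) has_sum (a * b)) A" by (rule has_sum_cmult_left[OF f])
qed

lemma half_integral_psd_add: "half_integral_psd S \<Longrightarrow> half_integral_psd T \<Longrightarrow> half_integral_psd (S + T)"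
  by (auto simp: half_integral_psd_def transpose_def vec_eq_iff ring_distribs sum.distrib)

lemma fourier_index_add: "(S, Q) \<in> fourier_index \<Longrightarrow> (T, R) \<in> fourier_index \<Longrightarrow> (S + T, Q + R) \<in> fourier_index"
  by (auto simp: fourier_index_def half_integral_psd_add)

lemma block_psd_add:
  assumes "block_psd 1 m S Q" "block_psd 1 n T R"
  shows "block_psd 1 (m + n) (S + T) (Q + R)"
  unfolding block_psd_def
proof (intro allI)
  fix x :: "real ^ 'a" and y :: real
  show "0 \<le> (\<Sum>i\<in>UNIV. \<Sum>j\<in>UNIV. x $ i * ((S + T) $ i $ j / real 1) * x $ j) + 2 * (\<Sum>i\<in>UNIV. x $ i * ((Q + R) $ i / 2) * y) + real (m + n) * y * y"
    using assms[unfolded block_psd_def, rule_format, of x y] by (simp add: ring_distribs sum.distrib add_divide_distrib)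
qed

lemma fourier_nice_mult:
  assumes "fourier_nice m \<phi>" "fourier_nice n \<psi>"
  shows "fourier_nice (m + n) (\<lambda>Z W. \<phi> Z W * \<psi> Z W)"
proof -
  obtain c d where "fourier_coeffs c m \<phi>" "fourier_coeffs d n \<psi>"
    using assms unfolding fourier_nice_def by blast
  note c = fourier_coeffsD[OF this(1)] and d = fourier_coeffsD[OF this(2)]
  show ?thesis
  proof (rule fourier_niceI[where I = "fourier_index \<times> fourier_index" and a = "\<lambda>(p, q). c (fst p) (snd p) * d (fst q) (snd q)"
        and T = "\<lambda>(p, q). fst p + fst q" and R = "\<lambda>(p, q). snd p + snd q"])
    fix Z :: "complex ^ 'a ^ 'a" and W :: "complex ^ 'a" assume "Z \<in> siegel_H"
    from has_sum_product_complex[OF c(1)[OF this, of W] d(1)[OF this, of W]]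
    show "((\<lambda>i. (case i of (p, q) \<Rightarrow> c (fst p) (snd p) * d (fst q) (snd q)) * fterm (case i of (p, q) \<Rightarrow> fst p + fst q) (case i of (p, q) \<Rightarrow> snd p + snd q) Z W) has_sum \<phi> Z W * \<psi> Z W) (fourier_index \<times> fourier_index)"
      by (simp add: case_prod_unfold fterm_add mult_ac)
  qed (auto simp: fourier_index_add c(2) d(2) block_psd_add simp del: One_nat_def)
qed

lemma block_psd_scale:
  assumes "block_psd 1 m T R"
  shows "block_psd 1 (m * s^2) T (\<chi> i. real s * R $ i)"
  unfolding block_psd_def
proof (intro allI)
  fix x :: "real ^ 'a" and y :: real
  show "0 \<le> (\<Sum>i\<in>UNIV. \<Sum>j\<in>UNIV. x $ i * (T $ i $ j / real 1) * x $ j) + 2 * (\<Sum>i\<in>UNIV. x $ i * ((\<chi> i. real s * R $ i) $ i / 2) * y) + real (m * s^2) * y * y"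
    using assms[unfolded block_psd_def, rule_format, of x "real s * y"] by (simp add: power2_eq_square mult_ac)
qed

text \<open>Rescaling replaces R by s R, which in the positivity condition amounts to replacing y by
  s y; hence the factor s^2. The case s = 0 is included and lowers the index to 0.\<close>

lemma fourier_nice_scale:
  assumes "fourier_nice m \<phi>"
  shows "fourier_nice (m * s^2) (\<lambda>Z W. \<phi> Z (of_nat s *s W))"
proof -
  obtain c where "fourier_coeffs c m \<phi>"
    using assms unfolding fourier_nice_def by blast
  note c = fourier_coeffsD[OF this]
  show ?thesis
  proof (rule fourier_niceI[where I = fourier_index and a = "\<lambda>(T, R). c T R" and T = fst and R = "\<lambda>p. \<chi> i. real s * snd p $ i"])
    fix Z :: "complex ^ 'a ^ 'a" and W :: "complex ^ 'a" assume Z: "Z \<in> siegel_H"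
    have "fterm T R Z (of_nat s *s W) = fterm T (\<chi> i. real s * R $ i) Z W" for T R
      by (simp add: fterm_def mult_ac)
    then show "((\<lambda>p. (case p of (T, R) \<Rightarrow> c T R) * fterm (fst p) (\<chi> i. real s * snd p $ i) Z W) has_sum \<phi> Z (of_nat s *s W)) fourier_index"
      using c(1)[OF Z, of "of_nat s *s W"] by (simp add: case_prod_unfold)
  qed (auto simp: fourier_index_def block_psd_scale c(2) simp del: One_nat_def)
qed

text \<open>T is half the Gram matrix of the X_i, and R lists their inner products with the root e.
  The block matrix of index 1 is half the Gram matrix of X_1, ..., X_g, e, hence semidefinite: its
  form is a sum of squares divided by 8.\<close>

lemma Theta_fourier_nice: "fourier_nice 1 (Theta :: complex ^ 'g::finite ^ 'g \<Rightarrow> _)"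
proof -
  define T where "T X = ((\<chi> i j. of_int (ip8 (X i) (X j)) / 8) :: real ^ 'g ^ 'g)" for X
  define R where "R X = ((\<chi> i. of_int (sum8 (X i)) / 4) :: real ^ 'g)" for X
  have quad: "(\<Sum>i\<in>UNIV. \<Sum>j\<in>UNIV. x $ i * T X $ i $ j * x $ j) = (\<Sum>k\<in>UNIV. (\<Sum>i\<in>UNIV. x $ i * of_int (X i k))^2) / 8" for x :: "real ^ 'g" and X
  proof -
    have "(\<Sum>k\<in>UNIV. (\<Sum>i\<in>UNIV. x $ i * of_int (X i k))^2) = (\<Sum>k\<in>UNIV. \<Sum>i\<in>UNIV. \<Sum>j\<in>UNIV. x $ i * x $ j * (of_int (X i k) * of_int (X j k)))"
      by (simp add: power2_eq_square sum_product mult_ac)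
    also have "\<dots> = (\<Sum>i\<in>UNIV. \<Sum>j\<in>UNIV. \<Sum>k\<in>UNIV. x $ i * x $ j * (of_int (X i k) * of_int (X j k)))"
      by (subst sum.swap, subst (2) sum.swap) (rule refl)
    also have "\<dots> = (\<Sum>i\<in>UNIV. \<Sum>j\<in>UNIV. x $ i * x $ j * of_int (ip8 (X i) (X j)))"
      by (simp add: ip8_def sum_distrib_left)
    finally show ?thesis by (simp add: T_def sum_divide_distrib mult_ac)
  qed
  show ?thesis
  proof (rule fourier_niceI[where I = E8n and a = "\<lambda>_. 1" and T = T and R = R])
    fix Z :: "complex ^ 'g ^ 'g" and W :: "complex ^ 'g" assume Z: "Z \<in> siegel_H"
    have sym: "Z $ i $ j = Z $ j $ i" for i j
      using siegel_H_sym[OF Z] by (simp add: vec_eq_iff transpose_def)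
    have "exp (texp Z W X) = 1 * fterm (T X) (R X) Z W" for X
    proof -
      have 1: "(\<Sum>i\<in>UNIV. \<Sum>j\<in>UNIV. of_real (T X $ i $ j) * Z $ j $ i) = (\<Sum>i\<in>UNIV. \<Sum>j\<in>UNIV. Z $ i $ j * of_int (ip8 (X i) (X j))) / 8"
        by (simp add: T_def sum_divide_distrib sym mult.commute)
      have 2: "(\<Sum>i\<in>UNIV. W $ i * of_real (R X $ i)) = (\<Sum>i\<in>UNIV. W $ i * of_int (sum8 (X i))) / 4"
        by (simp add: R_def sum_divide_distrib)
      show ?thesis
        unfolding fterm_def 1 2 e2pi_def texp_def mult_1 exp_add[symmetric] by (intro arg_cong[where f = exp]) (simp add: field_simps)
    qed
    then show "((\<lambda>X. 1 * fterm (T X) (R X) Z W) has_sum Theta Z W) E8n"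
      using has_sum_infsum[OF Theta_summable[OF Z, of W E8n]] Z by (simp add: Theta_def)
  next
    fix X :: "'g \<Rightarrow> 8 \<Rightarrow> int" assume X: "X \<in> E8n"
    have "2 * T X $ i $ j \<in> \<int>" for i j
    proof -
      have "4 dvd ip8 (X i) (X j)" using X E8_ip8 by (auto simp: E8n_def)
      then obtain b where "ip8 (X i) (X j) = 4 * b" by (elim dvdE)
      then show ?thesis by (simp add: T_def)
    qed
    moreover have "T X $ i $ i \<in> \<int>" for i
    proof -
      have "8 dvd ip8 (X i) (X i)" using X E8_norm by (auto simp: E8n_def)
      then obtain b where "ip8 (X i) (X i) = 8 * b" by (elim dvdE)
      then show ?thesis by (simp add: T_def)
    qed
    moreover have "R X $ i \<in> \<int>" for i
    proof -
      have "4 dvd sum8 (X i)" using X E8_sum8 by (auto simp: E8n_def)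
      then obtain b where "sum8 (X i) = 4 * b" by (elim dvdE)
      then show ?thesis by (simp add: R_def)
    qed
    moreover have "transpose (T X) = T X"
      by (simp add: T_def transpose_def vec_eq_iff ip8_commute)
    moreover have "(\<Sum>i\<in>UNIV. \<Sum>j\<in>UNIV. x $ i * T X $ i $ j * x $ j) \<ge> 0" for x
      unfolding quad by (auto intro!: sum_nonneg)
    ultimately show "(T X, R X) \<in> fourier_index"
      by (simp add: fourier_index_def half_integral_psd_def)
    show "block_psd 1 1 (T X) (R X)"
      unfolding block_psd_def
    proof (intro allI)
      fix x :: "real ^ 'g" and y :: real
      define z where "z k = (\<Sum>i\<in>UNIV. x $ i * of_int (X i k))" for k
      have "(\<Sum>k\<in>UNIV. z k) = (\<Sum>i\<in>UNIV. x $ i * of_int (sum8 (X i)))"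
        unfolding z_def by (subst sum.swap) (simp add: sum8_def sum_distrib_left)
      then have s: "2 * (\<Sum>i\<in>UNIV. x $ i * (R X $ i / 2) * y) = (\<Sum>k\<in>UNIV. z k) * y / 4"
        by (simp add: R_def sum_distrib_left sum_distrib_right sum_divide_distrib mult_ac)
      have "(\<Sum>k\<in>UNIV. (z k + y)^2) = (\<Sum>k\<in>UNIV. (z k)^2) + 2 * (\<Sum>k\<in>UNIV. z k) * y + 8 * y^2"
        by (simp add: power2_sum sum.distrib sum_distrib_left sum_distrib_right mult_ac)
      then have sq: "(\<Sum>k\<in>UNIV. (z k)^2) / 8 + (\<Sum>k\<in>UNIV. z k) * y / 4 + 1 * y * y = (\<Sum>k\<in>UNIV. (z k + y)^2) / 8"
        by (simp add: power2_eq_square field_simps)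
      have quad': "(\<Sum>i\<in>UNIV. \<Sum>j\<in>UNIV. x $ i * T X $ i $ j * x $ j) = (\<Sum>k\<in>UNIV. (z k)^2) / 8"
        unfolding z_def by (rule quad)
      have "(\<Sum>i\<in>UNIV. \<Sum>j\<in>UNIV. x $ i * (T X $ i $ j / real 1) * x $ j) + 2 * (\<Sum>i\<in>UNIV. x $ i * (R X $ i / 2) * y) + real 1 * y * y = (\<Sum>k\<in>UNIV. (z k + y)^2) / 8"
        by (simp only: of_nat_1 div_by_1 quad' s sq)
      moreover have "(\<Sum>k\<in>UNIV. (z k + y)^2) / 8 \<ge> 0" by (simp add: sum_nonneg)
      ultimately show "0 \<le> (\<Sum>i\<in>UNIV. \<Sum>j\<in>UNIV. x $ i * (T X $ i $ j / real 1) * x $ j) + 2 * (\<Sum>i\<in>UNIV. x $ i * (R X $ i / 2) * y) + real 1 * y * y"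
        by simp
    qed
  qed
qed

section \<open>Products and rescalings of forms for the full group\<close>

text \<open>Forms for the whole integral symplectic group. The class is closed under products and
  rescaling of W, and its members are forms for every subgroup.\<close>

definition full_form :: "int \<Rightarrow> nat \<Rightarrow> (complex ^ 'g ^ 'g \<Rightarrow> complex ^ 'g::finite \<Rightarrow> complex) \<Rightarrow> bool" where
  "full_form k m \<phi> \<longleftrightarrow> (\<forall>Z W. Z \<notin> siegel_H \<longrightarrow> \<phi> Z W = 0) \<and> holo_HC \<phi> \<and>
     (\<forall>M\<in>Sp_Z. \<forall>Z\<in>siegel_H. \<forall>W. slash k m M \<phi> Z W = \<phi> Z W) \<and>
     (\<forall>lam mu x. \<forall>Z\<in>siegel_H. \<forall>W. heis_slash m lam mu x \<phi> Z W = \<phi> Z W) \<and> fourier_nice m \<phi>"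

lemma full_form_Theta: "full_form 4 1 Theta"
proof -
  have "Theta Z W = 0" if "Z \<notin> siegel_H" for Z W using that by (simp add: Theta_def)
  then show ?thesis
    unfolding full_form_def by (intro conjI ballI allI impI holo_HC_Theta slash_Theta Theta_heis Theta_fourier_nice)
qed

lemma full_form_jacobi_forms:
  assumes f: "full_form k m \<phi>" and \<Gamma>: "\<Gamma> \<subseteq> Sp_Z"
  shows "\<phi> \<in> jacobi_forms k m \<Gamma>"
proof -
  have "has_fourier_exp m (slash k m M \<phi>)" if M: "M \<in> Sp_Z" for M
  proof -
    have inv: "slash k m M \<phi> Z W = \<phi> Z W" if "Z \<in> siegel_H" for Z W
      using f M that unfolding full_form_def by blast
    obtain c where "fourier_coeffs c m \<phi>"
      using f unfolding full_form_def fourier_nice_def by blast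
    note c = fourier_coeffsD[OF this]
    show ?thesis
      unfolding has_fourier_exp_def
    proof (intro exI[of _ 1] exI[of _ c] conjI ballI allI)
      fix Z :: "complex ^ 'a ^ 'a" and W assume Z: "Z \<in> siegel_H"
      show "((\<lambda>(T, R). c T R * e2pi ((\<Sum>i\<in>UNIV. \<Sum>j\<in>UNIV. of_real (T $ i $ j) * Z $ j $ i) / of_nat 1)
                      * e2pi (\<Sum>i\<in>UNIV. W $ i * of_real (R $ i))) has_sum slash k m M \<phi> Z W) fourier_index"
        using c(1)[OF Z, of W] by (simp add: inv[OF Z] fterm_def mult.assoc)
    qed (use c(2) in auto)
  qed
  then show ?thesis using f \<Gamma> unfolding full_form_def jacobi_forms_def by auto
qed

lemma holo_HC_mult:
  assumes "holo_HC \<phi>" "holo_HC \<psi>"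
  shows "holo_HC (\<lambda>Z W. \<phi> Z W * \<psi> Z W)"
  unfolding holo_HC_def
proof
  fix p :: "(complex ^ 'a ^ 'a) \<times> (complex ^ 'a)" assume p: "p \<in> siegel_H \<times> UNIV"
  obtain L M where L: "((\<lambda>q. \<phi> (fst q) (snd q)) has_derivative L) (at p within siegel_H \<times> UNIV)" "\<And>v. L (cmul_pair \<i> v) = \<i> * L v"
    and M: "((\<lambda>q. \<psi> (fst q) (snd q)) has_derivative M) (at p within siegel_H \<times> UNIV)" "\<And>v. M (cmul_pair \<i> v) = \<i> * M v"
    using assms p unfolding holo_HC_def by meson
  show "\<exists>L. ((\<lambda>q. \<phi> (fst q) (snd q) * \<psi> (fst q) (snd q)) has_derivative L) (at p within siegel_H \<times> UNIV) \<and> (\<forall>v. L (cmul_pair \<i> v) = \<i> * L v)"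
    using has_derivative_mult[OF L(1) M(1)]
    by (intro exI[of _ "\<lambda>h. \<phi> (fst p) (snd p) * M h + L h * \<psi> (fst p) (snd p)"]) (simp add: L(2) M(2) algebra_simps)
qed

lemma slash_split:
  assumes "M \<in> Sp_Z" "Z \<in> siegel_H"
  shows "slash (k + l) (m + n) M (\<lambda>Z W. \<phi> Z W * \<psi> Z W) Z W = slash k m M \<phi> Z W * slash l n M \<psi> Z W"
proof -
  have "det (autf M Z) \<noteq> 0" using invertible_autf[OF assms] by (simp add: invertible_det_nz)
  then have 1: "det (autf M Z) powi (- (k + l)) = det (autf M Z) powi (- k) * det (autf M Z) powi (- l)"
    by (simp add: power_int_add[symmetric])
  have 2: "exp (- 2 * of_real pi * \<i> * of_nat (m + n) * r) = exp (- 2 * of_real pi * \<i> * of_nat m * r) * exp (- 2 * of_real pi * \<i> * of_nat n * r)" for r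
    by (simp add: algebra_simps flip: exp_add)
  show ?thesis unfolding slash_altdef 1 2 by (simp add: mult_ac)
qed

lemma heis_slash_split:
  "heis_slash (m + n) lam mu x (\<lambda>Z W. \<phi> Z W * \<psi> Z W) Z W = heis_slash m lam mu x \<phi> Z W * heis_slash n lam mu x \<psi> Z W"
  by (simp only: heis_slash_def Let_def of_nat_add ring_distribs(2) e2pi_add) (simp add: mult_ac)

lemma full_form_mult:
  assumes "full_form k m \<phi>" "full_form l n \<psi>"
  shows "full_form (k + l) (m + n) (\<lambda>Z W. \<phi> Z W * \<psi> Z W)"
  using assms fourier_nice_mult[of m \<phi> n \<psi>] holo_HC_mult[of \<phi> \<psi>]
  unfolding full_form_def by (simp add: slash_split heis_slash_split)

lemma full_form_scale:
  assumes "full_form k m \<phi>"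
  shows "full_form k (m * s^2) (\<lambda>Z W. \<phi> Z (of_nat s *s W))"
proof -
  have h: "holo_HC \<phi>" and z: "\<And>Z W. Z \<notin> siegel_H \<Longrightarrow> \<phi> Z W = 0"
    and sl: "\<And>M Z W. M \<in> Sp_Z \<Longrightarrow> Z \<in> siegel_H \<Longrightarrow> slash k m M \<phi> Z W = \<phi> Z W"
    and he: "\<And>lam mu x Z W. Z \<in> siegel_H \<Longrightarrow> heis_slash m lam mu x \<phi> Z W = \<phi> Z W"
    and fn: "fourier_nice m \<phi>"
    using assms unfolding full_form_def by blast+
  have vs: "(of_nat s *s W) v* N = of_nat s *s (W v* N)" for W :: "complex ^ 'a" and N :: "complex ^ 'a ^ 'a"
    by (simp add: vector_matrix_mult_def vec_eq_iff sum_distrib_left mult_ac)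
  have "holo_HC (\<lambda>Z W. \<phi> Z (of_nat s *s W))"
    unfolding holo_HC_def
  proof
    fix p :: "(complex ^ 'a ^ 'a) \<times> (complex ^ 'a)" assume p: "p \<in> siegel_H \<times> UNIV"
    define g where "g q = (fst q, of_nat s *s snd q)" for q :: "(complex ^ 'a ^ 'a) \<times> (complex ^ 'a)"
    have gp: "g p \<in> siegel_H \<times> UNIV" using p by (auto simp: g_def)
    obtain L where L: "((\<lambda>q. \<phi> (fst q) (snd q)) has_derivative L) (at (g p) within siegel_H \<times> UNIV)" "\<And>v. L (cmul_pair \<i> v) = \<i> * L v"
      using h gp unfolding holo_HC_def by meson
    have "of_nat s *s w = real s *\<^sub>R w" for w :: "complex ^ 'a"
      unfolding vec_eq_iff vector_scaleR_component vector_smult_component unfolding scaleR_conv_of_real by simp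
    then have gs: "g = (\<lambda>q. (fst q, real s *\<^sub>R snd q))"
      by (simp add: g_def fun_eq_iff)
    have dg: "(g has_derivative g) (at p within siegel_H \<times> UNIV)"
      unfolding gs by (intro has_derivative_Pair has_derivative_fst has_derivative_scaleR_right has_derivative_snd has_derivative_ident)
    have "((\<lambda>q. \<phi> (fst (g q)) (snd (g q))) has_derivative (\<lambda>v. L (g v))) (at p within siegel_H \<times> UNIV)"
      by (rule has_derivative_in_compose[OF dg has_derivative_subset[OF L(1)]]) (auto simp: g_def)
    moreover have "L (g (cmul_pair \<i> v)) = \<i> * L (g v)" for v
    proof -
      have "g (cmul_pair \<i> v) = cmul_pair \<i> (g v)"
        by (simp add: g_def cmul_pair_def vec_eq_iff mult_ac)
      then show ?thesis by (simp add: L(2))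
    qed
    ultimately show "\<exists>L. ((\<lambda>q. \<phi> (fst q) (of_nat s *s snd q)) has_derivative L) (at p within siegel_H \<times> UNIV) \<and> (\<forall>v. L (cmul_pair \<i> v) = \<i> * L v)"
      unfolding g_def by auto
  qed
  moreover have "slash k (m * s^2) M (\<lambda>Z W. \<phi> Z (of_nat s *s W)) Z W = \<phi> Z (of_nat s *s W)"
    if M: "M \<in> Sp_Z" and Z: "Z \<in> siegel_H" for M Z W
  proof -
    have "rowdot ((of_nat s *s W) v* N) (C *v (of_nat s *s W)) = of_nat (s^2) * rowdot (W v* N) (C *v W)" for N C :: "complex ^ 'a ^ 'a"
      unfolding vs by (simp add: rowdot_def matrix_vector_mult_def sum_distrib_left power2_eq_square mult_ac)
    then show ?thesis
      unfolding sl[OF M Z, of "of_nat s *s W", symmetric] slash_altdef by (simp add: vs mult_ac)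
  qed
  moreover have "heis_slash (m * s^2) lam mu x (\<lambda>Z W. \<phi> Z (of_nat s *s W)) Z W = \<phi> Z (of_nat s *s W)"
    if Z: "Z \<in> siegel_H" for lam mu x Z W
  proof -
    define l where "l = ((\<chi> i. of_int (lam $ i)) :: complex ^ 'a)"
    define u where "u = ((\<chi> i. of_int (mu $ i)) :: complex ^ 'a)"
    have l': "(\<chi> i. of_int ((\<chi> i. int s * lam $ i) $ i)) = of_nat s *s l" "(\<chi> i. of_int ((\<chi> i. int s * mu $ i) $ i)) = of_nat s *s u"
      by (simp_all add: l_def u_def vec_eq_iff)
    have rd: "rowdot (c *s a) b = c * rowdot a b" "rowdot a (c *s b) = c * rowdot a b" for a b :: "complex ^ 'a" and c
      by (simp_all add: rowdot_def sum_distrib_left mult_ac)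
    \<comment> \<open>The rescaled function transforms by \<open>s * lam\<close> and
      \<open>s * mu\<close> with central parameter 0; the original x contributes only an integer to
      the exponent.\<close>
    have E: "of_nat (m * s^2) * (rowdot (l v* Z) l + 2 * rowdot l W + of_int x + rowdot u l)
       = of_nat m * (rowdot ((of_nat s *s l) v* Z) (of_nat s *s l) + 2 * rowdot (of_nat s *s l) (of_nat s *s W) + of_int 0 + rowdot (of_nat s *s u) (of_nat s *s l)) + of_int (int (m * s^2) * x)"
      by (simp add: vs rd power2_eq_square algebra_simps)
    have A: "of_nat s *s (W + l v* Z + u) = of_nat s *s W + (of_nat s *s l) v* Z + of_nat s *s u"
      by (simp add: vs vector_add_ldistrib)
    show ?thesis
      unfolding he[OF Z, of "\<chi> i. int s * lam $ i" "\<chi> i. int s * mu $ i" 0 "of_nat s *s W", symmetric]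
      unfolding heis_slash_def Let_def l' unfolding l_def[symmetric] u_def[symmetric] E A e2pi_add e2pi_of_int by simp
  qed
  ultimately show ?thesis
    using fourier_nice_scale[OF fn, of s] z unfolding full_form_def by auto
qed

definition hone :: "complex ^ 'g ^ 'g \<Rightarrow> complex ^ 'g::finite \<Rightarrow> complex" where
  "hone Z W = (if Z \<in> siegel_H then 1 else 0)"

lemma full_form_hone: "full_form 0 0 (hone :: complex ^ 'g::finite ^ 'g \<Rightarrow> _)"
proof -
  have "holo_HC (hone :: complex ^ 'g::finite ^ 'g \<Rightarrow> _)"
    unfolding holo_HC_def
  proof
    fix p :: "(complex ^ 'g ^ 'g) \<times> (complex ^ 'g)" assume p: "p \<in> siegel_H \<times> UNIV"
    have "((\<lambda>q. hone (fst q) (snd q)) has_derivative (\<lambda>_. 0)) (at p within siegel_H \<times> UNIV)"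
      by (rule has_derivative_transform[OF p _ has_derivative_const[of 1]]) (auto simp: hone_def)
    then show "\<exists>L. ((\<lambda>q. hone (fst q) (snd q)) has_derivative L) (at p within siegel_H \<times> UNIV) \<and> (\<forall>v. L (cmul_pair \<i> v) = \<i> * L v)"
      by (intro exI[of _ "\<lambda>_. 0"]) auto
  qed
  moreover have "fourier_nice 0 (hone :: complex ^ 'g::finite ^ 'g \<Rightarrow> _)"
  proof (rule fourier_niceI[where I = "{()}" and a = "\<lambda>_. 1" and T = "\<lambda>_. 0" and R = "\<lambda>_. 0"])
    fix Z :: "complex ^ 'g ^ 'g" and W :: "complex ^ 'g" assume "Z \<in> siegel_H"
    moreover have "fterm 0 0 Z W = 1" by (simp add: fterm_def e2pi_def)
    ultimately show "((\<lambda>i. 1 * fterm 0 0 Z W) has_sum hone Z W) {()}"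
      using has_sum_finite[of "{()}" "\<lambda>i. 1 * fterm 0 0 Z W"] by (simp add: hone_def)
  qed (simp_all add: fourier_index_def half_integral_psd_def block_psd_def transpose_def vec_eq_iff)
  moreover have "slash 0 0 M hone Z W = hone Z W" if "M \<in> Sp_Z" "Z \<in> siegel_H" for M and Z :: "complex ^ 'g ^ 'g" and W
    using mact_siegel_H[OF that] that by (simp add: slash_altdef hone_def)
  ultimately show ?thesis
    by (simp add: full_form_def heis_slash_def Let_def) (simp add: hone_def e2pi_def)
qed

text \<open>Starting from \<open>hone\<close> instead of the constant 1 keeps the power zero outside
  the half space for exponent 0 too.\<close>

fun hpow :: "(complex ^ 'g ^ 'g \<Rightarrow> complex ^ 'g::finite \<Rightarrow> complex) \<Rightarrow> nat \<Rightarrow> (complex ^ 'g ^ 'g \<Rightarrow> complex ^ 'g \<Rightarrow> complex)" where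
  "hpow \<phi> 0 = hone"
| "hpow \<phi> (Suc n) = (\<lambda>Z W. \<phi> Z W * hpow \<phi> n Z W)"

lemma full_form_hpow: "full_form k m \<phi> \<Longrightarrow> full_form (int n * k) (n * m) (hpow \<phi> n)"
proof (induction n)
  case 0 then show ?case by (simp add: full_form_hone)
next
  case (Suc n)
  have "int (Suc n) * k = k + int n * k" "Suc n * m = m + n * m" by (simp_all add: algebra_simps)
  then show ?case using full_form_mult[OF Suc.prems Suc.IH[OF Suc.prems]] by (simp only: hpow.simps)
qed

lemma hpow_eq: "Z \<in> siegel_H \<Longrightarrow> hpow \<phi> n Z W = \<phi> Z W ^ n"
  by (induction n) (simp_all add: hone_def)

section \<open>Growth along rays\<close>

definition Zray :: "'g \<Rightarrow> real \<Rightarrow> complex ^ 'g::finite ^ 'g" where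
  "Zray p t = (\<chi> i j. if i = j then \<i> * of_real (1 + (if i = p then t else 0)) else 0)"

definition Wray :: "'g \<Rightarrow> real \<Rightarrow> real \<Rightarrow> complex ^ 'g::finite" where
  "Wray p y t = (\<chi> i. if i = p then \<i> * of_real (y * (1 + t)) else 0)"

lemma Zray_siegel_H:
  fixes p :: "'g::finite"
  assumes "t \<ge> 0"
  shows "Zray p t \<in> siegel_H"
proof -
  have "(\<Sum>i\<in>UNIV. \<Sum>j\<in>UNIV. x $ i * Im (Zray p t $ i $ j) * x $ j) > 0" if x: "x \<noteq> 0" for x :: "real ^ 'g"
  proof -
    have "(\<Sum>i\<in>UNIV. \<Sum>j\<in>UNIV. x $ i * Im (Zray p t $ i $ j) * x $ j) = (\<Sum>i\<in>UNIV. (1 + (if i = p then t else 0)) * (x $ i)^2)"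
    proof (rule sum.cong[OF refl])
      fix i
      have "(\<Sum>j\<in>UNIV. x $ i * Im (Zray p t $ i $ j) * x $ j) = (\<Sum>j\<in>UNIV. if j = i then (1 + (if i = p then t else 0)) * (x $ i)^2 else 0)"
        by (intro sum.cong refl) (auto simp: Zray_def power2_eq_square)
      then show "(\<Sum>j\<in>UNIV. x $ i * Im (Zray p t $ i $ j) * x $ j) = (1 + (if i = p then t else 0)) * (x $ i)^2" by simp
    qed
    also have "\<dots> \<ge> (\<Sum>i\<in>UNIV. (x $ i)^2)"
      using assms by (intro sum_mono) (auto simp: ring_distribs)
    moreover have "(\<Sum>i\<in>UNIV. (x $ i)^2) > 0"
    proof -
      obtain k where "x $ k \<noteq> 0" using x by (auto simp: vec_eq_iff)
      then show ?thesis by (intro sum_pos2[of UNIV k]) auto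
    qed
    ultimately show ?thesis by linarith
  qed
  moreover have "transpose (Zray p t) = Zray p t"
    by (auto simp: Zray_def transpose_def vec_eq_iff)
  ultimately show ?thesis by (simp add: siegel_H_def)
qed

text \<open>At a purely imaginary Z and W = 0 all terms are positive, and the zero vector
  contributes 1.\<close>

lemma norm_Theta_Zray:
  assumes "t \<ge> 0"
  shows "norm (Theta (Zray p t) 0) \<ge> 1"
proof -
  define r where "r X = - pi / 4 * (\<Sum>i\<in>UNIV. (1 + (if i = p then t else 0)) * of_int (ip8 (X i) (X i)))" for X
  have e: "exp (texp (Zray p t) 0 X) = of_real (exp (r X))" for X
  proof -
    have "(\<Sum>i\<in>UNIV. \<Sum>j\<in>UNIV. Zray p t $ i $ j * of_int (ip8 (X i) (X j))) = (\<Sum>i\<in>UNIV. \<i> * of_real ((1 + (if i = p then t else 0)) * of_int (ip8 (X i) (X i))))"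
    proof (rule sum.cong[OF refl])
      fix i
      have "(\<Sum>j\<in>UNIV. Zray p t $ i $ j * of_int (ip8 (X i) (X j))) = (\<Sum>j\<in>UNIV. if j = i then \<i> * of_real ((1 + (if i = p then t else 0)) * of_int (ip8 (X i) (X i))) else 0)"
        by (intro sum.cong refl) (auto simp: Zray_def)
      then show "(\<Sum>j\<in>UNIV. Zray p t $ i $ j * of_int (ip8 (X i) (X j))) = \<i> * of_real ((1 + (if i = p then t else 0)) * of_int (ip8 (X i) (X i)))" by simp
    qed
    also have "\<dots> = \<i> * of_real (\<Sum>i\<in>UNIV. (1 + (if i = p then t else 0)) * of_int (ip8 (X i) (X i)))"
      by (simp only: sum_distrib_left of_real_sum)
    finally have A: "(\<Sum>i\<in>UNIV. \<Sum>j\<in>UNIV. Zray p t $ i $ j * of_int (ip8 (X i) (X j))) = \<i> * of_real (\<Sum>i\<in>UNIV. (1 + (if i = p then t else 0)) * of_int (ip8 (X i) (X i)))" .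
    define s where "s = (\<Sum>i\<in>UNIV. (1 + (if i = p then t else 0)) * real_of_int (ip8 (X i) (X i)))"
    have "texp (Zray p t) 0 X = of_real (r X)"
      unfolding texp_def A r_def s_def[symmetric] by (simp add: mult.assoc)
    then show ?thesis by (simp only: exp_of_real)
  qed
  note Z = Zray_siegel_H[OF assms, of p]
  have "(\<lambda>X. norm (exp (texp (Zray p t) 0 X))) summable_on E8n"
    by (rule summable_on_subset_banach[OF norm_Theta_summable[OF Z]]) auto
  then have sm: "(\<lambda>X. exp (r X)) summable_on E8n" by (simp add: e)
  have "Theta (Zray p t) 0 = of_real (\<Sum>\<^sub>\<infinity>X\<in>E8n. exp (r X))"
  proof -
    have "((\<lambda>X. complex_of_real (exp (r X))) has_sum of_real (\<Sum>\<^sub>\<infinity>X\<in>E8n. exp (r X))) E8n"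
      by (rule has_sum_of_real) (use sm in simp)
    then show ?thesis using Z by (simp add: Theta_def e infsumI)
  qed
  moreover have "(\<Sum>\<^sub>\<infinity>X\<in>E8n. exp (r X)) \<ge> 1"
  proof -
    have "(\<lambda>_ _. 0) \<in> E8n" by (simp add: E8n_def E8_zero)
    then have "sum (\<lambda>X. exp (r X)) {\<lambda>_ _. 0} \<le> (\<Sum>\<^sub>\<infinity>X\<in>E8n. exp (r X))"
      by (intro finite_sum_le_infsum sm) auto
    then show ?thesis by (simp add: r_def ip8_def)
  qed
  ultimately show ?thesis by simp
qed

text \<open>The point n W is Z e_p, a period translate of 0, so the Heisenberg law for
  \<open>lam\<close> = e_p gives the value exactly: exp (2 pi (1 + t)) times the value at 0.\<close>

lemma norm_Theta_ray:
  fixes p :: "'g::finite"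
  assumes t: "t \<ge> 0" and n: "n > 0"
  shows "norm (Theta (Zray p t) (of_nat n *s Wray p (1 / real n) t)) \<ge> exp (2 * pi * t)"
proof -
  let ?Z = "Zray p t"
  define l where "l = ((\<chi> i. of_int ((axis p 1 :: int ^ 'g) $ i)) :: complex ^ 'g)"
  have l: "l $ i = (if i = p then 1 else 0)" for i by (simp add: l_def axis_def)
  have lZ: "(l v* ?Z) $ i = (if i = p then \<i> * of_real (1 + t) else 0)" for i
  proof -
    have "(l v* ?Z) $ i = (\<Sum>j\<in>UNIV. if j = p then ?Z $ p $ i else 0)"
      unfolding vector_matrix_mult_def vec_lambda_beta by (intro sum.cong refl) (simp add: l)
    then show ?thesis by (auto simp: Zray_def)
  qed
  have W: "of_nat n *s Wray p (1 / real n) t = 0 + l v* ?Z + 0"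
    using n by (simp add: vec_eq_iff lZ Wray_def)
  have q: "rowdot (l v* ?Z) l = \<i> * of_real (1 + t)"
  proof -
    have "rowdot (l v* ?Z) l = (\<Sum>j\<in>UNIV. if j = p then \<i> * of_real (1 + t) else 0)"
      unfolding rowdot_def by (intro sum.cong refl) (simp add: l lZ)
    then show ?thesis by simp
  qed
  have z: "(\<chi> i. of_int ((0 :: int ^ 'g) $ i)) = (0 :: complex ^ 'g)" by (simp add: vec_eq_iff)
  have "Theta ?Z 0 = e2pi (of_nat 1 * (rowdot (l v* ?Z) l + 2 * rowdot l 0 + of_int 0 + rowdot 0 l)) * Theta ?Z (0 + l v* ?Z + 0)"
    using Theta_heis[OF Zray_siegel_H[OF t], of "axis p 1" 0 0 p 0]
    unfolding heis_slash_def Let_def l_def[symmetric] z by simp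
  also have "\<dots> = e2pi (\<i> * of_real (1 + t)) * Theta ?Z (of_nat n *s Wray p (1 / real n) t)"
    unfolding W q by (simp add: rowdot_0)
  finally have "norm (Theta ?Z 0) = exp (- (2 * pi * (1 + t))) * norm (Theta ?Z (of_nat n *s Wray p (1 / real n) t))"
    by (simp add: norm_mult e2pi_def norm_exp_eq_Re)
  moreover have "exp u * (exp (- u) * b) = b" for u b :: real by (simp add: exp_minus)
  ultimately have "norm (Theta ?Z (of_nat n *s Wray p (1 / real n) t)) = exp (2 * pi * (1 + t)) * norm (Theta ?Z 0)"
    by (simp only:)
  also have "\<dots> \<ge> exp (2 * pi * t) * 1"
    using norm_Theta_Zray[OF t, of p] by (intro mult_mono) auto
  finally show ?thesis by simp
qed

section \<open>Upper bounds from the Fourier support\<close>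

lemma block_psd_diagonal:
  assumes "block_psd lam m T R"
  shows "T $ p $ p / real lam + R $ p * y + real m * y^2 \<ge> 0"
proof -
  have 1: "(\<Sum>i\<in>UNIV. \<Sum>j\<in>UNIV. axis p (1::real) $ i * (T $ i $ j / real lam) * axis p 1 $ j) = T $ p $ p / real lam"
  proof -
    have "(\<Sum>i\<in>UNIV. \<Sum>j\<in>UNIV. axis p (1::real) $ i * (T $ i $ j / real lam) * axis p 1 $ j) = (\<Sum>i\<in>UNIV. if i = p then T $ p $ p / real lam else 0)"
      by (intro sum.cong refl) (simp add: axis_def mult_delta_right)
    then show ?thesis by simp
  qed
  have 2: "2 * (\<Sum>i\<in>UNIV. axis p (1::real) $ i * (R $ i / 2) * y) = R $ p * y"
  proof -
    have "(\<Sum>i\<in>UNIV. axis p (1::real) $ i * (R $ i / 2) * y) = (\<Sum>i\<in>UNIV. if i = p then R $ p / 2 * y else 0)"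
      by (intro sum.cong refl) (simp add: axis_def)
    then show ?thesis by simp
  qed
  show ?thesis
    using assms[unfolded block_psd_def, rule_format, of "axis p 1" y] unfolding 1 2
    by (simp add: power2_eq_square mult.assoc)
qed

text \<open>The quadratic polynomial in \<open>y\<close> is nonnegative, and its only possible real zero \<open>-R\<^sub>p/2m\<close>
cannot equal \<open>1/n\<close> when \<open>2m < n\<close>.\<close>

lemma block_psd_gap:
  assumes b: "block_psd lam m T R" and R: "R $ p \<in> \<int>" and m: "m > 0" and n: "2 * m < n"
  shows "T $ p $ p / real lam + R $ p / real n + real m / (real n)^2 \<ge> 1 / (4 * real m * (real n)^2)"
proof -
  obtain r :: int where r: "R $ p = of_int r" using R by (elim Ints_cases)
  have n0: "real n > 0" using n by simp
  have m0: "real m > 0" using m by simp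
  \<comment> \<open>Evaluation at the vertex of the parabola yields the discriminant
    inequality.\<close>
  have "T $ p $ p / real lam + R $ p * (- R $ p / (2 * real m)) + real m * (- R $ p / (2 * real m))^2 \<ge> 0"
    by (rule block_psd_diagonal[OF b])
  then have T: "T $ p $ p / real lam \<ge> (R $ p)^2 / (4 * real m)"
    using m0 by (simp add: power2_eq_square field_simps)
  \<comment> \<open>A zero would make n a divisor of 2 m, impossible as 0 < 2 m < n. The square of
    this nonzero integer is at least 1.\<close>
  have "r * int n + 2 * int m \<noteq> 0"
  proof
    assume "r * int n + 2 * int m = 0"
    then have "int n dvd 2 * int m" by (metis add.commute add_eq_0_iff dvd_minus_iff dvd_triv_right minus_equation_iff)
    then show False using zdvd_imp_le[of "int n" "2 * int m"] m n by auto
  qed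
  then have "1 \<le> \<bar>r * int n + 2 * int m\<bar>" by linarith
  then have "1 \<le> \<bar>r * int n + 2 * int m\<bar>^2" by (metis one_le_power)
  then have "1 \<le> (r * int n + 2 * int m)^2" by simp
  then have "real_of_int 1 \<le> of_int ((r * int n + 2 * int m)^2)" by (simp only: of_int_le_iff)
  then have sq: "1 \<le> (R $ p * real n + 2 * real m)^2" by (simp add: r)
  have "1 / (4 * real m * (real n)^2) \<le> (R $ p * real n + 2 * real m)^2 / (4 * real m * (real n)^2)"
    using sq m0 n0 by (intro divide_right_mono) auto
  also have "\<dots> = (R $ p)^2 / (4 * real m) + R $ p / real n + real m / (real n)^2"
    using m0 n0 by (simp add: power2_eq_square field_simps)
  also have "\<dots> \<le> T $ p $ p / real lam + R $ p / real n + real m / (real n)^2" using T by simp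
  finally show ?thesis .
qed

text \<open>Along the ray each term changes by the real factor exp (-2 pi t (T_pp / \<lambda> + R_p
  y)). A uniform lower bound on that exponent bounds the whole series by its absolute sum at t =
  0.\<close>

lemma jacobi_form_growth:
  fixes \<phi> :: "complex ^ 'g::finite ^ 'g \<Rightarrow> complex ^ 'g \<Rightarrow> complex" and p :: 'g
  assumes f: "\<phi> \<in> jacobi_forms k m \<Gamma>" and one: "mat 1 \<in> \<Gamma>" "\<Gamma> \<subseteq> Sp_Z"
    and gap: "\<And>lam T R. lam > 0 \<Longrightarrow> block_psd lam m T R \<Longrightarrow> R $ p \<in> \<int> \<Longrightarrow> T $ p $ p / real lam + R $ p * y \<ge> - d"
  shows "\<exists>C. \<forall>t\<ge>0. norm (\<phi> (Zray p t) (Wray p y t)) \<le> C * exp (2 * pi * t * d)"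
proof -
  have inv: "slash k m (mat 1) \<phi> Z W = \<phi> Z W" if "Z \<in> siegel_H" for Z W
    using f one(1) that unfolding jacobi_forms_def by blast
  have "has_fourier_exp m (slash k m (mat 1) \<phi>)"
    using f one unfolding jacobi_forms_def by blast
  then obtain lam c where lam: "lam > 0"
    and c0: "(\<forall>Z\<in>siegel_H. \<forall>W. ((\<lambda>(T, R). c T R * e2pi ((\<Sum>i\<in>UNIV. \<Sum>j\<in>UNIV. of_real (T $ i $ j) * Z $ j $ i) / of_nat lam)
                      * e2pi (\<Sum>i\<in>UNIV. W $ i * of_real (R $ i))) has_sum slash k m (mat 1) \<phi> Z W) fourier_index)"
    and psd: "(\<forall>(T, R) \<in> fourier_index. c T R \<noteq> 0 \<longrightarrow> block_psd lam m T R)"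
    unfolding has_fourier_exp_def by blast
  define h where "h t q = c (fst q) (snd q) * e2pi ((\<Sum>i\<in>UNIV. \<Sum>j\<in>UNIV. of_real (fst q $ i $ j) * Zray p t $ j $ i) / of_nat lam)
                      * e2pi (\<Sum>i\<in>UNIV. Wray p y t $ i * of_real (snd q $ i))" for t q
  have hs: "(h t has_sum \<phi> (Zray p t) (Wray p y t)) fourier_index" if t: "t \<ge> 0" for t
    using c0[rule_format, OF Zray_siegel_H[OF t], of p "Wray p y t"]
    unfolding inv[OF Zray_siegel_H[OF t]] h_def case_prod_unfold .
  have tr: "(\<Sum>i\<in>UNIV. \<Sum>j\<in>UNIV. of_real (T $ i $ j) * Zray p t $ j $ i) = \<i> * of_real ((\<Sum>i\<in>UNIV. T $ i $ i) + t * T $ p $ p)" for T t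
  proof -
    have "(\<Sum>i\<in>UNIV. \<Sum>j\<in>UNIV. of_real (T $ i $ j) * Zray p t $ j $ i) = (\<Sum>i\<in>UNIV. \<i> * of_real (T $ i $ i) + (if i = p then \<i> * of_real (t * T $ p $ p) else 0))"
    proof (rule sum.cong[OF refl])
      fix i
      have "(\<Sum>j\<in>UNIV. of_real (T $ i $ j) * Zray p t $ j $ i) = (\<Sum>j\<in>UNIV. if j = i then \<i> * of_real (T $ i $ i) + (if i = p then \<i> * of_real (t * T $ p $ p) else 0) else 0)"
        by (intro sum.cong refl) (auto simp: Zray_def algebra_simps)
      then show "(\<Sum>j\<in>UNIV. of_real (T $ i $ j) * Zray p t $ j $ i) = \<i> * of_real (T $ i $ i) + (if i = p then \<i> * of_real (t * T $ p $ p) else 0)" by simp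
    qed
    then show ?thesis by (simp add: sum.distrib sum_distrib_left ring_distribs)
  qed
  have wr: "(\<Sum>i\<in>UNIV. Wray p y t $ i * of_real (R $ i)) = \<i> * of_real ((1 + t) * (y * R $ p))" for R t
  proof -
    have "(\<Sum>i\<in>UNIV. Wray p y t $ i * of_real (R $ i)) = (\<Sum>i\<in>UNIV. if i = p then \<i> * of_real ((1 + t) * (y * R $ p)) else 0)"
      by (intro sum.cong refl) (simp add: Wray_def mult_ac)
    then show ?thesis by simp
  qed
  have ne: "norm (e2pi (\<i> * of_real x)) = exp (- (2 * pi * x))" for x
    by (simp add: e2pi_def norm_exp_eq_Re)
  have nh: "norm (h t q) = norm (h 0 q) * exp (- (2 * pi * t * (fst q $ p $ p / real lam + snd q $ p * y)))" for t q
  proof -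
    have d: "\<i> * of_real x / of_nat lam = \<i> * of_real (x / real lam)" for x by simp
    show ?thesis
      unfolding h_def tr wr d norm_mult ne mult.assoc exp_add[symmetric]
      by (simp add: algebra_simps add_divide_distrib)
  qed
  have s0: "(\<lambda>q. norm (h 0 q)) summable_on fourier_index"
    using has_sum_imp_summable[OF hs[of 0]] by (simp add: summable_on_iff_abs_summable_on_complex)
  define C where "C = (\<Sum>\<^sub>\<infinity>q\<in>fourier_index. norm (h 0 q))"
  have "norm (\<phi> (Zray p t) (Wray p y t)) \<le> C * exp (2 * pi * t * d)" if t: "t \<ge> 0" for t
  proof -
    have le: "norm (h t q) \<le> norm (h 0 q) * exp (2 * pi * t * d)" if q: "q \<in> fourier_index" for q
    proof (cases "c (fst q) (snd q) = 0")
      case True then show ?thesis by (simp add: h_def)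
    next
      case False
      have "block_psd lam m (fst q) (snd q)" using psd q False by (auto simp: case_prod_unfold)
      moreover have "snd q $ p \<in> \<int>" using q by (auto simp: fourier_index_def)
      ultimately have "fst q $ p $ p / real lam + snd q $ p * y \<ge> - d" by (rule gap[OF lam])
      then have "2 * pi * t * (- d) \<le> 2 * pi * t * (fst q $ p $ p / real lam + snd q $ p * y)"
        using t by (intro mult_left_mono) auto
      then have "- (2 * pi * t * (fst q $ p $ p / real lam + snd q $ p * y)) \<le> 2 * pi * t * d"
        by linarith
      then show ?thesis unfolding nh[of t q] by (intro mult_left_mono) (simp_all only: exp_le_cancel_iff norm_ge_zero)
    qed
    have st: "(\<lambda>q. norm (h t q)) summable_on fourier_index"
      using has_sum_imp_summable[OF hs[OF t]] by (simp add: summable_on_iff_abs_summable_on_complex)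
    have "norm (\<phi> (Zray p t) (Wray p y t)) = norm (infsum (h t) fourier_index)"
      using hs[OF t] by (simp add: infsumI)
    also have "\<dots> \<le> (\<Sum>\<^sub>\<infinity>q\<in>fourier_index. norm (h t q))" by (rule norm_infsum_bound[OF st])
    also have "\<dots> \<le> (\<Sum>\<^sub>\<infinity>q\<in>fourier_index. norm (h 0 q) * exp (2 * pi * t * d))"
      by (rule infsum_mono[OF st summable_on_cmult_left[OF s0]]) (rule le)
    also have "\<dots> = C * exp (2 * pi * t * d)" unfolding C_def by (rule infsum_cmult_left')
    finally show ?thesis .
  qed
  then show ?thesis by blast
qed

text \<open>The rate is proportional to the degree, so it is additive in products of homogeneous
  components. The constants may depend on the element and its degree, since only the exponential
  rate matters.\<close>

lemma subalg_gen_growth: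
  fixes p :: "'g::finite"
  assumes S: "\<And>F l. F \<in> S \<Longrightarrow> \<exists>C. \<forall>t\<ge>0. norm (F l (Zray p t) (Wray p y t)) \<le> C * exp (2 * pi * t * (real l * K))"
    and F: "F \<in> subalg_gen S"
  shows "\<exists>C. \<forall>t\<ge>0. norm (F l (Zray p t) (Wray p y t)) \<le> C * exp (2 * pi * t * (real l * K))"
  using F
proof (induction arbitrary: l)
  case (gen F)
  then show ?case by (rule S)
next
  case one
  show ?case
    by (cases "l = 0") (auto simp: gone_def Zray_siegel_H intro!: exI[of _ 1])
next
  case (add F G)
  obtain C D where C: "\<And>t. t \<ge> 0 \<Longrightarrow> norm (F l (Zray p t) (Wray p y t)) \<le> C * exp (2 * pi * t * (real l * K))"
    and D: "\<And>t. t \<ge> 0 \<Longrightarrow> norm (G l (Zray p t) (Wray p y t)) \<le> D * exp (2 * pi * t * (real l * K))"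
    using add.IH by meson
  show ?case
  proof (intro exI[of _ "C + D"] allI impI)
    fix t :: real assume t: "t \<ge> 0"
    show "norm (gadd F G l (Zray p t) (Wray p y t)) \<le> (C + D) * exp (2 * pi * t * (real l * K))"
      unfolding gadd_def ring_distribs by (rule norm_triangle_le[OF add_mono[OF C[OF t] D[OF t]]])
  qed
next
  case (scale F c)
  obtain C where C: "\<And>t. t \<ge> 0 \<Longrightarrow> norm (F l (Zray p t) (Wray p y t)) \<le> C * exp (2 * pi * t * (real l * K))"
    using scale.IH by meson
  show ?case
  proof (intro exI[of _ "norm c * C"] allI impI)
    fix t :: real assume t: "t \<ge> 0"
    show "norm (gscale c F l (Zray p t) (Wray p y t)) \<le> (norm c * C) * exp (2 * pi * t * (real l * K))"
      unfolding gscale_def norm_mult mult.assoc[of "norm c" C] by (rule mult_left_mono[OF C[OF t]]) simp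
  qed
next
  case (mult F G)
  have "\<forall>i. \<exists>C. \<forall>t\<ge>0. norm (F i (Zray p t) (Wray p y t)) \<le> C * exp (2 * pi * t * (real i * K))"
    "\<forall>i. \<exists>C. \<forall>t\<ge>0. norm (G i (Zray p t) (Wray p y t)) \<le> C * exp (2 * pi * t * (real i * K))"
    using mult.IH by blast+
  then obtain C D where C: "\<And>i t. t \<ge> 0 \<Longrightarrow> norm (F i (Zray p t) (Wray p y t)) \<le> C i * exp (2 * pi * t * (real i * K))"
    and D: "\<And>i t. t \<ge> 0 \<Longrightarrow> norm (G i (Zray p t) (Wray p y t)) \<le> D i * exp (2 * pi * t * (real i * K))"
    by metis
  show ?case
  proof (intro exI[of _ "\<Sum>i\<le>l. C i * D (l - i)"] allI impI)
    fix t :: real assume t: "t \<ge> 0"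
    have "norm (gmult F G l (Zray p t) (Wray p y t)) \<le> (\<Sum>i\<le>l. (C i * D (l - i)) * exp (2 * pi * t * (real l * K)))"
      unfolding gmult_def
    proof (rule sum_norm_le)
      fix i assume i: "i \<in> {..l}"
      have "norm (F i (Zray p t) (Wray p y t) * G (l - i) (Zray p t) (Wray p y t)) \<le> (C i * exp (2 * pi * t * (real i * K))) * (D (l - i) * exp (2 * pi * t * (real (l - i) * K)))"
        unfolding norm_mult by (intro mult_mono C D t order_trans[OF norm_ge_zero C[OF t]]) auto
      also have "\<dots> = (C i * D (l - i)) * (exp (2 * pi * t * (real i * K)) * exp (2 * pi * t * (real (l - i) * K)))"
        by (simp add: mult_ac)
      also have "exp (2 * pi * t * (real i * K)) * exp (2 * pi * t * (real (l - i) * K)) = exp (2 * pi * t * (real l * K))"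
        using i by (simp add: of_nat_diff algebra_simps flip: exp_add)
      finally show "norm (F i (Zray p t) (Wray p y t) * G (l - i) (Zray p t) (Wray p y t)) \<le> (C i * D (l - i)) * exp (2 * pi * t * (real l * K))" .
    qed
    then show "norm (gmult F G l (Zray p t) (Wray p y t)) \<le> (\<Sum>i\<le>l. C i * D (l - i)) * exp (2 * pi * t * (real l * K))"
      by (simp add: sum_distrib_right)
  qed
qed

section \<open>The growth contradiction\<close>

lemma zero_jacobi_forms: "(\<lambda>_ _. 0) \<in> jacobi_forms k m (\<Gamma> :: (int ^ ('g::finite + 'g) ^ ('g + 'g)) set)"
proof -
  have "slash k m M (\<lambda>_ _. 0) = (\<lambda>_ _. 0)" for M :: "int ^ ('g + 'g) ^ ('g + 'g)"
    by (simp add: fun_eq_iff slash_altdef)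
  moreover have "has_fourier_exp m (\<lambda>(_ :: complex ^ 'g ^ 'g) (_ :: complex ^ 'g). 0)"
    unfolding has_fourier_exp_def by (intro exI[of _ 1] exI[of _ "\<lambda>_ _. 0"]) (auto simp: case_prod_unfold)
  moreover have "holo_HC (\<lambda>(_ :: complex ^ 'g ^ 'g) (_ :: complex ^ 'g). 0)"
    unfolding holo_HC_def by (intro ballI exI[of _ "\<lambda>_. 0"]) auto
  ultimately show ?thesis by (simp add: jacobi_forms_def heis_slash_def Let_def)
qed

theorem theorem6p9:
  fixes \<Gamma> :: "(int ^ ('g::finite + 'g) ^ ('g + 'g)) set"
    and k m :: nat
  assumes "is_subgroup_Sp \<Gamma>" and "finite_index_Sp \<Gamma>" and "neat \<Gamma>"
    and "k > 0" and "m > 0"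
  shows "\<not> finitely_generated_alg (jacobi_algebra k m \<Gamma>)"
proof
  assume "finitely_generated_alg (jacobi_algebra k m \<Gamma>)"
  then obtain S where S: "finite S" "S \<subseteq> jacobi_algebra k m \<Gamma>" "jacobi_algebra k m \<Gamma> \<subseteq> subalg_gen S"
    unfolding finitely_generated_alg_def by blast
  have \<Gamma>: "mat 1 \<in> \<Gamma>" "\<Gamma> \<subseteq> Sp_Z" using assms(1) by (auto simp: is_subgroup_Sp_def)
  have k: "k \<ge> 1" and m: "m \<ge> 1" using assms(4,5) by auto
  \<comment> \<open>A bound for the degrees of all nonzero components of generators; it is taken at
    least 1 so that division by \<open>L\<close> is harmless.\<close>
  obtain L where L1: "L \<ge> 1" and L: "\<And>F l. F \<in> S \<Longrightarrow> F l \<noteq> (\<lambda>_ _. 0) \<Longrightarrow> l \<le> L"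
  proof -
    have "finite (\<Union>F\<in>S. {l. F l \<noteq> (\<lambda>_ _. 0)})"
      using S(1,2) by (intro finite_UN_I) (auto simp: jacobi_algebra_def)
    then obtain L where "\<forall>l\<in>(\<Union>F\<in>S. {l. F l \<noteq> (\<lambda>_ _. 0)}). l \<le> L"
      using finite_nat_set_iff_bounded_le by blast
    then show ?thesis by (intro that[of "Suc L"]) (auto intro: le_SucI)
  qed
  \<comment> \<open>Any coordinate serves; the index type is nonempty, which encodes g \<ge>
    1.\<close>
  obtain p :: 'g where True by simp
  \<comment> \<open>Exceeds 2 l m for every l \<le> L, as the gap requires, and is at least 4 m, so
    that the exponent of the witness below is not negative.\<close>
  define n where "n = 4 * m * L + 1"
  have "n > 0" by (simp add: n_def)
  then have n0: "real n > 0" by simp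
  have m0: "real m > 0" using m by simp
  have L0: "real L \<ge> 1" using L1 by simp
  \<comment> \<open>A loss per degree valid for all generators: for 1 \<le> l \<le> L, l times
    \<open>d\<close> is at most the gap 1 / (4 l m n^2), because l^2 \<le> L^2.\<close>
  define d where "d = 1 / (4 * real m * (real L)^2 * (real n)^2)"
  have d0: "d > 0" using m0 n0 L0 by (simp add: d_def)
  define y where "y = 1 / real n"
  define K where "K = real m * y^2 - d"
  have gen: "\<exists>C. \<forall>t\<ge>0. norm (F l (Zray p t) (Wray p y t)) \<le> C * exp (2 * pi * t * (real l * K))" if F: "F \<in> S" for F l
  proof (cases "F l = (\<lambda>_ _. 0)")
    case True then show ?thesis by (intro exI[of _ 0]) simp
  next
    case False
    have lL: "l \<le> L" by (rule L[OF F False])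
    have Fl: "F l \<in> jacobi_forms (int (l * k)) (l * m) \<Gamma>" using F S(2) by (auto simp: jacobi_algebra_def)
    show ?thesis
    proof (rule jacobi_form_growth[OF Fl \<Gamma>])
      fix lam T and R :: "real ^ 'g" assume b: "lam > 0" "block_psd lam (l * m) T R" "R $ p \<in> \<int>"
      show "T $ p $ p / real lam + R $ p * y \<ge> - (real l * K)"
      proof (cases "l = 0")
        case True
        then show ?thesis using block_psd_diagonal[OF b(2), of p y] by simp
      next
        case False
        then have l1: "real l \<ge> 1" by simp
        have "l * m \<le> L * m" using lL by simp
        moreover have "n = 4 * (L * m) + 1" by (simp add: n_def)
        ultimately have "2 * (l * m) < n" by linarith
        moreover have "l * m > 0" using False m by simp
        ultimately have g: "T $ p $ p / real lam + R $ p / real n + real (l * m) / (real n)^2 \<ge> 1 / (4 * real (l * m) * (real n)^2)"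
          using block_psd_gap[OF b(2,3)] by blast
        have "real l * d \<le> 1 / (4 * real (l * m) * (real n)^2)"
        proof -
          have "(real l)^2 \<le> (real L)^2" using lL by (intro power_mono) auto
          then have "(real l)^2 / (real L)^2 \<le> 1" using L0 by simp
          then have "((real l)^2 / (real L)^2) * (1 / (4 * real l * real m * (real n)^2)) \<le> 1 * (1 / (4 * real l * real m * (real n)^2))"
            using l1 m0 n0 by (intro mult_right_mono) auto
          then show ?thesis using l1 by (simp add: d_def power2_eq_square field_simps)
        qed
        then show ?thesis using g by (simp add: K_def y_def power_divide algebra_simps)
      qed
    qed
  qed
  \<comment> \<open>Powers b of Theta(Z, 0) and c of Theta(Z, n W) have weight 4 (b + c) and index c
    n^2. Matching l0 k and l0 m with l0 = 4 n^2 gives c = 4 m and b = n^2 k - 4 m.\<close>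
  define \<phi> :: "complex ^ 'g ^ 'g \<Rightarrow> complex ^ 'g \<Rightarrow> complex" where "\<phi> = (\<lambda>Z W. hpow (\<lambda>Z W. Theta Z (of_nat 0 *s W)) (n^2 * k - 4 * m) Z W * hpow (\<lambda>Z W. Theta Z (of_nat n *s W)) (4 * m) Z W)"
  define l0 where "l0 = 4 * n^2"
  have big: "4 * m \<le> n^2 * k"
  proof -
    have "4 * m * 1 \<le> 4 * m * L" using L1 by (intro mult_le_mono2)
    then have "4 * m * 1 \<le> n" unfolding n_def by linarith
    also have "n \<le> n * n" using \<open>n > 0\<close> by simp
    also have "n * n \<le> n * n * k" using k by simp
    finally show ?thesis by (simp add: power2_eq_square)
  qed
  have "full_form (int (n^2 * k - 4 * m) * 4 + int (4 * m) * 4) ((n^2 * k - 4 * m) * (1 * 0^2) + (4 * m) * (1 * n^2)) \<phi>"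
    unfolding \<phi>_def by (intro full_form_mult full_form_hpow full_form_scale full_form_Theta)
  moreover have "int (n^2 * k - 4 * m) * 4 + int (4 * m) * 4 = int (l0 * k)"
    using big by (simp add: l0_def of_nat_diff)
  moreover have "(n^2 * k - 4 * m) * (1 * 0^2) + (4 * m) * (1 * n^2) = l0 * m" by (simp add: l0_def)
  ultimately have ff: "full_form (int (l0 * k)) (l0 * m) \<phi>" by (simp only:)
  define F where "F = (\<lambda>l. if l = l0 then \<phi> else (\<lambda>_ _. 0))"
  have "F \<in> jacobi_algebra k m \<Gamma>"
  proof -
    have "F l \<in> jacobi_forms (int (l * k)) (l * m) \<Gamma>" for l
      using full_form_jacobi_forms[OF ff \<Gamma>(2)] zero_jacobi_forms by (auto simp: F_def)
    moreover have "finite {l. F l \<noteq> (\<lambda>_ _. 0)}"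
      by (rule finite_subset[of _ "{l0}"]) (auto simp: F_def)
    ultimately show ?thesis by (simp add: jacobi_algebra_def)
  qed
  then have FS: "F \<in> subalg_gen S" using S(3) by blast
  have "\<exists>C. \<forall>t\<ge>0. norm (F l0 (Zray p t) (Wray p y t)) \<le> C * exp (2 * pi * t * (real l0 * K))"
    by (rule subalg_gen_growth[OF _ FS]) (rule gen)
  then obtain C where C: "\<And>t. t \<ge> 0 \<Longrightarrow> norm (\<phi> (Zray p t) (Wray p y t)) \<le> C * exp (2 * pi * t * (real l0 * K))"
    by (auto simp: F_def)
  have lower: "exp (2 * pi * t * (4 * real m)) \<le> norm (\<phi> (Zray p t) (Wray p y t))" if t: "t \<ge> 0" for t
  proof -
    have "norm (Theta (Zray p t) 0) ^ (n^2 * k - 4 * m) \<ge> 1" by (rule one_le_power[OF norm_Theta_Zray[OF t]])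
    moreover have "norm (Theta (Zray p t) (of_nat n *s Wray p y t)) ^ (4 * m) \<ge> exp (2 * pi * t) ^ (4 * m)"
      unfolding y_def by (intro power_mono norm_Theta_ray[OF t]) (auto simp: n_def)
    moreover have "exp (2 * pi * t) ^ (4 * m) = exp (2 * pi * t * (4 * real m))"
      by (simp add: mult_ac flip: exp_of_nat_mult)
    ultimately have "1 * exp (2 * pi * t * (4 * real m)) \<le> norm (Theta (Zray p t) 0) ^ (n^2 * k - 4 * m) * norm (Theta (Zray p t) (of_nat n *s Wray p y t)) ^ (4 * m)"
      by (intro mult_mono) auto
    then show ?thesis
      by (simp add: \<phi>_def hpow_eq[OF Zray_siegel_H[OF t]] norm_mult norm_power)
  qed
  \<comment> \<open>In degree l0 the generated algebra allows the rate 4 m minus a positive amount,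
    whereas the witness attains 4 m.\<close>
  have lK: "real l0 * K = 4 * real m - real l0 * d"
    using n0 by (simp add: K_def l0_def y_def power_divide field_simps)
  define e where "e = 2 * pi * (real l0 * d)"
  have e0: "e > 0" using d0 n0 by (simp add: e_def l0_def)
  have "exp (t * e) \<le> C" if t: "t \<ge> 0" for t
  proof -
    have "exp (t * e) * exp (2 * pi * t * (real l0 * K)) = exp (2 * pi * t * (4 * real m))"
      unfolding lK e_def by (simp add: algebra_simps flip: exp_add)
    also have "\<dots> \<le> C * exp (2 * pi * t * (real l0 * K))" using lower[OF t] C[OF t] by linarith
    finally show ?thesis by simp
  qed
  \<comment> \<open>At t = |C| / e the bound reads exp |C| \<le> C, contradicting exp s \<ge> 1 +
    s.\<close>
  from this[of "\<bar>C\<bar> / e"] have "exp \<bar>C\<bar> \<le> C" using e0 by simp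
  then show False using exp_ge_add_one_self[of "\<bar>C\<bar>"] by linarith
qed

end
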